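(* Let $k,l$ be natural numbers with $1<k\le l$ and let $m=k+l-1$. Every $\left(12l\left\lceil\frac{2m}{k-1}\right\rceil+6m-4\right)$-edge-connected bipartite simple graph whose number of edges is divisible by $m$ has an $S(k,l)$-decomposition. In particular, every $(72k+236)$-edge-connected bipartite simple graph whose number of edges is divisible by $2k$ has an $S(k,k+1)$-decomposition.
   Context: $S(k,l)$ denotes the bistar: the tree consisting of two adjacent vertices of degrees $k$ and $l$ respectively, all other vertices being leaves (so it has $k+l-1$ edges). An $H$-decomposition of a graph $G$ is a partition of $E(G)$ into subgraphs isomorphic to $H$. *)

theory Defs
  imports Complex_Main
begin

text \<open>A finite simple graph: vertex set V, edge set E of 2-element subsets of V.\<close>
definition simple_graph :: "'a set \<Rightarrow> 'a set set \<Rightarrow> bool" where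
  "simple_graph V E \<longleftrightarrow> finite V \<and> (\<forall>e\<in>E. e \<subseteq> V \<and> card e = 2)"

definition bipartite :: "'a set \<Rightarrow> 'a set set \<Rightarrow> bool" where
  "bipartite V E \<longleftrightarrow> (\<exists>A \<subseteq> V. \<forall>e\<in>E. card (e \<inter> A) = 1)"

text \<open>Adjacency relation induced by an edge set.\<close>
definition adj_rel :: "'a set set \<Rightarrow> ('a \<times> 'a) set" where
  "adj_rel E = {(u, v). {u, v} \<in> E}"

definition connected_graph :: "'a set \<Rightarrow> 'a set set \<Rightarrow> bool" where
  "connected_graph V E \<longleftrightarrow> (\<forall>u\<in>V. \<forall>v\<in>V. (u, v) \<in> (adj_rel E)\<^sup>*)"

text \<open>\<lambda>-edge-connected: deleting fewer than \<lambda> edges leaves the graph connected.\<close>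
definition edge_connected :: "nat \<Rightarrow> 'a set \<Rightarrow> 'a set set \<Rightarrow> bool" where
  "edge_connected c V E \<longleftrightarrow> (\<forall>F \<subseteq> E. card F < c \<longrightarrow> connected_graph V (E - F))"

text \<open>Edge set of a copy of the bistar S(k,l): adjacent centres u (degree k) and v
  (degree l), u having k-1 further leaf neighbours A, v having l-1 further leaf neighbours B.\<close>
definition is_bistar :: "nat \<Rightarrow> nat \<Rightarrow> 'a set set \<Rightarrow> bool" where
  "is_bistar k l F \<longleftrightarrow> (\<exists>u v A B. u \<noteq> v \<and> finite A \<and> finite B \<and> A \<inter> B = {} \<and>
     u \<notin> A \<union> B \<and> v \<notin> A \<union> B \<and> card A = k - 1 \<and> card B = l - 1 \<and>
     F = {{u, v}} \<union> {{u, x} | x. x \<in> A} \<union> {{v, y} | y. y \<in> B})"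

text \<open>An H-decomposition: a partition of E into edge sets each forming a copy of H.\<close>
definition bistar_decomposition :: "nat \<Rightarrow> nat \<Rightarrow> 'a set set \<Rightarrow> 'a set set set \<Rightarrow> bool" where
  "bistar_decomposition k l E P \<longleftrightarrow> \<Union>P = E \<and>
     (\<forall>F\<in>P. \<forall>G\<in>P. F \<noteq> G \<longrightarrow> F \<inter> G = {}) \<and> (\<forall>F\<in>P. is_bistar k l F)"

definition has_bistar_decomposition :: "nat \<Rightarrow> nat \<Rightarrow> 'a set set \<Rightarrow> bool" where
  "has_bistar_decomposition k l E \<longleftrightarrow> (\<exists>P. bistar_decomposition k l E P)"

end

theory Submission
  imports Defs
begin

text \<open>
  With $u$ in one colour class as centre of degree $l$ and its neighbour in the other class as centre
  of degree $k$, a bistar decomposition of a bipartite graph $G$ amounts to subgraphs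
  $M \subseteq K \subseteq G$ in which every vertex of the first class has $M$-degree $n$,
  $K$-degree $kn$ and $G$-degree $mn$, $m = k + l - 1$, for some $n$, and every vertex of the second class has
  $K$-degree $k$ times its $M$-degree. Given $K$ with all degrees divisible by $k$, the uniform weight
  $1/k$ rounds to such an $M$.

  The edge set is first packed into three parts, each with many edges across every vertex partition.
  Orienting the first part with prescribed out-degrees modulo $m$ and adding the two others splits $E$
  into $G_1$ and $G_2$ whose degrees are divisible by $m$ in one colour class each. Inside $G_1$ the
  second part contains a subgraph of small degree in the first class that is still well connected;
  orienting it, balanced in the first class and modulo $k$ in the second, yields $K$.

  Both the packing and the low-degree subgraph come from one Rado-type selection theorem, applied to
  the supermodular number of components. The orientation theorem is a variant, with weaker constants,
  of the one of Lovasz, Thomassen, Wu and Zhang: in a minimal counterexample no small cut can be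
  contracted, so every nontrivial cut is large and edges can be lifted or deleted freely as long as the
  conditions at single vertices are kept.
\<close>

section \<open>Orientations modulo $m$\<close>

text \<open>Uniform fractional weights would meet all demands; the difficulty is to round them and
  keep many edges across every vertex partition. The condition
  \<open>int q * (comps V F - 1) \<le> int (card (X - F))\<close> for all \<open>F\<close> is the
  Nash-Williams-Tutte condition for \<open>q\<close> edge-disjoint spanning trees in
  \<open>X\<close>. Its left side is supermodular in \<open>F\<close>, so it can be both obtained
  from and fed into the selection theorem, and it bounds every cut of \<open>X\<close> below by
  \<open>q\<close>.

  Low degree matters for the following reason. At a vertex of \<open>G\<close>-degree
  \<open>m * n\<close> the balanced orientation uses \<open>2 * p\<close> edges and puts
  \<open>p\<close> of them into \<open>K\<close>. The other \<open>k * n - p\<close> edges of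
  \<open>K\<close> must come from the remaining \<open>m * n - 2 * p\<close>, so \<open>p\<close>
  has to be at most \<open>(l - 1) * n\<close>.

  Orienting modulo \<open>m\<close> asks for cuts of \<open>8 * m - 3\<close> edges, modulo
  \<open>k\<close> for \<open>8 * k - 3\<close>. If each of the two other parts gets
  \<open>t\<close>, the packing costs \<open>8 * m - 3 + 2 * t\<close>; the edge-connectivity is
  twice that because an edge leaves two classes of a partition. The size of \<open>t\<close> is
  dictated by thinning a part from \<open>t\<close> down to \<open>8 * k - 3\<close> with degrees
  below \<open>2 * (k - 1) * n\<close>.\<close>

definition cutd :: "'i set \<Rightarrow> ('i \<Rightarrow> 'v) \<Rightarrow> ('i \<Rightarrow> 'v) \<Rightarrow> 'v set \<Rightarrow> int" where
  "cutd I h t A = (\<Sum>i\<in>I. of_bool ((h i \<in> A) \<noteq> (t i \<in> A)))"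

text \<open>Out-degree minus in-degree, where \<open>q i = 1\<close> directs edge \<open>i\<close>
  from \<open>h i\<close> to \<open>t i\<close> and \<open>q i = -1\<close> the other way; loops
  cancel.\<close>

definition net :: "'i set \<Rightarrow> ('i \<Rightarrow> 'v) \<Rightarrow> ('i \<Rightarrow> 'v) \<Rightarrow> ('i \<Rightarrow> int) \<Rightarrow> 'v \<Rightarrow> int" where
  "net I h t q x = (\<Sum>i\<in>I. q i * (of_bool (h i = x) - of_bool (t i = x)))"

text \<open>In the ranges used below \<open>\<tau>\<close> is nonnegative away from \<open>s\<close>
  and nonpositive at \<open>s\<close>, so this is a constant plus the absolute value of
  \<open>\<tau> y\<close>. It has the same parity as \<open>\<tau> y\<close>, hence as the
  degree.\<close>

definition need :: "int \<Rightarrow> 'v \<Rightarrow> ('v \<Rightarrow> int) \<Rightarrow> 'v \<Rightarrow> int" where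
  "need m s \<tau> y = (if y = s then 4 * m - 2 - \<tau> y else 6 * m - 2 + \<tau> y)"

text \<open>Outside \<open>H\<close> the balance vanishes exactly, not only modulo
  \<open>2 * m\<close>. Lifting preserves precisely this: when a lifted pair is split again, one of
  its edges enters the vertex and the other leaves it.\<close>

definition solves ::
  "int \<Rightarrow> 'v set \<Rightarrow> 'v set \<Rightarrow> 'v \<Rightarrow> 'i set \<Rightarrow> ('i \<Rightarrow> 'v) \<Rightarrow> ('i \<Rightarrow> 'v) \<Rightarrow> ('i \<Rightarrow> int) \<Rightarrow> ('v \<Rightarrow> int) \<Rightarrow> ('i \<Rightarrow> int) \<Rightarrow> bool" where
  "solves m V H z I h t p \<tau> q \<longleftrightarrow>
     (\<forall>i\<in>I. q i = 1 \<or> q i = -1) \<and> (\<forall>i\<in>I. h i = z \<or> t i = z \<longrightarrow> q i = p i) \<and>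
     (\<forall>x\<in>H. 2 * m dvd net I h t q x - \<tau> x) \<and> (\<forall>x\<in>V - H. net I h t q x = 0)"

lemma sum_of_bool_eq: "finite A \<Longrightarrow> (\<Sum>x\<in>A. of_bool (a = x)) = (of_bool (a \<in> A) :: int)"
  by (simp add: of_bool_def)

lemma sum_net:
  assumes "finite A"
  shows "(\<Sum>x\<in>A. net I h t q x) = (\<Sum>i\<in>I. q i * (of_bool (h i \<in> A) - of_bool (t i \<in> A)))"
proof -
  have "(\<Sum>x\<in>A. net I h t q x) = (\<Sum>i\<in>I. \<Sum>x\<in>A. q i * (of_bool (h i = x) - of_bool (t i = x)))"
    unfolding net_def by (rule sum.swap)
  also have "\<dots> = (\<Sum>i\<in>I. q i * (of_bool (h i \<in> A) - of_bool (t i \<in> A)))"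
    by (intro sum.cong refl, simp only: sum_distrib_left [symmetric] sum_subtractf sum_of_bool_eq[OF assms])
  finally show ?thesis .
qed

text \<open>An edge that is no loop is counted once for each of its ends in \<open>A\<close>, and
  that number is odd exactly when the edge leaves \<open>A\<close>.\<close>

lemma cutd_parity:
  assumes "finite A"
  shows "even ((\<Sum>x\<in>A. cutd I h t {x}) - cutd I h t A)"
proof -
  have "(\<Sum>x\<in>A. cutd I h t {x}) = (\<Sum>i\<in>I. \<Sum>x\<in>A. of_bool ((h i = x) \<noteq> (t i = x)))"
    unfolding cutd_def by (subst sum.swap) simp
  then have eq: "(\<Sum>x\<in>A. cutd I h t {x}) - cutd I h t A =
      (\<Sum>i\<in>I. (\<Sum>x\<in>A. of_bool ((h i = x) \<noteq> (t i = x))) - of_bool ((h i \<in> A) \<noteq> (t i \<in> A)))"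
    unfolding cutd_def by (simp add: sum_subtractf)
  have "even ((\<Sum>x\<in>A. of_bool ((a = x) \<noteq> (b = x))) - (of_bool ((a \<in> A) \<noteq> (b \<in> A)) :: int))" for a b
  proof (cases "a = b")
    case False
    then have "(\<Sum>x\<in>A. of_bool ((a = x) \<noteq> (b = x))) = (\<Sum>x\<in>A. of_bool (a = x) + of_bool (b = x) :: int)"
      by (intro sum.cong) auto
    also have "\<dots> = of_bool (a \<in> A) + of_bool (b \<in> A)"
      by (simp only: sum.distrib sum_of_bool_eq[OF assms])
    finally have e: "(\<Sum>x\<in>A. of_bool ((a = x) \<noteq> (b = x))) = (of_bool (a \<in> A) + of_bool (b \<in> A) :: int)" .
    show ?thesis unfolding e by simp
  qed simp
  then show ?thesis unfolding eq by (intro dvd_sum) simp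
qed

lemma cutd_nonneg: "0 \<le> cutd I h t A"
  unfolding cutd_def by (intro sum_nonneg) simp

lemma finite_minimizer:
  fixes f :: "'b \<Rightarrow> 'c::linorder"
  assumes "finite S" "S \<noteq> {}"
  obtains x where "x \<in> S" "\<And>y. y \<in> S \<Longrightarrow> f x \<le> f y"
proof -
  have "Min (f ` S) \<in> f ` S" using assms by simp
  then obtain x where "x \<in> S" "f x = Min (f ` S)" by force
  then show ?thesis using that[of x] assms(1) by simp
qed

text \<open>
  Edges are indexed by \<open>I\<close> with ends \<open>h i\<close>, \<open>t i\<close>; the edges at the extra vertex \<open>z\<close> are already
  oriented by \<open>p\<close>. The balance of an orientation must be congruent to \<open>\<tau>\<close> modulo \<open>2 * m\<close> at the
  vertices of \<open>H\<close> and zero at the others. The parity convention turns residues of out-degrees modulo \<open>m\<close>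
  into residues of balances modulo \<open>2 * m\<close>. At most one vertex \<open>s\<close> may have a negative \<open>\<tau>\<close>, and there
  the degree condition is relaxed by \<open>2 * m\<close> (\<open>s \<notin> H\<close> means that there is none); deleting an edge
  directed from a vertex with positive \<open>\<tau>\<close> to \<open>s\<close> preserves the degree conditions at both ends.

  The constants are chosen so that \<open>8 * m - 3\<close> bounds the requirement at a single vertex, lifting two edges
  keeps a cut of more than \<open>8 * m - 2\<close> edges above \<open>8 * m - 3\<close>, and two remaining vertices are joined by
  at least \<open>((6 * m - 2) + (4 * m - 2) - (8 * m - 2)) / 2 = m - 1\<close> edges, enough for every residue.
\<close>

locale mod_problem =
  fixes m :: int and V H :: "'v set" and s z :: 'v
    and I :: "'i set" and h t :: "'i \<Rightarrow> 'v" and p :: "'i \<Rightarrow> int" and \<tau> :: "'v \<Rightarrow> int"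
  assumes m1: "1 \<le> m" and finV: "finite V" and finI: "finite I" and zV: "z \<notin> V"
    and ends: "\<And>i. i \<in> I \<Longrightarrow> h i \<in> insert z V \<and> t i \<in> insert z V"
    and HV: "H \<subseteq> V" and Hne: "H \<noteq> {}"
    and pm: "\<And>i. i \<in> I \<Longrightarrow> p i = 1 \<or> p i = -1"
    and parity: "\<And>x. x \<in> V \<Longrightarrow> even (\<tau> x - cutd I h t {x})"
    and light: "\<And>x. x \<in> V - H \<Longrightarrow> \<tau> x = 0"
    and range: "\<And>x. x \<in> H \<Longrightarrow> x \<noteq> s \<Longrightarrow> 0 \<le> \<tau> x \<and> \<tau> x < 2 * m"
    and srange: "s \<in> H \<Longrightarrow> - 2 * m < \<tau> s \<and> \<tau> s \<le> 0"
    and cut1: "\<And>A y. A \<subseteq> V \<Longrightarrow> A \<inter> H = {y} \<Longrightarrow> H \<noteq> {y} \<Longrightarrow> need m s \<tau> y \<le> cutd I h t A"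
    and cut2: "\<And>A. A \<subseteq> V \<Longrightarrow> 2 \<le> card (A \<inter> H) \<Longrightarrow> \<not> H \<subseteq> A \<Longrightarrow> 8 * m - 3 \<le> cutd I h t A"
    and cut3: "\<And>A. H \<subseteq> A \<Longrightarrow> A \<subseteq> V \<Longrightarrow> cutd I h t V \<le> cutd I h t A"
    and cutV: "cutd I h t V \<le> 8 * m - 2"
    and total: "2 * m dvd (\<Sum>x\<in>V. \<tau> x) + net I h t p z"
begin

section \<open>Contractible sets, and the slack in all cuts when there are none\<close>

abbreviation d where "d \<equiv> cutd I h t"

text \<open>The conditions are what the two contracted problems require. The size conditions make
  both of them smaller, \<open>A \<inter> H \<noteq> {}\<close> leaves a vertex of \<open>H\<close>
  in each, the bound on \<open>d A\<close> becomes \<open>cutV\<close> of the inner problem, and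
  minimality among subsets with the same trace on \<open>H\<close> becomes its
  \<open>cut3\<close>.\<close>

definition contractible where
  "contractible A \<longleftrightarrow> A \<subseteq> V \<and> A \<noteq> V \<and> 2 \<le> card A \<and> A \<inter> H \<noteq> {} \<and> d A \<le> 8 * m - 2 \<and>
     (\<forall>A'\<subseteq>A. A' \<inter> H = A \<inter> H \<longrightarrow> d A \<le> d A')"

lemma finS: "A \<subseteq> V \<Longrightarrow> finite A"
  using finV finite_subset by blast

lemma sum_tau_H: "A \<subseteq> V \<Longrightarrow> (\<Sum>x\<in>A. \<tau> x) = (\<Sum>x\<in>A \<inter> H. \<tau> x)"
  by (rule sum.mono_neutral_right) (auto intro: finS light)

lemma parity_set: assumes "A \<subseteq> V" shows "even (d A - (\<Sum>x\<in>A \<inter> H. \<tau> x))"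
proof -
  have "even ((\<Sum>x\<in>A. d {x}) - d A)" by (rule cutd_parity) (rule finS[OF assms])
  moreover have "even (\<Sum>x\<in>A. \<tau> x - d {x})" by (intro dvd_sum) (use assms parity in blast)
  ultimately show ?thesis by (simp add: sum_subtractf sum_tau_H[OF assms, symmetric])
qed

lemma need_bound: "y \<in> H \<Longrightarrow> need m s \<tau> y \<le> 8 * m - 3"
  using range[of y] srange m1 by (auto simp: need_def)

context
  assumes nc: "\<And>A. \<not> contractible A"
begin

text \<open>Among the sets with the given trace on \<open>H\<close>, one of least cut would be
  contractible if its cut were at most \<open>8 * m - 2\<close>. The gain of two over
  \<open>cut2\<close> is what one lift may cost.\<close>

lemma nc2:
  assumes "A \<subseteq> V" "2 \<le> card (A \<inter> H)" "\<not> H \<subseteq> A"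
  shows "8 * m - 1 \<le> d A"
proof (rule ccontr)
  assume c: "\<not> ?thesis"
  let ?S = "{B. B \<subseteq> V \<and> B \<inter> H = A \<inter> H}"
  have "finite ?S" using finV by simp
  moreover have "?S \<noteq> {}" using assms by blast
  ultimately obtain B where B: "B \<in> ?S" and min: "\<And>C. C \<in> ?S \<Longrightarrow> d B \<le> d C"
    by (rule finite_minimizer[of ?S d]) blast
  have "card (A \<inter> H) \<le> card B" using B by (intro card_mono finS) auto
  moreover have "d B \<le> d A" using min assms(1) by blast
  moreover have "A \<inter> H \<noteq> {}" using assms(2) by force
  moreover have "B \<noteq> V" using B HV assms(3) by blast
  moreover have "d B \<le> d A'" if "A' \<subseteq> B" "A' \<inter> H = B \<inter> H" for A'
    using min[of A'] B that by blast
  ultimately have "contractible B" unfolding contractible_def using B c assms by (intro conjI) (simp_all)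
  with nc show False by blast
qed

text \<open>A violating set other than \<open>{y}\<close> of least cut has, by parity, at most
  \<open>need m s \<tau> y\<close> leaving edges. That is no more than \<open>{y}\<close> itself
  has, so not even the excluded competitor \<open>{y}\<close> stops it from being
  contractible.\<close>

lemma nc1:
  assumes "A \<subseteq> V" "A \<inter> H = {y}" "H \<noteq> {y}" "A \<noteq> {y}"
  shows "need m s \<tau> y + 2 \<le> d A"
proof (rule ccontr)
  assume c: "\<not> ?thesis"
  have yH: "y \<in> H" "y \<in> V" using assms by auto
  let ?S = "{B. B \<subseteq> V \<and> B \<inter> H = {y} \<and> B \<noteq> {y}}"
  have "finite ?S" using finV by simp
  moreover have "?S \<noteq> {}" using assms by blast
  ultimately obtain B where B: "B \<in> ?S" and min: "\<And>C. C \<in> ?S \<Longrightarrow> d B \<le> d C"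
    by (rule finite_minimizer[of ?S d]) blast
  have par: "even (d C - \<tau> y)" if "C \<subseteq> V" "C \<inter> H = {y}" for C
    using parity_set[OF that(1)] that(2) by simp
  have "d B \<le> d A" using min assms by blast
  then have le: "d B < need m s \<tau> y + 2" using c by simp
  moreover have need: "need m s \<tau> y \<le> d C" if "C \<subseteq> V" "C \<inter> H = {y}" for C using cut1 that assms by blast
  moreover have "even (need m s \<tau> y - \<tau> y)" by (simp add: need_def)
  moreover have "even (d B - \<tau> y)" "even (d {y} - \<tau> y)" "need m s \<tau> y \<le> d {y}"
    using par[of B] par[of "{y}"] need[of "{y}"] B yH by auto
  ultimately have "d B \<le> d {y}" by presburger
  moreover have "2 \<le> card B"
  proof -
    have "card {y} < card B" using B by (intro psubset_card_mono finS) auto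
    then show ?thesis by simp
  qed
  moreover have "B \<noteq> V" using B HV assms(3) by blast
  moreover have "d B \<le> 8 * m - 2" using le need_bound[OF yH(1)] by simp
  moreover have "d B \<le> d A'" if "A' \<subseteq> B" "A' \<inter> H = B \<inter> H" for A'
    using min[of A'] B that calculation(1) by blast
  ultimately have "contractible B" unfolding contractible_def using B by (intro conjI) auto
  with nc show False by blast
qed

text \<open>A cut as small as that of \<open>V\<close> would be a minimum by \<open>cut3\<close>,
  hence contractible; parity turns strict inequality into a gap of two.\<close>

lemma nc3:
  assumes "H \<subseteq> A" "A \<subseteq> V" "A \<noteq> V" "2 \<le> card A"
  shows "d V + 2 \<le> d A"
proof (rule ccontr)
  assume c: "\<not> ?thesis"
  have "even (d A - (\<Sum>x\<in>H. \<tau> x))" "even (d V - (\<Sum>x\<in>H. \<tau> x))"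
    using parity_set[OF assms(2)] parity_set[of V] assms HV by (simp_all add: Int_absorb1)
  moreover have "d V \<le> d A" using cut3 assms by blast
  ultimately have eq: "d A = d V" using c by presburger
  moreover have "d V \<le> d A'" if "A' \<subseteq> A" "A' \<inter> H = A \<inter> H" for A'
    using cut3[of A'] that assms by blast
  moreover have "A \<inter> H \<noteq> {}" using assms Hne by blast
  ultimately have "contractible A" unfolding contractible_def using assms cutV by auto
  with nc show False by blast
qed

end

section \<open>Reductions: removing, lifting and directing\<close>

lemma remove_isolated:
  assumes x: "x \<in> V - H" and d0: "d {x} = 0"
  defines "I' \<equiv> {i \<in> I. h i \<noteq> x \<and> t i \<noteq> x}"
  shows "mod_problem m (V - {x}) H s z I' h t p \<tau>"
    and "solves m (V - {x}) H z I' h t p \<tau> q \<Longrightarrow> \<exists>q'. solves m V H z I h t p \<tau> q'"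
proof -
  have loop: "(h i = x) = (t i = x)" if "i \<in> I" for i
    using d0 that unfolding cutd_def by (subst (asm) sum_nonneg_eq_0_iff) (auto simp: finI)
  have cut: "cutd I' h t A = d A" for A
    unfolding cutd_def
  proof (rule sum.mono_neutral_left)
    have "(h i \<in> A) = (t i \<in> A)" if "i \<in> I - I'" for i
      using that loop[of i] by (auto simp: I'_def)
    then show "\<forall>i\<in>I - I'. of_bool ((h i \<in> A) \<noteq> (t i \<in> A)) = (0::int)" by simp
  qed (auto simp: I'_def finI)
  have cutx: "d (A - {x}) = d A" for A
    unfolding cutd_def
  proof (intro sum.cong refl)
    fix i assume "i \<in> I"
    then show "of_bool ((h i \<in> A - {x}) \<noteq> (t i \<in> A - {x})) = (of_bool ((h i \<in> A) \<noteq> (t i \<in> A)) :: int)"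
      using loop[of i] by auto
  qed
  have nt: "net I' h t q y = net I h t q y" for q y
    unfolding net_def
  proof (rule sum.mono_neutral_left)
    have "h i = t i" if "i \<in> I - I'" for i
      using that loop[of i] by (auto simp: I'_def)
    then show "\<forall>i\<in>I - I'. q i * (of_bool (h i = y) - of_bool (t i = y)) = 0" by simp
  qed (auto simp: I'_def finI)
  have netx: "net I h t q x = 0" for q
    unfolding net_def by (intro sum.neutral) (use loop in auto)
  have sumt: "(\<Sum>y\<in>V - {x}. \<tau> y) = (\<Sum>y\<in>V. \<tau> y)"
    using x light[OF x] finV by (simp add: sum.remove[of V x])
  show "mod_problem m (V - {x}) H s z I' h t p \<tau>"
  proof (unfold_locales, unfold cut nt sumt cutx)
    show "finite I'" using finI by (simp add: I'_def)
    show "h i \<in> insert z (V - {x}) \<and> t i \<in> insert z (V - {x})" if "i \<in> I'" for i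
      using that ends unfolding I'_def by blast
    show "H \<subseteq> V - {x}" using x HV by blast
    show "p i = 1 \<or> p i = -1" if "i \<in> I'" for i using that pm unfolding I'_def by blast
    show "d V \<le> d A" if "H \<subseteq> A" "A \<subseteq> V - {x}" for A using cut3 that by blast
    show "need m s \<tau> y \<le> d A" if "A \<subseteq> V - {x}" "A \<inter> H = {y}" "H \<noteq> {y}" for A y
      using cut1 that by blast
    show "8 * m - 3 \<le> d A" if "A \<subseteq> V - {x}" "2 \<le> card (A \<inter> H)" "\<not> H \<subseteq> A" for A
      using cut2 that by blast
    show "\<tau> y = 0" if "y \<in> V - {x} - H" for y using that light by blast
  qed (use m1 finV zV Hne range srange cutV total parity in auto)
  assume q: "solves m (V - {x}) H z I' h t p \<tau> q"
  \<comment> \<open>The removed edges are loops at \<open>x\<close>; they affect no balance, and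
    \<open>p\<close> serves as a default value for them.\<close>
  let ?q = "\<lambda>i. if i \<in> I' then q i else p i"
  have "net I' h t ?q y = net I' h t q y" for y unfolding net_def by (intro sum.cong) auto
  then have n: "net I h t ?q y = net I h t q y" for y by (simp add: nt)
  have "solves m V H z I h t p \<tau> ?q"
    using q pm netx[of q] unfolding solves_def n nt by auto
  then show "\<exists>q'. solves m V H z I h t p \<tau> q'" by blast
qed

text \<open>The edges \<open>i\<close> and \<open>j\<close> from \<open>x\<close> to
  \<open>P = oth i\<close> and \<open>Q = oth j\<close> are replaced by one edge \<open>P Q\<close>,
  which reuses the index \<open>i\<close>. A cut loses two edges exactly when it separates
  \<open>x\<close> from both \<open>P\<close> and \<open>Q\<close>. If \<open>P \<noteq> Q\<close>,
  the absence of contractible sets supplies this slack. If \<open>P = Q\<close>, the hypothesis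
  \<open>dist\<close> says that all edges at \<open>x\<close> lead to \<open>P\<close>, and moving
  \<open>x\<close> across the cut supplies it. If \<open>Q = z\<close>, the new edge inherits the
  prescribed direction of \<open>j\<close>.\<close>

lemma lift_pair:
  assumes nc: "\<And>A. \<not> contractible A"
    and x: "x \<in> V - H" and i: "i \<in> I" and j: "j \<in> I" and ij: "i \<noteq> j"
    and xi: "(h i = x) \<noteq> (t i = x)" and xj: "(h j = x) \<noteq> (t j = x)"
  defines "oth \<equiv> \<lambda>k. if h k = x then t k else h k"
    and "sg \<equiv> \<lambda>k. if h k = x then 1 else (-1::int)"
  assumes Pz: "oth i \<noteq> z"
    and dist: "oth i \<noteq> oth j \<or> (\<forall>k\<in>I. (h k = x) \<noteq> (t k = x) \<longrightarrow> oth k = oth i)"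
  defines "I' \<equiv> I - {j}" and "h' \<equiv> h(i := oth i)" and "t' \<equiv> t(i := oth j)"
    and "p' \<equiv> p(i := sg j * p j)"
  shows "mod_problem m V H s z I' h' t' p' \<tau>"
    and "solves m V H z I' h' t' p' \<tau> q \<Longrightarrow> \<exists>q'. solves m V H z I h t p \<tau> q'"
    and "card {k \<in> I'. h' k \<in> V \<and> t' k \<in> V} < card {k \<in> I. h k \<in> V \<and> t k \<in> V}"
proof -
  define P Q where "P = oth i" and "Q = oth j"
  define R where "R = I - {i, j}"
  have I_eq: "I = insert i (insert j R)" "I' = insert i R" and nR: "i \<notin> R" "j \<notin> R" and finR: "finite R"
    using i j ij finI by (auto simp: R_def I'_def)
  have sumI: "(\<Sum>k\<in>I. f k) = f i + (f j + (\<Sum>k\<in>R. f k))" for f :: "'i \<Rightarrow> int"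
    unfolding I_eq using nR ij finR by simp
  have sumI': "(\<Sum>k\<in>I'. f k) = f i + (\<Sum>k\<in>R. f k)" for f :: "'i \<Rightarrow> int"
    unfolding I_eq using nR finR by simp
  have zx: "x \<noteq> z" using x zV by blast
  have PV: "P \<in> V" and QV: "Q \<in> insert z V" and Pnz: "P \<noteq> z" and Px: "P \<noteq> x" and Qx: "Q \<noteq> x"
    using ends[OF i] ends[OF j] Pz xi xj unfolding P_def Q_def oth_def by auto
  \<comment> \<open>\<open>2 * \<delta> A\<close> is the loss of the cut of
    \<open>A\<close>.\<close>
  define \<delta> :: "'v set \<Rightarrow> int" where "\<delta> = (\<lambda>A. of_bool ((P \<in> A) = (Q \<in> A) \<and> (P \<in> A) \<noteq> (x \<in> A)))"
  have R_same: "(\<Sum>k\<in>R. of_bool ((h' k \<in> A) \<noteq> (t' k \<in> A))) = (\<Sum>k\<in>R. of_bool ((h k \<in> A) \<noteq> (t k \<in> A)) :: int)" for A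
    by (intro sum.cong) (use nR in \<open>auto simp: h'_def t'_def\<close>)
  have cut: "cutd I' h' t' A = d A - 2 * \<delta> A" for A
    unfolding cutd_def sumI sumI' R_same using xi xj
    by (auto simp: h'_def t'_def P_def Q_def oth_def \<delta>_def of_bool_def)
  have \<delta>V: "\<delta> V = 0" using PV x by (simp add: \<delta>_def)
  \<comment> \<open>Signs are set so that a new edge directed from \<open>P\<close> to
    \<open>Q\<close> unfolds to the path from \<open>P\<close> through \<open>x\<close> to
    \<open>Q\<close>; \<open>sg\<close> records which end of an edge is \<open>x\<close>.\<close>
  have neteq: "net I h t (\<lambda>k. if k = i then - sg i * q k else if k = j then sg j * q i else q k) y
      = net I' h' t' q y" for q y
  proof -
    have "(\<Sum>k\<in>R. (if k = i then - sg i * q k else if k = j then sg j * q i else q k) *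
        (of_bool (h k = y) - of_bool (t k = y))) =
        (\<Sum>k\<in>R. q k * (of_bool (h' k = y) - of_bool (t' k = y)))"
      by (intro sum.cong) (use nR in \<open>auto simp: h'_def t'_def\<close>)
    then show ?thesis
      unfolding net_def sumI sumI' using xi xj ij
      by (auto simp: h'_def t'_def oth_def sg_def algebra_simps)
  qed
  have netz: "net I' h' t' p' z = net I h t p z"
  proof -
    have R_eq: "(\<Sum>k\<in>R. p' k * (of_bool (h' k = z) - of_bool (t' k = z))) =
        (\<Sum>k\<in>R. p k * (of_bool (h k = z) - of_bool (t k = z)))"
      by (intro sum.cong) (use nR in \<open>auto simp: h'_def t'_def p'_def\<close>)
    have "h i \<noteq> z" "t i \<noteq> z" using Pz xi zx by (auto simp: oth_def split: if_splits)
    then have "p' i * (of_bool (h' i = z) - of_bool (t' i = z)) =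
        p i * (of_bool (h i = z) - of_bool (t i = z)) + p j * (of_bool (h j = z) - of_bool (t j = z))"
      using xi xj ij zx Pz by (auto simp: h'_def t'_def p'_def sg_def oth_def)
    then show ?thesis unfolding net_def sumI sumI' R_eq by simp
  qed
  have pm': "p' k = 1 \<or> p' k = -1" if "k \<in> I'" for k
    using that pm[of k] pm[OF j] by (auto simp: I'_def p'_def sg_def)
  have deg2: "2 \<le> d {x}"
  proof -
    have "0 \<le> (\<Sum>k\<in>R. of_bool ((h k \<in> {x}) \<noteq> (t k \<in> {x})) :: int)" by (intro sum_nonneg) simp
    then show ?thesis unfolding cutd_def sumI using xi xj by simp
  qed
  \<comment> \<open>Every non-loop edge at \<open>x\<close> leads to \<open>P\<close> on the other
    side, so moving \<open>x\<close> there removes all \<open>d {x}\<close> of them from the cut and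
    adds none.\<close>
  have toggle: "d (insert x A) + 2 \<le> d A" if "x \<notin> A" "\<delta> A = 1" "P = Q" for A
  proof -
    have all: "\<forall>k\<in>I. (h k = x) \<noteq> (t k = x) \<longrightarrow> oth k = P"
      using dist that(3) unfolding P_def Q_def by blast
    have PA: "P \<in> A" using that by (auto simp: \<delta>_def)
    have "d (insert x A) + d {x} = d A"
      unfolding cutd_def sum.distrib[symmetric]
    proof (intro sum.cong refl)
      fix k assume k: "k \<in> I"
      have "(h k = x) = (t k = x) \<or> h k = x \<and> t k = P \<or> t k = x \<and> h k = P"
        using bspec[OF all k] by (auto simp: oth_def split: if_splits)
      then show "of_bool ((h k \<in> insert x A) \<noteq> (t k \<in> insert x A)) + of_bool ((h k \<in> {x}) \<noteq> (t k \<in> {x}))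
          = (of_bool ((h k \<in> A) \<noteq> (t k \<in> A)) :: int)"
        using PA that(1) Px by auto
    qed
    then show ?thesis using deg2 by simp
  qed
  have toggle': "d (A - {x}) + 2 \<le> d A" if "x \<in> A" "\<delta> A = 1" "P = Q" for A
  proof -
    have all: "\<forall>k\<in>I. (h k = x) \<noteq> (t k = x) \<longrightarrow> oth k = P"
      using dist that(3) unfolding P_def Q_def by blast
    have PA: "P \<notin> A" using that by (auto simp: \<delta>_def)
    have "d (A - {x}) + d {x} = d A"
      unfolding cutd_def sum.distrib[symmetric]
    proof (intro sum.cong refl)
      fix k assume k: "k \<in> I"
      have "(h k = x) = (t k = x) \<or> h k = x \<and> t k = P \<or> t k = x \<and> h k = P"
        using bspec[OF all k] by (auto simp: oth_def split: if_splits)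
      then show "of_bool ((h k \<in> A - {x}) \<noteq> (t k \<in> A - {x})) + of_bool ((h k \<in> {x}) \<noteq> (t k \<in> {x}))
          = (of_bool ((h k \<in> A) \<noteq> (t k \<in> A)) :: int)"
        using PA that(1) Px by auto
    qed
    then show ?thesis using deg2 by simp
  qed
  have move: "\<exists>A'. A' \<subseteq> V \<and> A' \<inter> H = A \<inter> H \<and> d A' + 2 \<le> d A"
    if "A \<subseteq> V" "\<delta> A = 1" "P = Q" for A
  proof (cases "x \<in> A")
    case True
    then show ?thesis using that toggle'[of A] x by (intro exI[of _ "A - {x}"]) auto
  next
    case False
    then show ?thesis using that toggle[of A] x by (intro exI[of _ "insert x A"]) auto
  qed
  have \<delta>01: "\<delta> A = 0 \<or> \<delta> A = 1" for A unfolding \<delta>_def of_bool_def by simp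
  \<comment> \<open>\<open>{y}\<close> loses edges only if \<open>P = Q = y\<close>, because
    \<open>x\<close> lies outside \<open>H\<close>. So the one set excluded from \<open>nc1\<close>
    and \<open>nc3\<close> does not occur.\<close>
  have not1: "A \<noteq> {y}" if "\<delta> A = 1" "P \<noteq> Q" "y \<in> H" for A y
    using that x by (auto simp: \<delta>_def)
  show "mod_problem m V H s z I' h' t' p' \<tau>"
  proof (unfold_locales, unfold cut netz)
    show "finite I'" by (simp add: I'_def finI)
    show "h' k \<in> insert z V \<and> t' k \<in> insert z V" if "k \<in> I'" for k
      using that ends[of k] PV QV unfolding I'_def h'_def t'_def P_def Q_def by auto
    show "even (\<tau> y - (d {y} - 2 * \<delta> {y}))" if "y \<in> V" for y using parity[OF that] by simp
    show "need m s \<tau> y \<le> d A - 2 * \<delta> A" if A: "A \<subseteq> V" "A \<inter> H = {y}" "H \<noteq> {y}" for A y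
    proof (cases "\<delta> A = 0")
      case False
      then have \<delta>1: "\<delta> A = 1" using \<delta>01 by blast
      have "need m s \<tau> y + 2 \<le> d A"
      proof (cases "P = Q")
        case True
        then obtain A' where "A' \<subseteq> V" "A' \<inter> H = A \<inter> H" "d A' + 2 \<le> d A" using move A(1) \<delta>1 by blast
        then show ?thesis using cut1[of A' y] A by simp
      next
        case False
        then show ?thesis using nc1[OF nc A] not1[OF \<delta>1] A by blast
      qed
      then show ?thesis using \<delta>1 by simp
    qed (use cut1 A in simp)
    show "8 * m - 3 \<le> d A - 2 * \<delta> A" if A: "A \<subseteq> V" "2 \<le> card (A \<inter> H)" "\<not> H \<subseteq> A" for A
      using nc2[OF nc A] \<delta>01[of A] by auto
    show "d V - 2 * \<delta> V \<le> d A - 2 * \<delta> A" if A: "H \<subseteq> A" "A \<subseteq> V" for A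
    proof (cases "\<delta> A = 0")
      case True
      then show ?thesis using cut3[OF A] \<delta>V by simp
    next
      case False
      then have \<delta>1: "\<delta> A = 1" using \<delta>01 by blast
      have "d V + 2 \<le> d A"
      proof (cases "P = Q")
        case True
        then obtain A' where A': "A' \<subseteq> V" "A' \<inter> H = A \<inter> H" "d A' + 2 \<le> d A" using move A(2) \<delta>1 by blast
        then have "d V \<le> d A'" using cut3[of A'] A(1) by blast
        then show ?thesis using A'(3) by simp
      next
        case False
        have "A \<noteq> V" using \<delta>1 \<delta>V by auto
        moreover obtain y where y: "y \<in> H" using Hne by blast
        moreover have "2 \<le> card A"
        proof -
          have "card {y} < card A" using not1[OF \<delta>1 False y] y A by (intro psubset_card_mono finS) auto
          then show ?thesis by simp
        qed
        ultimately show ?thesis using nc3[OF nc A] by blast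
      qed
      then show ?thesis using \<delta>1 \<delta>V by simp
    qed
    show "d V - 2 * \<delta> V \<le> 8 * m - 2" using cutV \<delta>V by simp
  qed (use m1 finV zV Hne HV range srange total light pm' in auto)
  have rel: "k \<in> R \<Longrightarrow> h' k = h k \<and> t' k = t k" for k using nR by (auto simp: h'_def t'_def)
  let ?real = "{k \<in> R. h k \<in> V \<and> t k \<in> V}"
  have "{k \<in> I'. h' k \<in> V \<and> t' k \<in> V} = (if Q \<in> V then insert i ?real else ?real)"
    using PV rel nR unfolding I_eq by (auto simp: h'_def t'_def P_def[symmetric] Q_def[symmetric])
  moreover have "{k \<in> I. h k \<in> V \<and> t k \<in> V} = (if Q \<in> V then insert i (insert j ?real) else insert i ?real)"
  proof -
    have "h i \<in> V \<and> t i \<in> V" using PV x xi by (auto simp: P_def oth_def split: if_splits)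
    moreover have "h j \<in> V \<and> t j \<in> V \<longleftrightarrow> Q \<in> V" using x xj by (auto simp: Q_def oth_def split: if_splits)
    ultimately show ?thesis unfolding I_eq by auto
  qed
  ultimately show "card {k \<in> I'. h' k \<in> V \<and> t' k \<in> V} < card {k \<in> I. h k \<in> V \<and> t k \<in> V}"
    using nR ij finR by simp
  assume q: "solves m V H z I' h' t' p' \<tau> q"
  let ?q = "\<lambda>k. if k = i then - sg i * q k else if k = j then sg j * q i else q k"
  have qpm: "q k = 1 \<or> q k = -1" if "k \<in> I'" for k using q that by (simp add: solves_def)
  have iI': "i \<in> I'" using i ij by (simp add: I'_def)
  have "?q k = 1 \<or> ?q k = -1" if "k \<in> I" for k
    using qpm[of k] qpm[OF iI'] that by (auto simp: sg_def I'_def)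
  moreover have "?q k = p k" if k: "k \<in> I" "h k = z \<or> t k = z" for k
  proof -
    consider "k = i" | "k = j" | "k \<in> R" using k(1) by (auto simp: R_def)
    then show ?thesis
    proof cases
      case 1
      then show ?thesis using k Pz xi zx by (auto simp: oth_def split: if_splits)
    next
      case 2
      then have "Q = z" using k xj zx by (auto simp: Q_def oth_def)
      then have "q i = p' i" using q iI' by (simp add: solves_def t'_def Q_def)
      then show ?thesis using 2 ij by (auto simp: p'_def sg_def)
    next
      case 3
      then have "q k = p' k" using q k(2) rel[OF 3] by (auto simp: solves_def I_eq)
      then show ?thesis using 3 nR by (auto simp: p'_def)
    qed
  qed
  ultimately have "solves m V H z I h t p \<tau> ?q"
    using q unfolding solves_def neteq by auto
  then show "\<exists>q'. solves m V H z I h t p \<tau> q'" by blast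
qed

text \<open>Exact balance at \<open>x\<close> is a stronger demand, but it makes \<open>x\<close>
  available for lifting. The cuts that fall under a new condition are those of \<open>{x, y}\<close>
  and \<open>V - {x}\<close>; both have at least \<open>8 * m - 1\<close> edges by
  \<open>nc2\<close>. If \<open>x\<close> was the exceptional vertex, \<open>z\<close> takes its
  place, which means that there is none since \<open>z \<notin> V\<close>.\<close>

lemma make_light:
  assumes nc: "\<And>A. \<not> contractible A" and HV': "H = V" and card3: "3 \<le> card V"
    and x: "x \<in> V" "\<tau> x = 0"
  shows "mod_problem m V (V - {x}) (if x = s then z else s) z I h t p \<tau>"
    and "solves m V (V - {x}) z I h t p \<tau> q \<Longrightarrow> solves m V H z I h t p \<tau> q"
proof -
  have not_pair: "\<not> H \<subseteq> {x, y}" for y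
  proof
    assume "H \<subseteq> {x, y}"
    then have "card V \<le> card {x, y}" unfolding HV' by (intro card_mono) auto
    also have "\<dots> \<le> 2" by (simp add: card_insert_if)
    finally show False using card3 by simp
  qed
  have card2: "2 \<le> card (V - {x})" using x card3 finV by simp
  show "mod_problem m V (V - {x}) (if x = s then z else s) z I h t p \<tau>"
  proof unfold_locales
    show "V - {x} \<noteq> {}" using card2 by force
    show "need m (if x = s then z else s) \<tau> y \<le> d A"
      if A: "A \<subseteq> V" "A \<inter> (V - {x}) = {y}" "V - {x} \<noteq> {y}" for A y
    proof -
      have y: "y \<in> V" "y \<noteq> x" using A by auto
      then have eq: "need m (if x = s then z else s) \<tau> y = need m s \<tau> y"
        using zV by (auto simp: need_def)
      have "A = {y} \<or> A = {x, y}" using A by blast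
      then show ?thesis
      proof
        assume "A = {y}"
        then show ?thesis using cut1[of A y] A not_pair[of y] HV' y unfolding eq by auto
      next
        assume Axy: "A = {x, y}"
        have "8 * m - 1 \<le> d A"
          using nc2[OF nc A(1)] not_pair[of y] y x Axy by (simp add: HV' Int_absorb2)
        then show ?thesis using need_bound[of y] y HV' unfolding eq by simp
      qed
    qed
    show "8 * m - 3 \<le> d A" if A: "A \<subseteq> V" "2 \<le> card (A \<inter> (V - {x}))" "\<not> V - {x} \<subseteq> A" for A
    proof -
      have "card (A \<inter> (V - {x})) \<le> card (A \<inter> H)" using finV HV' by (intro card_mono) auto
      then show ?thesis using cut2[of A] A HV' by auto
    qed
    show "d V \<le> d A" if A: "V - {x} \<subseteq> A" "A \<subseteq> V" for A
    proof (cases "A = V")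
      case False
      then have A: "A = V - {x}" using A x by blast
      have "8 * m - 1 \<le> d A" using nc2[OF nc, of A] card2 x unfolding A HV' by (auto simp: Int_absorb2)
      then show ?thesis using cutV by simp
    qed simp
  qed (use m1 finV finI zV ends pm parity range srange cutV total x HV' in \<open>auto split: if_splits\<close>)
  show "solves m V H z I h t p \<tau> q" if "solves m V (V - {x}) z I h t p \<tau> q"
    using that x unfolding solves_def HV' by (auto split: if_splits)
qed

text \<open>Directing the edge from \<open>y\<close> to \<open>s\<close> accounts for one unit of
  balance at each end. Degree and requirement drop together at both vertices; larger cuts can spare
  an edge by \<open>nc2\<close>, and the cut of \<open>V\<close> does not contain this edge.\<close>

lemma direct_edge:
  assumes nc: "\<And>A. \<not> contractible A" and HV': "H = V"
    and i: "i \<in> I" "h i = y \<and> t i = s \<or> h i = s \<and> t i = y"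
    and y: "y \<in> V" "y \<noteq> s" "0 < \<tau> y" and s: "s \<in> V" "\<tau> s < 0"
  shows "mod_problem m V H s z (I - {i}) h t p (\<tau>(y := \<tau> y - 1, s := \<tau> s + 1))"
    and "solves m V H z (I - {i}) h t p (\<tau>(y := \<tau> y - 1, s := \<tau> s + 1)) q
           \<Longrightarrow> \<exists>q'. solves m V H z I h t p \<tau> q'"
proof -
  let ?\<tau> = "\<tau>(y := \<tau> y - 1, s := \<tau> s + 1)"
  have nz: "y \<noteq> z" "s \<noteq> z" using zV y s by auto
  have sumI: "(\<Sum>k\<in>I. f k) = f i + (\<Sum>k\<in>I - {i}. f k)" for f :: "'i \<Rightarrow> int"
    using i finI by (simp add: sum.remove)
  have cut: "cutd (I - {i}) h t A = d A - of_bool ((y \<in> A) \<noteq> (s \<in> A))" for A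
    unfolding cutd_def sumI using i by auto
  have netz: "net (I - {i}) h t p z = net I h t p z"
    unfolding net_def sumI using i nz by auto
  have "(\<Sum>x\<in>V. ?\<tau> x) = (\<Sum>x\<in>V. \<tau> x + (of_bool (s = x) - of_bool (y = x)))"
    by (intro sum.cong) (use y in auto)
  also have "\<dots> = (\<Sum>x\<in>V. \<tau> x)"
    by (simp only: sum.distrib sum_subtractf sum_of_bool_eq[OF finV]) (use y s in simp)
  finally have tot: "(\<Sum>x\<in>V. ?\<tau> x) = (\<Sum>x\<in>V. \<tau> x)" .
  show "mod_problem m V H s z (I - {i}) h t p ?\<tau>"
  proof (unfold_locales, unfold cut netz tot)
    show "even (?\<tau> x - (d {x} - of_bool ((y \<in> {x}) \<noteq> (s \<in> {x}))))" if "x \<in> V" for x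
      using parity[OF that] y(2) by auto
    show "need m s ?\<tau> w \<le> d A - of_bool ((y \<in> A) \<noteq> (s \<in> A))"
      if A: "A \<subseteq> V" "A \<inter> H = {w}" "H \<noteq> {w}" for A w
    proof -
      have "A = {w}" using A HV' by blast
      then show ?thesis using cut1[OF A] y(2) by (auto simp: need_def)
    qed
    show "8 * m - 3 \<le> d A - of_bool ((y \<in> A) \<noteq> (s \<in> A))"
      if A: "A \<subseteq> V" "2 \<le> card (A \<inter> H)" "\<not> H \<subseteq> A" for A
      using nc2[OF nc A] by auto
    show "d V - of_bool ((y \<in> V) \<noteq> (s \<in> V)) \<le> d A - of_bool ((y \<in> A) \<noteq> (s \<in> A))"
      if "H \<subseteq> A" "A \<subseteq> V" for A using that HV' by auto
    show "d V - of_bool ((y \<in> V) \<noteq> (s \<in> V)) \<le> 8 * m - 2" using cutV y s by simp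
    show "0 \<le> ?\<tau> x \<and> ?\<tau> x < 2 * m" if "x \<in> H" "x \<noteq> s" for x
      using range[OF that] y that by auto
    show "- 2 * m < ?\<tau> s \<and> ?\<tau> s \<le> 0" if "s \<in> H" using srange[OF that] s by simp
  qed (use m1 finV finI zV ends pm light total HV' Hne in auto)
  assume q: "solves m V H z (I - {i}) h t p ?\<tau> q"
  let ?q = "q(i := if h i = y then 1 else -1)"
  have "(\<Sum>k\<in>I - {i}. ?q k * (of_bool (h k = x) - of_bool (t k = x))) =
      (\<Sum>k\<in>I - {i}. q k * (of_bool (h k = x) - of_bool (t k = x)))" for x
    by (intro sum.cong) auto
  then have nt: "net I h t ?q x = net (I - {i}) h t q x + of_bool (y = x) - of_bool (s = x)" for x
    unfolding net_def sumI using i y(2) by auto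
  have "2 * m dvd net I h t ?q x - \<tau> x" if "x \<in> H" for x
  proof -
    have "2 * m dvd net (I - {i}) h t q x - ?\<tau> x" using q that by (simp add: solves_def)
    moreover have "net I h t ?q x - \<tau> x = net (I - {i}) h t q x - ?\<tau> x"
      unfolding nt using y(2) by auto
    ultimately show ?thesis by simp
  qed
  then have "solves m V H z I h t p \<tau> ?q"
    using q i nz unfolding solves_def by (auto simp: HV')
  then show "\<exists>q'. solves m V H z I h t p \<tau> q'" by blast
qed

text \<open>The residue is unchanged, and the requirement at \<open>x\<close> becomes
  \<open>4 * m - 2 - (\<tau> x - 2 * m)\<close>, which is \<open>6 * m - 2 - \<tau> x\<close> and
  thus below the old \<open>6 * m - 2 + \<tau> x\<close>.\<close>

lemma make_special:
  assumes HV': "H = V" and s: "s \<notin> V" and x: "x \<in> V" "0 < \<tau> x"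
  shows "mod_problem m V H x z I h t p (\<tau>(x := \<tau> x - 2 * m))"
    and "solves m V H z I h t p (\<tau>(x := \<tau> x - 2 * m)) q \<Longrightarrow> solves m V H z I h t p \<tau> q"
proof -
  let ?\<tau> = "\<tau>(x := \<tau> x - 2 * m)"
  have xs: "x \<noteq> s" using x s by blast
  have tot: "(\<Sum>y\<in>V. ?\<tau> y) = (\<Sum>y\<in>V. \<tau> y) - 2 * m"
    using x(1) finV by (simp add: sum.remove[of V x])
  show "mod_problem m V H x z I h t p ?\<tau>"
  proof (unfold_locales, unfold tot)
    show "even (?\<tau> y - d {y})" if "y \<in> V" for y using parity[OF that] by auto
    show "need m x ?\<tau> y \<le> d A" if A: "A \<subseteq> V" "A \<inter> H = {y}" "H \<noteq> {y}" for A y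
    proof -
      have "y \<noteq> s" using A s by blast
      then show ?thesis using cut1[OF A] x(2) xs by (auto simp: need_def split: if_splits)
    qed
    show "0 \<le> ?\<tau> y \<and> ?\<tau> y < 2 * m" if "y \<in> H" "y \<noteq> x" for y
      using range[OF that(1)] that s HV' by auto
    show "- 2 * m < ?\<tau> x \<and> ?\<tau> x \<le> 0" using range[of x] x xs HV' by auto
    show "2 * m dvd (\<Sum>y\<in>V. \<tau> y) - 2 * m + net I h t p z"
      using total by (metis (no_types, lifting) add.commute add_diff_eq dvd_diff dvd_refl)
  qed (use m1 finV finI zV ends pm light cut2 cut3 cutV HV' Hne in auto)
  show "solves m V H z I h t p \<tau> q" if q: "solves m V H z I h t p ?\<tau> q"
  proof -
    have "2 * m dvd net I h t q y - \<tau> y" if "y \<in> H" for y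
    proof -
      have "2 * m dvd net I h t q y - ?\<tau> y" using q that by (simp add: solves_def)
      moreover have "net I h t q y - \<tau> y = net I h t q y - ?\<tau> y - (2 * m) * of_bool (x = y)" by auto
      ultimately show ?thesis by (simp only: dvd_diff dvd_triv_left)
    qed
    then show ?thesis using q unfolding solves_def by blast
  qed
qed

text \<open>If all edges at \<open>s\<close> were loops or led to \<open>z\<close>, then
  \<open>V - {s}\<close> would have at most as many leaving edges as \<open>V\<close>, that is at
  most \<open>8 * m - 2\<close>, against \<open>nc2\<close>.\<close>

lemma special_has_neighbor:
  assumes nc: "\<And>A. \<not> contractible A" and HV': "H = V" and card3: "3 \<le> card V" and s: "s \<in> V"
  obtains i y where "i \<in> I" "h i = y \<and> t i = s \<or> h i = s \<and> t i = y" "y \<in> V" "y \<noteq> s"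
proof (rule ccontr)
  assume no: "\<not> thesis"
  have "d (V - {s}) \<le> d V"
    unfolding cutd_def
  proof (intro sum_mono)
    fix i assume i: "i \<in> I"
    have "h i \<in> V - {s} \<Longrightarrow> t i \<noteq> s" "t i \<in> V - {s} \<Longrightarrow> h i \<noteq> s" using no that i by blast+
    then show "of_bool ((h i \<in> V - {s}) \<noteq> (t i \<in> V - {s})) \<le> (of_bool ((h i \<in> V) \<noteq> (t i \<in> V)) :: int)"
      using ends[OF i] zV by auto
  qed
  moreover have "8 * m - 1 \<le> d (V - {s})"
  proof (rule nc2[OF nc])
    have "(V - {s}) \<inter> H = V - {s}" using HV' by blast
    then show "2 \<le> card ((V - {s}) \<inter> H)" using s card3 finV by simp
  qed (use s HV' in auto)
  ultimately show False using cutV by simp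
qed

section \<open>Total balance, and problems with one or two vertices\<close>

lemma net_total: "(\<Sum>x\<in>V. net I h t q x) + net I h t q z = 0"
proof -
  have "(\<Sum>x\<in>V. net I h t q x) + net I h t q z = (\<Sum>x\<in>insert z V. net I h t q x)"
    using finV zV by simp
  also have "\<dots> = 0"
    using ends finV by (subst sum_net) (auto intro!: sum.neutral)
  finally show ?thesis .
qed

lemma net_z: assumes "\<And>i. i \<in> I \<Longrightarrow> h i = z \<or> t i = z \<Longrightarrow> q i = p i"
  shows "net I h t q z = net I h t p z"
  unfolding net_def by (intro sum.cong) (use assms in auto)

lemma base_one:
  assumes "V = {y}" "H = {y}"
  shows "solves m V H z I h t p \<tau> p"
proof -
  have "net I h t p y = - net I h t p z" using net_total[of p] assms by simp
  then have eq: "net I h t p y - \<tau> y = - (\<tau> y + net I h t p z)" by simp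
  have "2 * m dvd \<tau> y + net I h t p z" using total assms by simp
  then have "2 * m dvd net I h t p y - \<tau> y" unfolding eq dvd_minus_iff .
  then show ?thesis using pm assms unfolding solves_def by simp
qed

lemma net_parity:
  assumes "\<And>i. i \<in> I \<Longrightarrow> q i = 1 \<or> q i = -1"
  shows "even (net I h t q x - d {x})"
proof -
  have eq: "net I h t q x - d {x} =
     (\<Sum>i\<in>I. q i * (of_bool (h i = x) - of_bool (t i = x)) - of_bool ((h i = x) \<noteq> (t i = x)))"
    unfolding net_def cutd_def by (simp add: sum_subtractf)
  show ?thesis unfolding eq
  proof (intro dvd_sum)
    fix i assume "i \<in> I"
    then show "even (q i * (of_bool (h i = x) - of_bool (t i = x)) - of_bool ((h i = x) \<noteq> (t i = x)))"
      using assms[of i] by auto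
  qed
qed

text \<open>Start with all edges between \<open>x\<close> and \<open>y\<close> directed towards
  \<open>x\<close>. Reversing one of them raises the balance at \<open>x\<close> by two, so
  \<open>m - 1\<close> of them reach all \<open>m\<close> residues of the right parity modulo
  \<open>2 * m\<close>. The condition at \<open>y\<close> then follows from
  \<open>total\<close>.\<close>

lemma base_two:
  assumes V: "V = {x, y}" "x \<noteq> y" "H = V"
  shows "\<exists>q. solves m V H z I h t p \<tau> q"
proof -
  define X where "X = {i \<in> I. h i = x \<and> t i = y \<or> h i = y \<and> t i = x}"
  have XI: "X \<subseteq> I" and finX: "finite X" using finI by (auto simp: X_def)
  have "d {x} + d {y} - d V = (\<Sum>i\<in>I. 2 * of_bool (i \<in> X))"
    unfolding cutd_def sum.distrib[symmetric] sum_subtractf[symmetric]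
  proof (intro sum.cong refl)
    fix i assume "i \<in> I"
    then show "of_bool ((h i \<in> {x}) \<noteq> (t i \<in> {x})) + of_bool ((h i \<in> {y}) \<noteq> (t i \<in> {y}))
        - of_bool ((h i \<in> V) \<noteq> (t i \<in> V)) = (2 * of_bool (i \<in> X) :: int)"
      using ends[of i] zV V by (auto simp: X_def)
  qed
  also have "\<dots> = 2 * int (card X)"
    using XI finI by (simp add: sum_distrib_left[symmetric] Int_absorb1)
  finally have dX: "d {x} + d {y} - d V = 2 * int (card X)" .
  moreover have "need m s \<tau> x \<le> d {x}" "need m s \<tau> y \<le> d {y}" using cut1[of "{x}" x] cut1[of "{y}" y] V by auto
  moreover have "10 * m - 4 \<le> need m s \<tau> x + need m s \<tau> y"
    using range[of x] range[of y] srange V m1 by (auto simp: need_def)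
  ultimately have cX: "m - 1 \<le> int (card X)" using cutV by linarith
  define dr where "dr i = (if h i = x then 1 else (-1::int))" for i
  define orient where "orient Y i = (if i \<in> X then (if i \<in> Y then dr i else - dr i) else p i)" for Y i
  have opm: "orient Y i = 1 \<or> orient Y i = -1" if "i \<in> I" for Y i
    using pm[OF that] by (auto simp: orient_def dr_def)
  have netx: "net I h t (orient Y) x = net I h t (orient {}) x + 2 * int (card Y)" if "Y \<subseteq> X" for Y
  proof -
    have "net I h t (orient Y) x - net I h t (orient {}) x = (\<Sum>i\<in>I. 2 * of_bool (i \<in> Y))"
      unfolding net_def sum_subtractf[symmetric]
    proof (intro sum.cong refl)
      fix i assume "i \<in> I"
      then show "orient Y i * (of_bool (h i = x) - of_bool (t i = x)) -
          orient {} i * (of_bool (h i = x) - of_bool (t i = x)) = 2 * of_bool (i \<in> Y)"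
        using that V by (auto simp: orient_def dr_def X_def)
    qed
    also have "\<dots> = 2 * int (card Y)"
      using XI that finI by (simp add: sum_distrib_left[symmetric] Int_absorb1)
    finally show ?thesis by simp
  qed
  define r where "r = \<tau> x - net I h t (orient {}) x"
  have "even (net I h t (orient {}) x - d {x})" by (rule net_parity) (rule opm)
  moreover have "even (\<tau> x - d {x})" using parity V by simp
  ultimately have "even r" unfolding r_def by simp
  then obtain r' where r': "r = 2 * r'" by blast
  have "nat (r' mod m) \<le> card X" using cX m1 pos_mod_bound[of m r'] by linarith
  then obtain Y where Y: "Y \<subseteq> X" "card Y = nat (r' mod m)"
    by (meson obtain_subset_with_card_n)
  have "net I h t (orient Y) x - \<tau> x = 2 * (r' mod m) - 2 * r'"
    using netx[OF Y(1)] Y(2) m1 r' unfolding r_def by simp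
  also have "\<dots> = - (2 * m * (r' div m))"
    by (simp add: minus_div_mult_eq_mod[symmetric] algebra_simps)
  finally have nx: "2 * m dvd net I h t (orient Y) x - \<tau> x" by simp
  have pz: "orient Y i = p i" if "i \<in> I" "h i = z \<or> t i = z" for i
    using that V zV by (auto simp: orient_def X_def)
  have "net I h t (orient Y) x + net I h t (orient Y) y + net I h t p z = 0"
    using net_total[of "orient Y"] net_z[of "orient Y", OF pz] V by simp
  then have "net I h t (orient Y) y - \<tau> y =
      - (net I h t (orient Y) x - \<tau> x) - (\<tau> x + \<tau> y + net I h t p z)" by simp
  moreover have "2 * m dvd \<tau> x + \<tau> y + net I h t p z" using total V by simp
  ultimately have ny: "2 * m dvd net I h t (orient Y) y - \<tau> y"
    using nx by (metis dvd_diff dvd_minus_iff)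
  have "solves m V H z I h t p \<tau> (orient Y)"
    unfolding solves_def using opm pz nx ny V by auto
  then show ?thesis by blast
qed

text \<open>
  A cut with at most \<open>8 * m - 2\<close> edges splits the problem: orient the graph with \<open>A\<close> contracted to \<open>\<alpha>\<close>,
  then the one with the complement of \<open>A\<close> contracted to \<open>z\<close>, extending the orientation of the cut.
\<close>
lemma contract:
  assumes A: "contractible A"
    and IH: "\<And>V' H' s' I' (h' :: 'i \<Rightarrow> 'v) t' p' \<tau>'. mod_problem m V' H' s' z I' h' t' p' \<tau>' \<Longrightarrow>
        card V' < card V \<Longrightarrow> card H' \<le> card H \<Longrightarrow>
        card {i \<in> I'. h' i \<in> V' \<and> t' i \<in> V'} \<le> card {i \<in> I. h i \<in> V \<and> t i \<in> V} \<Longrightarrow>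
        \<exists>q. solves m V' H' z I' h' t' p' \<tau>' q"
  shows "\<exists>q. solves m V H z I h t p \<tau> q"
proof -
  have AV: "A \<subseteq> V" "A \<noteq> V" and cA: "2 \<le> card A" and AH: "A \<inter> H \<noteq> {}" and dA: "d A \<le> 8 * m - 2"
    and Amin: "\<And>A'. A' \<subseteq> A \<Longrightarrow> A' \<inter> H = A \<inter> H \<Longrightarrow> d A \<le> d A'"
    using A unfolding contractible_def by auto
  have finA: "finite A" and zA: "z \<notin> A" and finH: "finite H" using AV finS zV HV by auto
  \<comment> \<open>A vertex of \<open>A \<inter> H\<close> serves as the contracted vertex. If it
    is the only one there, its \<open>\<tau>\<close> and its exceptional status carry over
    unchanged.\<close>
  obtain \<alpha> where \<alpha>: "\<alpha> \<in> A" "\<alpha> \<in> H" using AH by blast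
  have single_or: "A \<inter> H = {\<alpha>} \<or> 2 \<le> card (A \<inter> H)"
  proof -
    have "card (A \<inter> H) \<noteq> 0" using AH finA by simp
    moreover have "card (A \<inter> H) = 1 \<Longrightarrow> A \<inter> H = {\<alpha>}"
      using \<alpha> by (metis IntI card_1_singletonE singletonD)
    ultimately show ?thesis by linarith
  qed
  define \<pi> where "\<pi> v = (if v \<in> A then \<alpha> else v)" for v
  define V1 where "V1 = insert \<alpha> (V - A)"
  define H1 where "H1 = insert \<alpha> (H - A)"
  \<comment> \<open>If \<open>A\<close> contains several vertices of \<open>H\<close>, the
    contracted vertex gets a residue in \<open>[0, 2 * m)\<close> and is an ordinary vertex, even if
    \<open>s\<close> lies in \<open>A\<close>; \<open>z\<close> then stands for "no exceptional
    vertex". Its requirement is at most \<open>8 * m - 3\<close>, which \<open>cut2\<close>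
    grants.\<close>
  define s1 where "s1 = (if 2 \<le> card (A \<inter> H) \<and> s \<in> A then z else s)"
  define \<tau>1 where "\<tau>1 = \<tau>(\<alpha> := if A \<inter> H = {\<alpha>} then \<tau> \<alpha> else (\<Sum>x\<in>A \<inter> H. \<tau> x) mod (2 * m))"
  define h1 where "h1 = (\<lambda>i. \<pi> (h i))"
  define t1 where "t1 = (\<lambda>i. \<pi> (t i))"
  \<comment> \<open>\<open>U S\<close> is the set of original vertices that contraction sends into
    \<open>S\<close>.\<close>
  define U where "U S = (if \<alpha> \<in> S then S \<union> A else S)" for S
  have cut: "cutd I h1 t1 S = d (U S)" if "S \<subseteq> V1" for S
    unfolding cutd_def
  proof (intro sum.cong refl)
    have "\<pi> v \<in> S \<longleftrightarrow> v \<in> U S" for v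
      using that \<alpha> by (auto simp: \<pi>_def U_def V1_def)
    then show "of_bool ((h1 i \<in> S) \<noteq> (t1 i \<in> S)) = (of_bool ((h i \<in> U S) \<noteq> (t i \<in> U S)) :: int)" for i
      by (simp add: h1_def t1_def)
  qed
  have net_out: "net I h1 t1 q w = net I h t q w" if "w \<notin> A" for q w
  proof -
    have "\<pi> v = w \<longleftrightarrow> v = w" for v using that \<alpha> by (auto simp: \<pi>_def)
    then show ?thesis by (simp add: net_def h1_def t1_def)
  qed
  have net_\<alpha>: "net I h1 t1 q \<alpha> = (\<Sum>i\<in>I. q i * (of_bool (h i \<in> A) - of_bool (t i \<in> A)))" for q
  proof -
    have "\<pi> v = \<alpha> \<longleftrightarrow> v \<in> A" for v using \<alpha> by (auto simp: \<pi>_def)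
    then show ?thesis by (simp add: net_def h1_def t1_def)
  qed
  have \<tau>\<alpha>: "2 * m dvd \<tau>1 \<alpha> - (\<Sum>x\<in>A. \<tau> x)"
    unfolding sum_tau_H[OF AV(1)] by (simp add: \<tau>1_def mod_eq_dvd_iff[symmetric])
  have \<tau>1o: "\<tau>1 v = \<tau> v" if "v \<notin> A" for v using that \<alpha> by (auto simp: \<tau>1_def)
  have \<tau>1_single: "\<tau>1 \<alpha> = \<tau> \<alpha>" "s1 = s" if "A \<inter> H = {\<alpha>}" using that by (simp_all add: \<tau>1_def s1_def)
  have \<tau>1_multi: "0 \<le> \<tau>1 \<alpha> \<and> \<tau>1 \<alpha> < 2 * m" "s1 \<noteq> \<alpha>" if "2 \<le> card (A \<inter> H)"
  proof -
    have "A \<inter> H \<noteq> {\<alpha>}" using that by force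
    then show "0 \<le> \<tau>1 \<alpha> \<and> \<tau>1 \<alpha> < 2 * m" using m1 by (simp add: \<tau>1_def)
    show "s1 \<noteq> \<alpha>" using that \<alpha> zA by (auto simp: s1_def)
  qed
  have s1o: "v = s1 \<longleftrightarrow> v = s" if "v \<notin> A" "v \<noteq> z" for v using that by (auto simp: s1_def)
  have finV1: "finite V1" using finV by (simp add: V1_def)
  have "mod_problem m V1 H1 s1 z I h1 t1 p \<tau>1"
  proof unfold_locales
    show "z \<notin> V1" using zV \<alpha> zA by (auto simp: V1_def)
    show "h1 i \<in> insert z V1 \<and> t1 i \<in> insert z V1" if "i \<in> I" for i
      using ends[OF that] by (auto simp: h1_def t1_def \<pi>_def V1_def)
    show "H1 \<subseteq> V1" using HV by (auto simp: H1_def V1_def)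
    show "even (\<tau>1 v - cutd I h1 t1 {v})" if "v \<in> V1" for v
    proof (cases "v = \<alpha>")
      case True
      have "even (\<tau>1 \<alpha> - (\<Sum>x\<in>A. \<tau> x))" using \<tau>\<alpha> by (meson dvd_mult_left)
      moreover have "even (d A - (\<Sum>x\<in>A. \<tau> x))" using parity_set[OF AV(1)] sum_tau_H[OF AV(1)] by simp
      moreover have "cutd I h1 t1 {v} = d A" using cut[of "{v}"] that True \<alpha> by (simp add: U_def insert_absorb)
      ultimately show ?thesis using True by simp
    next
      case False
      then have "v \<notin> A" "v \<in> V" using that by (auto simp: V1_def)
      then show ?thesis using parity[of v] cut[of "{v}"] that False by (simp add: U_def \<tau>1o)
    qed
    show "\<tau>1 v = 0" if "v \<in> V1 - H1" for v
      using that light[of v] \<tau>1o[of v] by (auto simp: V1_def H1_def)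
    show "0 \<le> \<tau>1 v \<and> \<tau>1 v < 2 * m" if v: "v \<in> H1" "v \<noteq> s1" for v
    proof (cases "v = \<alpha>")
      case True
      then show ?thesis using single_or \<tau>1_single \<tau>1_multi range[of \<alpha>] \<alpha> v by auto
    next
      case False
      then have "v \<in> H" "v \<notin> A" "v \<noteq> z" using v HV zV by (auto simp: H1_def)
      then show ?thesis using range[of v] v s1o \<tau>1o by simp
    qed
    show "- 2 * m < \<tau>1 s1 \<and> \<tau>1 s1 \<le> 0" if s1: "s1 \<in> H1"
    proof (cases "s1 = \<alpha>")
      case True
      then have "A \<inter> H = {\<alpha>}" using single_or \<tau>1_multi by blast
      then show ?thesis using \<tau>1_single srange \<alpha> True by simp
    next
      case False
      then have "s1 \<in> H" "s1 \<notin> A" "s1 \<noteq> z" using s1 HV zV by (auto simp: H1_def)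
      then show ?thesis using srange s1o[of s1] \<tau>1o by simp
    qed
    show "need m s1 \<tau>1 y \<le> cutd I h1 t1 S" if S: "S \<subseteq> V1" "S \<inter> H1 = {y}" "H1 \<noteq> {y}" for S y
    proof (cases "\<alpha> \<in> S")
      case True
      then have y: "y = \<alpha>" using S by (auto simp: H1_def)
      have US: "U S \<subseteq> V" "U S \<inter> H = A \<inter> H" "\<not> H \<subseteq> U S"
        using S y AV True \<alpha> HV by (auto simp: U_def V1_def H1_def)
      show ?thesis
      proof (cases "A \<inter> H = {\<alpha>}")
        case True
        then have "H \<noteq> {\<alpha>}" using US by blast
        then show ?thesis using cut1[of "U S" \<alpha>] US True cut[OF S(1)] \<tau>1_single y
            by (auto simp: need_def split: if_splits)
      next
        case False
        then have c: "2 \<le> card (A \<inter> H)" using single_or by blast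
        then have "8 * m - 3 \<le> d (U S)" using cut2[of "U S"] US by simp
        then show ?thesis using \<tau>1_multi[OF c] y cut[OF S(1)] by (simp add: need_def)
      qed
    next
      case False
      then have "U S = S" "S \<inter> H = {y}" "S \<subseteq> V" using S HV by (auto simp: U_def H1_def V1_def)
      moreover have y: "y \<notin> A" "y \<noteq> z" using S False zV HV \<alpha> by (auto simp: H1_def V1_def)
      moreover have "H \<noteq> {y}" using y \<alpha> by blast
      ultimately show ?thesis
        using cut1[of S y] cut[OF S(1)] s1o[OF y] \<tau>1o[OF y(1)]
        by (auto simp: need_def split: if_splits)
    qed
    show "8 * m - 3 \<le> cutd I h1 t1 S" if S: "S \<subseteq> V1" "2 \<le> card (S \<inter> H1)" "\<not> H1 \<subseteq> S" for S
    proof -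
      have "U S \<subseteq> V" using S AV \<alpha> by (auto simp: U_def V1_def)
      moreover have "S \<inter> H1 \<subseteq> U S \<inter> H" using \<alpha> by (auto simp: U_def H1_def)
      then have "card (S \<inter> H1) \<le> card (U S \<inter> H)" using finH by (intro card_mono) auto
      moreover have "\<not> H \<subseteq> U S" using S(3) \<alpha> by (auto simp: U_def H1_def)
      ultimately show ?thesis using cut2[of "U S"] S cut[OF S(1)] by simp
    qed
    show "cutd I h1 t1 V1 \<le> cutd I h1 t1 S" if S: "H1 \<subseteq> S" "S \<subseteq> V1" for S
    proof -
      have "U V1 = V" using AV \<alpha> by (auto simp: U_def V1_def)
      moreover have "H \<subseteq> U S" "U S \<subseteq> V" using S AV \<alpha> by (auto simp: U_def H1_def V1_def)
      ultimately show ?thesis using cut3 cut S(2) by simp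
    qed
    have "U V1 = V" using AV \<alpha> by (auto simp: U_def V1_def)
    then show "cutd I h1 t1 V1 \<le> 8 * m - 2" using cut[of V1] cutV by simp
    have "(\<Sum>x\<in>V1. \<tau>1 x) = \<tau>1 \<alpha> + (\<Sum>x\<in>V - A. \<tau> x)"
      using finV \<alpha> unfolding V1_def by (simp add: \<tau>1o)
    moreover have "(\<Sum>x\<in>V. \<tau> x) = (\<Sum>x\<in>A. \<tau> x) + (\<Sum>x\<in>V - A. \<tau> x)"
      using finV AV by (simp add: sum.subset_diff)
    ultimately have "(\<Sum>x\<in>V1. \<tau>1 x) + net I h1 t1 p z =
        (\<Sum>x\<in>V. \<tau> x) + net I h t p z + (\<tau>1 \<alpha> - (\<Sum>x\<in>A. \<tau> x))"
      using net_out[OF zA] by simp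
    then show "2 * m dvd (\<Sum>x\<in>V1. \<tau>1 x) + net I h1 t1 p z" using total \<tau>\<alpha> by simp
  qed (use m1 finV1 finI pm in \<open>auto simp: H1_def\<close>)
  moreover have "card V1 < card V"
  proof -
    have "V1 = V - (A - {\<alpha>})" using \<alpha> AV by (auto simp: V1_def)
    moreover have "card (A - {\<alpha>}) \<noteq> 0" using cA \<alpha>(1) finA by simp
    then have "A - {\<alpha>} \<noteq> {}" by force
    ultimately show ?thesis using AV finV by (intro psubset_card_mono) auto
  qed
  moreover have "card H1 \<le> card H" using \<alpha> finH by (intro card_mono) (auto simp: H1_def)
  moreover have "{i \<in> I. h1 i \<in> V1 \<and> t1 i \<in> V1} = {i \<in> I. h i \<in> V \<and> t i \<in> V}"
    using AV \<alpha> by (auto simp: h1_def t1_def \<pi>_def V1_def split: if_splits)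
  ultimately obtain q1 where q1: "solves m V1 H1 z I h1 t1 p \<tau>1 q1"
    using IH[of V1 H1 s1 I h1 t1 p \<tau>1] by auto
  define \<sigma> where "\<sigma> v = (if v \<in> A then v else z)" for v
  define I2 where "I2 = {i \<in> I. h i \<in> A \<or> t i \<in> A}"
  define h2 where "h2 = (\<lambda>i. \<sigma> (h i))"
  define t2 where "t2 = (\<lambda>i. \<sigma> (t i))"
  have I2: "I2 \<subseteq> I" by (auto simp: I2_def)
  have \<sigma>in: "\<sigma> v \<in> S \<longleftrightarrow> v \<in> S" if "S \<subseteq> A" for S v using that zA by (auto simp: \<sigma>_def)
  have cut2': "cutd I2 h2 t2 S = d S" if "S \<subseteq> A" for S
    unfolding cutd_def h2_def t2_def \<sigma>in[OF that]
    by (rule sum.mono_neutral_left) (use that finI in \<open>auto simp: I2_def\<close>)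
  have net2: "net I2 h2 t2 q x = net I h t q x" if "x \<in> A" for q x
  proof -
    have "\<sigma> v = x \<longleftrightarrow> v = x" for v using that zA by (auto simp: \<sigma>_def)
    then have eq: "net I2 h2 t2 q x = (\<Sum>i\<in>I2. q i * (of_bool (h i = x) - of_bool (t i = x)))"
      by (simp add: net_def h2_def t2_def)
    show ?thesis unfolding eq unfolding net_def
      by (rule sum.mono_neutral_left) (use that finI in \<open>auto simp: I2_def\<close>)
  qed
  \<comment> \<open>The inner problem sees everything outside \<open>A\<close> as \<open>z\<close>,
    so its balance at \<open>z\<close> is the negative of the balance at the contracted vertex. This
    passes the residue reached by \<open>q1\<close> on to the inner \<open>total\<close>
    condition.\<close>
  have net2z: "net I2 h2 t2 q z = - net I h1 t1 q \<alpha>" for q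
  proof -
    have "\<sigma> v = z \<longleftrightarrow> v \<notin> A" for v using zA by (auto simp: \<sigma>_def)
    then have "net I2 h2 t2 q z = (\<Sum>i\<in>I2. - (q i * (of_bool (h i \<in> A) - of_bool (t i \<in> A))))"
      unfolding net_def by (intro sum.cong) (auto simp: h2_def t2_def)
    also have "\<dots> = (\<Sum>i\<in>I. - (q i * (of_bool (h i \<in> A) - of_bool (t i \<in> A))))"
      by (rule sum.mono_neutral_left) (use finI in \<open>auto simp: I2_def\<close>)
    finally show ?thesis unfolding net_\<alpha> by (simp add: sum_negf)
  qed
  have "mod_problem m A (A \<inter> H) s z I2 h2 t2 q1 \<tau>"
  proof unfold_locales
    show "h2 i \<in> insert z A \<and> t2 i \<in> insert z A" if "i \<in> I2" for i by (simp add: h2_def t2_def \<sigma>_def)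
    show "q1 i = 1 \<or> q1 i = -1" if "i \<in> I2" for i using that I2 q1 unfolding solves_def by blast
    show "even (\<tau> x - cutd I2 h2 t2 {x})" if "x \<in> A" for x using parity[of x] AV that by (subst cut2') auto
    show "\<tau> x = 0" if "x \<in> A - A \<inter> H" for x using that light AV by blast
    show "need m s \<tau> y \<le> cutd I2 h2 t2 S" if S: "S \<subseteq> A" "S \<inter> (A \<inter> H) = {y}" "A \<inter> H \<noteq> {y}" for S y
      unfolding cut2'[OF S(1)] by (rule cut1) (use S AV in blast)+
    show "8 * m - 3 \<le> cutd I2 h2 t2 S" if S: "S \<subseteq> A" "2 \<le> card (S \<inter> (A \<inter> H))" "\<not> A \<inter> H \<subseteq> S" for S
    proof -
      have "S \<inter> (A \<inter> H) = S \<inter> H" using S by blast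
      then show ?thesis unfolding cut2'[OF S(1)] using cut2[of S] S AV by auto
    qed
    show "cutd I2 h2 t2 A \<le> cutd I2 h2 t2 S" if S: "A \<inter> H \<subseteq> S" "S \<subseteq> A" for S
      using Amin[of S] S cut2' by auto
    show "cutd I2 h2 t2 A \<le> 8 * m - 2" using cut2'[of A] dA by simp
    have "2 * m dvd net I h1 t1 q1 \<alpha> - \<tau>1 \<alpha>" using q1 unfolding solves_def H1_def by blast
    then have "2 * m dvd - (net I h1 t1 q1 \<alpha> - \<tau>1 \<alpha>) - (\<tau>1 \<alpha> - (\<Sum>x\<in>A. \<tau> x))"
      using \<tau>\<alpha> by (simp only: dvd_diff dvd_minus_iff)
    then show "2 * m dvd (\<Sum>x\<in>A. \<tau> x) + net I2 h2 t2 q1 z" unfolding net2z by simp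
  qed (use m1 finA finI I2 zA AH range srange finite_subset in auto)
  moreover have "card A < card V" using AV finV by (intro psubset_card_mono) auto
  moreover have "card (A \<inter> H) \<le> card H" using finH by (intro card_mono) auto
  moreover have "card {i \<in> I2. h2 i \<in> A \<and> t2 i \<in> A} \<le> card {i \<in> I. h i \<in> V \<and> t i \<in> V}"
    using finI AV zA by (intro card_mono) (auto simp: I2_def h2_def t2_def \<sigma>_def split: if_splits)
  ultimately obtain q2 where q2: "solves m A (A \<inter> H) z I2 h2 t2 q1 \<tau> q2"
    using IH[of A "A \<inter> H" s I2 h2 t2 q1 \<tau>] by auto
  define q where "q i = (if i \<in> I2 then q2 i else q1 i)" for i
  \<comment> \<open>The edges leaving \<open>A\<close> end in \<open>z\<close> in the inner problem,
    where \<open>q1\<close> is prescribed, so the two orientations agree on them.\<close>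
  have q_out: "q i = q1 i" if "i \<in> I" "h i \<notin> A \<or> t i \<notin> A" for i
  proof (cases "i \<in> I2")
    case True
    then have "h2 i = z \<or> t2 i = z" using that by (auto simp: h2_def t2_def \<sigma>_def)
    then show ?thesis using q2 True unfolding solves_def q_def by auto
  qed (simp add: q_def)
  have netA: "net I h t q x = net I2 h2 t2 q2 x" if "x \<in> A" for x
  proof -
    have "net I2 h2 t2 q2 x = net I2 h2 t2 q x" unfolding net_def by (intro sum.cong) (auto simp: q_def)
    then show ?thesis using net2[OF that] by simp
  qed
  have netO: "net I h t q x = net I h1 t1 q1 x" if "x \<notin> A" for x
    unfolding net_out[OF that] unfolding net_def by (intro sum.cong) (use q_out that in auto)
  have "solves m V H z I h t p \<tau> q"
    unfolding solves_def
  proof (intro conjI ballI impI)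
    show "q i = 1 \<or> q i = -1" if "i \<in> I" for i using that q1 q2 unfolding solves_def q_def by auto
    show "q i = p i" if i: "i \<in> I" "h i = z \<or> t i = z" for i
    proof -
      have "h1 i = z \<or> t1 i = z" using i zA by (auto simp: h1_def t1_def \<pi>_def)
      then have "q1 i = p i" using q1 i unfolding solves_def by blast
      then show ?thesis using q_out i zA by auto
    qed
    show "2 * m dvd net I h t q x - \<tau> x" if x: "x \<in> H" for x
    proof (cases "x \<in> A")
      case True
      then show ?thesis using q2 x unfolding netA[OF True] solves_def by blast
    next
      case False
      then have "2 * m dvd net I h1 t1 q1 x - \<tau>1 x" using q1 x unfolding solves_def H1_def by blast
      then show ?thesis using netO[OF False] \<tau>1o[OF False] by simp
    qed
    show "net I h t q x = 0" if x: "x \<in> V - H" for x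
    proof (cases "x \<in> A")
      case True
      then show ?thesis using q2 x unfolding netA[OF True] solves_def by blast
    next
      case False
      then have "x \<in> V1 - H1" using x \<alpha> by (auto simp: V1_def H1_def)
      then show ?thesis using q1 netO[OF False] unfolding solves_def by simp
    qed
  qed
  then show ?thesis by blast
qed

end

text \<open>
  Vertices outside \<open>H\<close> are eliminated by lifting. If none is left and no \<open>\<tau>\<close> vanishes, either \<open>s\<close> has
  a neighbour, which has positive \<open>\<tau>\<close>, or all \<open>\<tau>\<close> are positive and any vertex may become the
  exceptional one by lowering its \<open>\<tau>\<close> by \<open>2 * m\<close>.
\<close>
lemma mod_problem_solvable:
  fixes V H :: "'v set" and I :: "'i set" and h t :: "'i \<Rightarrow> 'v"
  assumes "mod_problem m V H s z I h t p \<tau>"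
  shows "\<exists>q. solves m V H z I h t p \<tau> q"
  using assms
\<comment> \<open>Every reduction lowers the sum of the three cardinalities, except the choice of an
  exceptional vertex, which only changes whether \<open>s \<in> H\<close>. The factor two makes the
  sum dominate that indicator.\<close>
proof (induction "2 * (card V + card H + card {i \<in> I. h i \<in> V \<and> t i \<in> V}) + of_bool (s \<notin> H)"
    arbitrary: V H s I h t p \<tau> rule: less_induct)
  case less
  interpret mod_problem m V H s z I h t p \<tau> by (rule less.prems)
  let ?real = "\<lambda>I h t V. {i \<in> I. h i \<in> V \<and> t i \<in> V}"
  have smaller: "\<exists>q. solves m V' H' z I' h' t' p' \<tau>' q"
    if "mod_problem m V' H' s' z I' h' t' p' \<tau>'"
      "card V' + card H' + card (?real I' h' t' V') < card V + card H + card (?real I h t V)"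
    for V' H' :: "'v set" and s' and I' :: "'i set" and h' t' :: "'i \<Rightarrow> 'v" and p' \<tau>'
    by (rule less.hyps[OF _ that(1)]) (use that(2) in \<open>auto simp: of_bool_def\<close>)
  have finR: "finite (?real I h t V)" using finI by simp
  show ?case
  proof (cases "\<exists>A. contractible A")
    case True
    then obtain A where "contractible A" by blast
    then show ?thesis
      by (rule contract) (rule smaller, auto)
  next
    case False
    then have nc: "\<And>A. \<not> contractible A" by blast
    show ?thesis
    proof (cases "H = V")
      case False
      then obtain x where x: "x \<in> V - H" using HV by blast
      show ?thesis
      proof (cases "d {x} = 0")
        case True
        let ?I = "{i \<in> I. h i \<noteq> x \<and> t i \<noteq> x}"
        have "card (V - {x}) < card V" using x finV by (intro psubset_card_mono) auto
        moreover have "card (?real ?I h t (V - {x})) \<le> card (?real I h t V)"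
          using finR by (intro card_mono) auto
        ultimately have "\<exists>q. solves m (V - {x}) H z ?I h t p \<tau> q"
          by (intro smaller[OF remove_isolated(1)[OF x True]]) simp
        then show ?thesis using remove_isolated(2)[OF x True] by blast
      next
        case False
        define oth where "oth k = (if h k = x then t k else h k)" for k
        let ?X = "{k \<in> I. (h k = x) \<noteq> (t k = x)}"
        have dX: "d {x} = int (card ?X)" using finI by (simp add: cutd_def Collect_conj_eq[symmetric] Int_def)
        have finX: "finite ?X" using finI by simp
        have "even (card ?X)" using parity[of x] light[OF x] x dX by simp
        moreover have "card ?X \<noteq> 0" using False dX by simp
        ultimately have two: "2 \<le> card ?X" by presburger
        \<comment> \<open>If all edges at \<open>x\<close> led to \<open>z\<close>, taking
          \<open>x\<close> out of \<open>V\<close> would remove at least two edges from the cut,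
          against \<open>cut3\<close>.\<close>
        have "\<exists>i\<in>?X. oth i \<noteq> z"
        proof (rule ccontr)
          assume "\<not> ?thesis"
          then have allz: "\<And>k. k \<in> ?X \<Longrightarrow> oth k = z" by blast
          have "d (V - {x}) + d {x} = d V"
            unfolding cutd_def sum.distrib[symmetric]
          proof (intro sum.cong refl)
            fix k assume k: "k \<in> I"
            have "(h k = x) = (t k = x) \<or> h k = x \<and> t k = z \<or> t k = x \<and> h k = z"
              using allz k unfolding oth_def by (cases "h k = x"; cases "t k = x") fastforce+
            then show "of_bool ((h k \<in> V - {x}) \<noteq> (t k \<in> V - {x})) + of_bool ((h k \<in> {x}) \<noteq> (t k \<in> {x}))
                = (of_bool ((h k \<in> V) \<noteq> (t k \<in> V)) :: int)"
              using zV x by auto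
          qed
          moreover have "d V \<le> d (V - {x})" using cut3[of "V - {x}"] x HV by blast
          ultimately show False using two dX by simp
        qed
        then obtain i where i: "i \<in> ?X" "oth i \<noteq> z" by blast
        \<comment> \<open>Different neighbours are preferred; a pair that becomes a loop is lifted
          only if \<open>x\<close> has a single neighbour.\<close>
        have "\<exists>j\<in>?X. j \<noteq> i \<and> (oth i \<noteq> oth j \<or> (\<forall>k\<in>?X. oth k = oth i))"
        proof (cases "\<forall>k\<in>?X. oth k = oth i")
          case True
          have "card ?X - 1 = card (?X - {i})" using i finX by simp
          then have "card (?X - {i}) \<noteq> 0" using two by simp
          then have "?X - {i} \<noteq> {}" by (metis card.empty)
          then show ?thesis using True by blast
        next
          case False
          then obtain j where j: "j \<in> ?X" "oth j \<noteq> oth i" by blast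
          then have "j \<noteq> i \<and> oth i \<noteq> oth j" by auto
          then show ?thesis using j(1) by blast
        qed
        then obtain j where j: "j \<in> ?X" "j \<noteq> i" "oth i \<noteq> oth j \<or> (\<forall>k\<in>?X. oth k = oth i)"
          by (elim bexE conjE)
        have prem: "i \<in> I" "j \<in> I" "i \<noteq> j" "(h i = x) \<noteq> (t i = x)" "(h j = x) \<noteq> (t j = x)"
          using i(1) j(1,2) by auto
        have dist: "oth i \<noteq> oth j \<or> (\<forall>k\<in>I. (h k = x) \<noteq> (t k = x) \<longrightarrow> oth k = oth i)" using j(3) by blast
        note L = lift_pair[OF nc x prem i(2)[unfolded oth_def] dist[unfolded oth_def]]
        obtain q where "solves m V H z (I - {j}) (h(i := if h i = x then t i else h i))
            (t(i := if h j = x then t j else h j)) (p(i := (if h j = x then 1 else - 1) * p j)) \<tau> q"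
          using smaller[OF L(1)] L(3) by auto
        then show ?thesis by (rule L(2))
      qed
    next
      case True
      have "card V \<noteq> 0" using Hne HV finV by auto
      then consider "card V = 1" | "card V = 2" | "3 \<le> card V" by linarith
      then show ?thesis
      proof cases
        case 1
        then obtain y where "V = {y}" by (auto simp: card_1_singleton_iff)
        then show ?thesis using base_one True by blast
      next
        case 2
        then obtain x y where "V = {x, y}" "x \<noteq> y" by (auto simp: card_2_iff)
        then show ?thesis using base_two True by blast
      next
        case 3
        show ?thesis
        proof (cases "\<exists>x\<in>V. \<tau> x = 0")
          case True
          then obtain x where x: "x \<in> V" "\<tau> x = 0" by blast
          note L = make_light[OF nc \<open>H = V\<close> 3 x]
          have "card (V - {x}) < card V" using x finV by (intro psubset_card_mono) auto
          then have "\<exists>q. solves m V (V - {x}) z I h t p \<tau> q"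
            by (intro smaller[OF L(1)]) (simp add: \<open>H = V\<close>)
          then show ?thesis using L(2) by blast
        next
          case False
          show ?thesis
          proof (cases "s \<in> V")
            case True
            obtain i y where i: "i \<in> I" "h i = y \<and> t i = s \<or> h i = s \<and> t i = y" "y \<in> V" "y \<noteq> s"
              using special_has_neighbor[OF nc \<open>H = V\<close> 3 True] by blast
            have "0 < \<tau> y" "\<tau> s < 0"
              using range[of y] srange i True \<open>H = V\<close> False by force+
            note L = direct_edge[OF nc \<open>H = V\<close> i(1-4) this(1) True this(2)]
            have "?real (I - {i}) h t V \<subset> ?real I h t V" using i True by auto
            then have "card (?real (I - {i}) h t V) < card (?real I h t V)"
              using finR psubset_card_mono by blast
            then have "\<exists>q. solves m V H z (I - {i}) h t p (\<tau>(y := \<tau> y - 1, s := \<tau> s + 1)) q"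
              by (intro smaller[OF L(1)]) simp
            then show ?thesis using L(2) by blast
          next
            case no_s: False
            obtain x where x: "x \<in> V" using \<open>H = V\<close> Hne by blast
            then have "0 < \<tau> x" using range[of x] no_s \<open>H = V\<close> False by force
            note L = make_special[OF \<open>H = V\<close> no_s x this]
            have "\<exists>q. solves m V H z I h t p (\<tau>(x := \<tau> x - 2 * m)) q"
              by (rule less.hyps[OF _ L(1)]) (use x no_s \<open>H = V\<close> in simp)
            then show ?thesis using L(2) by blast
          qed
        qed
      qed
    qed
  qed
qed

section \<open>Selection and packing\<close>

text \<open>
  For a minimal set that still satisfies the condition, tight sets outside which the label \<open>l\<close> does
  not exceed its capacity are closed under intersection; this excludes a label exceeding it altogether.
\<close>
lemma supermodular_selection:
  fixes lab :: "'o \<Rightarrow> 'l" and c :: "'l \<Rightarrow> nat" and d :: "'o set \<Rightarrow> int"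
  assumes finW: "finite W"
    and super: "\<And>F F'. F \<subseteq> W \<Longrightarrow> F' \<subseteq> W \<Longrightarrow> d F + d F' \<le> d (F \<inter> F') + d (F \<union> F')"
    and cond: "\<And>F. F \<subseteq> W \<Longrightarrow> d F \<le> (\<Sum>l\<in>lab ` W. int (min (c l) (card {w \<in> W - F. lab w = l})))"
  obtains X where "X \<subseteq> W" "\<And>l. card {w \<in> X. lab w = l} \<le> c l"
    "\<And>F. F \<subseteq> W \<Longrightarrow> d F \<le> int (card (X - F))"
proof -
  define a where "a X l F = card {w \<in> X - F. lab w = l}" for X l F
  define g where "g X F = (\<Sum>l\<in>lab ` W. int (min (c l) (a X l F)))" for X F
  let ?good = "{X. X \<subseteq> W \<and> (\<forall>F\<subseteq>W. d F \<le> g X F)}"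
  have "finite ?good" using finW by simp
  moreover have "W \<in> ?good" using cond by (simp add: g_def a_def)
  then have "?good \<noteq> {}" by blast
  ultimately obtain X where X: "X \<in> ?good" and min: "\<And>Y. Y \<in> ?good \<Longrightarrow> card X \<le> card Y"
    by (rule finite_minimizer[of ?good card]) blast
  have XW: "X \<subseteq> W" and Xd: "\<And>F. F \<subseteq> W \<Longrightarrow> d F \<le> g X F" using X by auto
  have finX: "finite X" using XW finW finite_subset by blast
  have cap: "card {w \<in> X. lab w = l} \<le> c l" for l
  proof (rule ccontr)
    let ?Xl = "{w \<in> X. lab w = l}"
    assume over: "\<not> card ?Xl \<le> c l"
    then have ne: "?Xl \<noteq> {}" by force
    then have l: "l \<in> lab ` W" using XW by blast
    define tight where "tight F \<longleftrightarrow> F \<subseteq> W \<and> d F = g X F \<and> a X l F \<le> c l" for F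
    \<comment> \<open>Without \<open>e\<close> some inequality fails by minimality of
      \<open>X\<close>. It must see the loss of \<open>e\<close>, so \<open>e \<notin> F\<close> and
      the label \<open>l\<close> is not cut off by its capacity; the loss being one, the inequality
      was an equality.\<close>
    have ex: "\<exists>F. tight F \<and> e \<notin> F" if e: "e \<in> ?Xl" for e
    proof -
      have "card (X - {e}) < card X" using e finX by (intro psubset_card_mono) auto
      then have "X - {e} \<notin> ?good" using min[of "X - {e}"] by linarith
      then have "\<not> (\<forall>F\<subseteq>W. d F \<le> g (X - {e}) F)" using XW by blast
      then obtain F where F: "F \<subseteq> W" "g (X - {e}) F < d F" by (meson not_le)
      have less: "g (X - {e}) F < g X F" using F(2) Xd[OF F(1)] by linarith
      have eF: "e \<notin> F"
      proof
        assume "e \<in> F"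
        then have "X - {e} - F = X - F" by blast
        then show False using less by (simp add: g_def a_def)
      qed
      have same: "a (X - {e}) l' F = a X l' F" if "l' \<noteq> l" for l'
        unfolding a_def by (intro arg_cong[where f=card]) (use e that in auto)
      have "{w \<in> X - F. lab w = l} = insert e {w \<in> X - {e} - F. lab w = l}" using e eF by auto
      then have one: "a X l F = Suc (a (X - {e}) l F)" unfolding a_def using finX by simp
      have split: "g Y F = int (min (c l) (a Y l F)) + (\<Sum>l'\<in>lab ` W - {l}. int (min (c l') (a Y l' F)))" for Y
        unfolding g_def using l finW by (simp add: sum.remove)
      have "(\<Sum>l'\<in>lab ` W - {l}. int (min (c l') (a (X - {e}) l' F))) = (\<Sum>l'\<in>lab ` W - {l}. int (min (c l') (a X l' F)))"
        by (intro sum.cong) (use same in auto)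
      then have diff: "g X F - g (X - {e}) F = int (min (c l) (a X l F)) - int (min (c l) (a (X - {e}) l F))"
        unfolding split by simp
      then have "a X l F \<le> c l" using less one by (auto simp: min_def split: if_splits)
      moreover have "g X F \<le> g (X - {e}) F + 1" using diff one by (auto simp: min_def split: if_splits)
      then have "d F = g X F" using F Xd[OF F(1)] by linarith
      ultimately show ?thesis using F(1) eF unfolding tight_def by blast
    qed
    have inter: "tight (F \<inter> F')" if F: "tight F" and F': "tight F'" for F F'
    proof -
      have FW: "F \<subseteq> W" "F' \<subseteq> W" using F F' by (auto simp: tight_def)
      have card_eq: "a X l' (F \<inter> F') + a X l' (F \<union> F') = a X l' F + a X l' F'"
        "a X l' (F \<union> F') \<le> a X l' F" "a X l' (F \<union> F') \<le> a X l' F'" for l'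
      proof -
        have sets: "{w \<in> X - (F \<inter> F'). lab w = l'} = {w \<in> X - F. lab w = l'} \<union> {w \<in> X - F'. lab w = l'}"
          "{w \<in> X - (F \<union> F'). lab w = l'} = {w \<in> X - F. lab w = l'} \<inter> {w \<in> X - F'. lab w = l'}" by auto
        show "a X l' (F \<inter> F') + a X l' (F \<union> F') = a X l' F + a X l' F'"
          unfolding a_def sets by (rule card_Un_Int[symmetric]) (use finX in auto)
        show "a X l' (F \<union> F') \<le> a X l' F" "a X l' (F \<union> F') \<le> a X l' F'"
          unfolding a_def using finX by (auto intro!: card_mono)
      qed
      have termle: "int (min (c l') (a X l' (F \<inter> F'))) + int (min (c l') (a X l' (F \<union> F')))
          \<le> int (min (c l') (a X l' F)) + int (min (c l') (a X l' F'))" for l'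
        using card_eq[of l'] by (auto simp: min_def)
      have cap_d: "d (F \<inter> F') \<le> g X (F \<inter> F')" "d (F \<union> F') \<le> g X (F \<union> F')"
        using FW by (intro Xd; blast)+
      have ge: "g X F + g X F' \<le> g X (F \<inter> F') + g X (F \<union> F')"
        using super[OF FW] cap_d F F' unfolding tight_def by linarith
      have le: "g X (F \<inter> F') + g X (F \<union> F') \<le> g X F + g X F'"
        unfolding g_def sum.distrib[symmetric] by (intro sum_mono termle)
      have "d (F \<inter> F') = g X (F \<inter> F')"
        using super[OF FW] cap_d F F' le unfolding tight_def by linarith
      \<comment> \<open>Above the capacity the truncation loses something at
        \<open>F \<inter> F'\<close> but nothing at \<open>F\<close> and \<open>F'\<close>, so the
        submodular inequality for \<open>g\<close> would be strict.\<close>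
      moreover have "a X l (F \<inter> F') \<le> c l"
      proof (rule ccontr)
        assume "\<not> ?thesis"
        then have "int (min (c l) (a X l (F \<inter> F'))) + int (min (c l) (a X l (F \<union> F')))
          < int (min (c l) (a X l F)) + int (min (c l) (a X l F'))"
          using card_eq[of l] F F' by (auto simp: tight_def min_def)
        then have "g X (F \<inter> F') + g X (F \<union> F') < g X F + g X F'"
          unfolding g_def sum.distrib[symmetric] using termle l finW by (intro sum_strict_mono_ex1) auto
        then show False using ge by simp
      qed
      ultimately show ?thesis using FW by (auto simp: tight_def)
    qed
    \<comment> \<open>Intersecting one tight set for each element labelled \<open>l\<close> gives a
      tight set that contains none of them. All of them are then counted outside it, which
      contradicts the excess over \<open>c l\<close>.\<close>
    have all: "\<exists>F. tight F \<and> T \<inter> F = {}" if "finite T" "T \<noteq> {}" "T \<subseteq> ?Xl" for T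
      using that
    proof (induction T rule: finite_ne_induct)
      case (singleton e)
      then show ?case using ex[of e] by auto
    next
      case (insert e T)
      then obtain F F' where "tight F" "T \<inter> F = {}" "tight F'" "e \<notin> F'" using ex[of e] by auto
      then show ?case using inter[of F F'] by (intro exI[of _ "F \<inter> F'"]) auto
    qed
    then obtain F where F: "tight F" "?Xl \<inter> F = {}" using all[OF _ ne subset_refl] finX by auto
    then have "{w \<in> X - F. lab w = l} = ?Xl" by blast
    then show False using F over by (simp add: tight_def a_def)
  qed
  have "d F \<le> int (card (X - F))" if F: "F \<subseteq> W" for F
  proof -
    have "a X l F \<le> c l" for l
    proof -
      have "card {w \<in> X - F. lab w = l} \<le> card {w \<in> X. lab w = l}" using finX by (intro card_mono) auto
      then show ?thesis using cap[of l] unfolding a_def by linarith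
    qed
    then have "g X F = (\<Sum>l\<in>lab ` W. int (a X l F))" unfolding g_def by (simp only: min_absorb2)
    also have "\<dots> = int (card (X - F))"
    proof -
      have "(\<Sum>l\<in>lab ` W. \<Sum>w\<in>{w \<in> X - F. lab w = l}. 1) = (\<Sum>w\<in>X - F. 1::nat)"
        by (rule sum.group) (use XW finX finW in auto)
      then show ?thesis by (simp add: a_def flip: of_nat_sum)
    qed
    finally show ?thesis using Xd[OF F] by simp
  qed
  then show thesis using that XW cap by blast
qed

section \<open>The number of components as a supermodular function\<close>

definition reach :: "'a set set \<Rightarrow> 'a \<Rightarrow> 'a set" where
  "reach F v = {w. (v, w) \<in> (adj_rel F)\<^sup>*}"

definition comps :: "'a set \<Rightarrow> 'a set set \<Rightarrow> int" where
  "comps V F = int (card (reach F ` V))"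

lemma sym_adj: "sym ((adj_rel F)\<^sup>*)"
  by (intro sym_rtrancl) (auto simp: sym_def adj_rel_def insert_commute)

lemma reach_refl [simp]: "v \<in> reach F v"
  by (simp add: reach_def)

lemma reach_eq_iff: "reach F v = reach F w \<longleftrightarrow> w \<in> reach F v"
proof
  assume "w \<in> reach F v"
  then have vw: "(v, w) \<in> (adj_rel F)\<^sup>*" "(w, v) \<in> (adj_rel F)\<^sup>*"
    using sym_adj[of F] by (auto simp: reach_def sym_def)
  then show "reach F v = reach F w" unfolding reach_def by (auto intro: rtrancl_trans)
qed (metis reach_refl)

lemma reach_mono: "F \<subseteq> F' \<Longrightarrow> reach F v \<subseteq> reach F' v"
  unfolding reach_def using rtrancl_mono[of "adj_rel F" "adj_rel F'"] by (auto simp: adj_rel_def)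

lemma reach_insert:
  "reach (insert {a, b} F) v =
    (if v \<in> reach F a \<union> reach F b then reach F a \<union> reach F b else reach F v)"
proof -
  let ?R = "(adj_rel F)\<^sup>*"
  have sym: "(x, y) \<in> ?R \<longleftrightarrow> (y, x) \<in> ?R" for x y using sym_adj[of F] by (auto simp: sym_def)
  have "adj_rel (insert {a, b} F) = insert (a, b) (insert (b, a) (adj_rel F))"
    by (auto simp: adj_rel_def doubleton_eq_iff)
  then have "(x, y) \<in> (adj_rel (insert {a, b} F))\<^sup>* \<longleftrightarrow>
      (x, y) \<in> ?R \<or> (x, a) \<in> ?R \<and> (b, y) \<in> ?R \<or> (x, b) \<in> ?R \<and> (a, y) \<in> ?R \<or>
      (x, a) \<in> ?R \<and> (a, y) \<in> ?R \<or> (x, b) \<in> ?R \<and> (b, y) \<in> ?R" for x y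
    by (auto simp: rtrancl_insert intro: rtrancl_trans)
  then show ?thesis
    unfolding reach_def by (auto simp: sym[of v] intro: rtrancl_trans)
qed

lemma comps_insert:
  assumes V: "finite V" "a \<in> V" "b \<in> V"
  shows "comps V (insert {a, b} F) = comps V F - of_bool (b \<notin> reach F a)"
proof (cases "b \<in> reach F a")
  case True
  then have eq: "reach F a = reach F b" by (simp add: reach_eq_iff)
  have "reach (insert {a, b} F) v = reach F v" for v
    using reach_eq_iff[of F a v] reach_eq_iff[of F b v] unfolding reach_insert eq by auto
  then have "reach (insert {a, b} F) = reach F" by blast
  then show ?thesis using True by (simp add: comps_def)
next
  case False
  then have ne: "reach F a \<noteq> reach F b" by (simp add: reach_eq_iff)
  have eq: "reach (insert {a, b} F) ` V = insert (reach F a \<union> reach F b) (reach F ` V - {reach F a, reach F b})"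
    using V reach_eq_iff[of F a] reach_eq_iff[of F b] by (auto simp: reach_insert image_iff; blast)
  have "reach F a \<union> reach F b \<notin> reach F ` V - {reach F a, reach F b}"
  proof
    assume "reach F a \<union> reach F b \<in> reach F ` V - {reach F a, reach F b}"
    then obtain v where v: "reach F a \<union> reach F b = reach F v" "reach F v \<noteq> reach F a" by auto
    then have "a \<in> reach F v" by (metis UnI1 reach_refl)
    then show False using v reach_eq_iff[of F v a] by simp
  qed
  moreover have "card (reach F ` V - {reach F a, reach F b}) = card (reach F ` V) - 2"
    using V ne by (simp add: card_Diff_subset)
  moreover have "2 \<le> card (reach F ` V)"
  proof -
    have "card {reach F a, reach F b} \<le> card (reach F ` V)" using V by (intro card_mono) auto
    then show ?thesis using ne by simp
  qed
  ultimately show ?thesis using False V unfolding comps_def eq by simp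
qed

section \<open>Cuts and partitions\<close>

definition crossing :: "'a set set \<Rightarrow> 'a set \<Rightarrow> 'a set set" where
  "crossing E S = {e \<in> E. e \<inter> S \<noteq> {} \<and> \<not> e \<subseteq> S}"

definition edges_in :: "'a set \<Rightarrow> 'a set set \<Rightarrow> bool" where
  "edges_in V E \<longleftrightarrow> (\<forall>e\<in>E. \<exists>a\<in>V. \<exists>b\<in>V. e = {a, b})"

lemma edges_in_mono: "edges_in V E \<Longrightarrow> F \<subseteq> E \<Longrightarrow> edges_in V F"
  unfolding edges_in_def by blast

text \<open>Diminishing returns: adding the edges of \<open>D\<close> one at a time, an edge that
  joins two components of the larger graph also joins two components of the smaller one.\<close>

lemma comps_union_diff:
  assumes V: "finite V" and D: "finite D" "edges_in V D" and XY: "X \<subseteq> Y"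
  shows "comps V Y - comps V (Y \<union> D) \<le> comps V X - comps V (X \<union> D)"
  using D
proof (induction D rule: finite_induct)
  case (insert e D)
  obtain a b where e: "a \<in> V" "b \<in> V" "e = {a, b}" using insert.prems by (auto simp: edges_in_def)
  have "reach (X \<union> D) a \<subseteq> reach (Y \<union> D) a" using XY by (intro reach_mono) auto
  then have "of_bool (b \<notin> reach (Y \<union> D) a) \<le> (of_bool (b \<notin> reach (X \<union> D) a) :: int)" by auto
  moreover have "comps V (X \<union> insert e D) = comps V (X \<union> D) - of_bool (b \<notin> reach (X \<union> D) a)"
    "comps V (Y \<union> insert e D) = comps V (Y \<union> D) - of_bool (b \<notin> reach (Y \<union> D) a)"
    using comps_insert[OF V e(1,2)] e(3) by simp_all
  moreover have "edges_in V D" using insert.prems by (auto simp: edges_in_def)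
  ultimately show ?case using insert.IH by linarith
qed simp

text \<open>Up to a constant and the sign, \<open>comps\<close> is the rank function of the graphic
  matroid; this is its submodularity, obtained from diminishing returns with
  \<open>D = F - F'\<close>.\<close>

lemma comps_supermodular:
  assumes V: "finite V" and F: "finite F" "edges_in V F"
  shows "comps V F + comps V F' \<le> comps V (F \<inter> F') + comps V (F \<union> F')"
proof -
  have "comps V F' - comps V (F' \<union> (F - F')) \<le> comps V (F \<inter> F') - comps V (F \<inter> F' \<union> (F - F'))"
    using F by (intro comps_union_diff V) (auto simp: edges_in_def)
  moreover have "F \<inter> F' \<union> (F - F') = F" "F' \<union> (F - F') = F \<union> F'" by auto
  ultimately show ?thesis by simp
qed

lemma comps_antimono:
  assumes V: "finite V" and F: "finite F'" "edges_in V F'" "F \<subseteq> F'"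
  shows "comps V F' \<le> comps V F"
proof -
  have "comps V (F \<union> D) \<le> comps V F" if "finite D" "edges_in V D" for D
    using that
  proof (induction D rule: finite_induct)
    case (insert e D)
    obtain a b where e: "a \<in> V" "b \<in> V" "e = {a, b}" using insert.prems by (auto simp: edges_in_def)
    have "comps V (F \<union> insert e D) \<le> comps V (F \<union> D)" using comps_insert[OF V e(1,2)] e(3) by simp
    moreover have "edges_in V D" using insert.prems by (auto simp: edges_in_def)
    ultimately show ?case using insert.IH by linarith
  qed simp
  then show ?thesis using F by (metis Un_absorb1)
qed

lemma comps_ge_1: "finite V \<Longrightarrow> V \<noteq> {} \<Longrightarrow> 1 \<le> comps V F"
  unfolding comps_def by (simp add: Suc_le_eq card_gt_0_iff)

lemma reach_closed:
  assumes "s \<in> S" "\<And>e. e \<in> F \<Longrightarrow> e \<inter> S \<noteq> {} \<Longrightarrow> e \<subseteq> S"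
  shows "reach F s \<subseteq> S"
proof
  fix w assume "w \<in> reach F s"
  then have "(s, w) \<in> (adj_rel F)\<^sup>*" by (simp add: reach_def)
  then show "w \<in> S"
    by (induction rule: rtrancl_induct) (use assms in \<open>auto simp: adj_rel_def\<close>)
qed

lemma reach_edge: "{a, b} \<in> F \<Longrightarrow> reach F a = reach F b"
  unfolding reach_eq_iff by (auto simp: reach_def adj_rel_def)

lemma comps_ge_2_if_cut:
  assumes V: "finite V" and S: "S \<subseteq> V" "S \<noteq> {}" "S \<noteq> V" and F: "\<And>e. e \<in> F \<Longrightarrow> e \<inter> S \<noteq> {} \<Longrightarrow> e \<subseteq> S"
  shows "2 \<le> comps V F"
proof -
  obtain s v where sv: "s \<in> S" "v \<in> V" "v \<notin> S" using S by blast
  have "reach F s \<noteq> reach F v" using reach_closed[OF sv(1) F] sv by (metis reach_refl subsetD)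
  moreover have "card {reach F s, reach F v} \<le> card (reach F ` V)" using V S sv by (intro card_mono) auto
  ultimately show ?thesis unfolding comps_def by simp
qed

text \<open>Applied to \<open>X\<close> without the edges leaving \<open>S\<close>, the condition
  has at least two components on its left and the cut on its right.\<close>

lemma crossing_ge_if_partition_connected:
  assumes V: "finite V" and S: "S \<subseteq> V" "S \<noteq> {}" "S \<noteq> V"
    and X: "\<And>F. F \<subseteq> X \<Longrightarrow> int q * (comps V F - 1) \<le> int (card (X - F))"
  shows "q \<le> card (crossing X S)"
proof -
  have "2 \<le> comps V (X - crossing X S)"
    by (rule comps_ge_2_if_cut[OF V S]) (auto simp: crossing_def)
  then have "int q * 1 \<le> int q * (comps V (X - crossing X S) - 1)" by (intro mult_left_mono) auto
  also have "\<dots> \<le> int (card (X - (X - crossing X S)))" by (rule X) auto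
  also have "X - (X - crossing X S) = crossing X S" by (auto simp: crossing_def)
  finally show ?thesis by simp
qed

text \<open>Each component of \<open>F\<close> is left by at least \<open>2 * N\<close> edges, all
  of them outside \<open>F\<close>, and each edge leaves at most two components.\<close>

lemma partition_connected_if_crossing_ge:
  assumes V: "finite V" "V \<noteq> {}" and E: "finite E" "edges_in V E" and F: "F \<subseteq> E"
    and cut: "\<And>S. S \<subseteq> V \<Longrightarrow> S \<noteq> {} \<Longrightarrow> S \<noteq> V \<Longrightarrow> 2 * N \<le> card (crossing E S)"
  shows "int N * (comps V F - 1) \<le> int (card (E - F))"
proof (cases "comps V F \<le> 1")
  case True
  then have "int N * (comps V F - 1) \<le> 0" by (simp add: mult_nonneg_nonpos)
  then show ?thesis by linarith
next
  case False
  let ?C = "reach F ` V"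
  have finC: "finite ?C" using V by simp
  have closed: "e \<subseteq> reach F v" if eF: "e \<in> F" "e \<inter> reach F v \<noteq> {}" for e v
  proof -
    obtain a b where e: "e = {a, b}" using eF(1) F E unfolding edges_in_def by blast
    have "reach F a = reach F b" by (rule reach_edge) (use e eF(1) in simp)
    then have "b \<in> reach F v \<longleftrightarrow> a \<in> reach F v" by (metis reach_eq_iff)
    then show ?thesis using eF(2) e by auto
  qed
  have big: "2 * N \<le> card (crossing E C)" if C: "C \<in> ?C" for C
  proof (rule cut)
    obtain v where v: "v \<in> V" "C = reach F v" using C by blast
    show "C \<subseteq> V" unfolding v(2) by (rule reach_closed[OF v(1)]) (use F E in \<open>auto simp: edges_in_def\<close>)
    show "C \<noteq> {}" using v by (metis empty_iff reach_refl)
    show "C \<noteq> V"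
    proof
      assume "C = V"
      then have "?C = {C}" using v by (auto simp: reach_eq_iff[symmetric])
      then show False using False by (simp add: comps_def)
    qed
  qed
  have sub: "card (crossing E C) = (\<Sum>e\<in>E - F. of_bool (e \<in> crossing E C))" if C: "C \<in> ?C" for C
  proof -
    have "crossing E C \<subseteq> E - F" using C closed by (auto simp: crossing_def)
    then show ?thesis using E by (simp add: Int_absorb1)
  qed
  have two: "(\<Sum>C\<in>?C. of_bool (e \<in> crossing E C)) \<le> (2::nat)" if e: "e \<in> E - F" for e
  proof -
    obtain a b where ab: "e = {a, b}" using e E by (auto simp: edges_in_def)
    have "{C \<in> ?C. e \<in> crossing E C} \<subseteq> {reach F a, reach F b}"
      using ab by (auto simp: crossing_def) (metis reach_eq_iff)+
    then have "card {C \<in> ?C. e \<in> crossing E C} \<le> card {reach F a, reach F b}" by (intro card_mono) auto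
    also have "\<dots> \<le> 2" by (simp add: card_insert_if)
    also have "{C \<in> ?C. e \<in> crossing E C} = ?C \<inter> {C. e \<in> crossing E C}" by blast
    finally show ?thesis using finC by simp
  qed
  have "card ?C * (2 * N) \<le> (\<Sum>C\<in>?C. card (crossing E C))" 
    using sum_bounded_below[of ?C "2 * N" "\<lambda>C. card (crossing E C)", OF big] unfolding of_nat_id .
  also have "\<dots> = (\<Sum>C\<in>?C. \<Sum>e\<in>E - F. of_bool (e \<in> crossing E C))"
    by (intro sum.cong refl sub)
  also have "\<dots> = (\<Sum>e\<in>E - F. \<Sum>C\<in>?C. of_bool (e \<in> crossing E C))"
    by (rule sum.swap)
  also have "\<dots> \<le> (\<Sum>e\<in>E - F. 2)" by (intro sum_mono two)
  finally have "N * card ?C \<le> card (E - F)" by (simp add: mult.commute)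
  then have "int N * comps V F \<le> int (card (E - F))" unfolding comps_def by (metis of_nat_le_iff of_nat_mult)
  then show ?thesis by (simp add: algebra_simps)
qed

text \<open>The objects to select are pairs of an edge and the index of a part. Labelling a pair by
  its edge, with capacity one, makes the parts disjoint; the demand is the sum of the demands of the
  parts.\<close>

lemma partition_connected_packing:
  fixes q :: "nat \<Rightarrow> nat"
  assumes V: "finite V" "V \<noteq> {}" and E: "finite E" "edges_in V E"
    and conn: "\<And>F. F \<subseteq> E \<Longrightarrow> int N * (comps V F - 1) \<le> int (card (E - F))"
    and r: "0 < r" "(\<Sum>j<r. q j) \<le> N"
  obtains X where "\<And>j. j < r \<Longrightarrow> X j \<subseteq> E" "\<And>i j. i < r \<Longrightarrow> j < r \<Longrightarrow> i \<noteq> j \<Longrightarrow> X i \<inter> X j = {}"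
    "\<And>j F. j < r \<Longrightarrow> F \<subseteq> E \<Longrightarrow> int (q j) * (comps V F - 1) \<le> int (card (X j - F))"
proof -
  define W where "W = E \<times> {..<r}"
  define part where "part j F = {e. (e, j) \<in> F}" for j :: nat and F :: "('a set \<times> nat) set"
  define d where "d F = (\<Sum>j<r. int (q j) * (comps V (part j F) - 1))" for F
  have part: "part j F \<subseteq> E" if "F \<subseteq> W" for j F using that by (auto simp: part_def W_def)
  have finp: "finite (part j F)" "edges_in V (part j F)" if "F \<subseteq> W" for j F
    using finite_subset[OF part[OF that] E(1)] edges_in_mono[OF E(2) part[OF that]] by simp_all
  have labW: "fst ` W = E" using r by (auto simp: W_def image_iff)
  obtain X where X: "X \<subseteq> W" "\<And>e. card {w \<in> X. fst w = e} \<le> 1" "\<And>F. F \<subseteq> W \<Longrightarrow> d F \<le> int (card (X - F))"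
  proof (rule supermodular_selection[where W = W and d = d and lab = fst and c = "\<lambda>_. 1"])
    show "finite W" using E by (simp add: W_def)
    fix F assume F: "F \<subseteq> W"
    show "d F + d F' \<le> d (F \<inter> F') + d (F \<union> F')" if F': "F' \<subseteq> W" for F'
      unfolding d_def sum.distrib[symmetric]
    proof (intro sum_mono)
      fix j
      have parts: "part j (F \<inter> F') = part j F \<inter> part j F'" "part j (F \<union> F') = part j F \<union> part j F'"
        by (auto simp: part_def)
      have "comps V (part j F) + comps V (part j F') \<le> comps V (part j (F \<inter> F')) + comps V (part j (F \<union> F'))"
        unfolding parts by (rule comps_supermodular[OF V(1) finp[OF F]])
      then have "int (q j) * (comps V (part j F) + comps V (part j F'))
          \<le> int (q j) * (comps V (part j (F \<inter> F')) + comps V (part j (F \<union> F')))" by (intro mult_left_mono) auto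
      then show "int (q j) * (comps V (part j F) - 1) + int (q j) * (comps V (part j F') - 1)
          \<le> int (q j) * (comps V (part j (F \<inter> F')) - 1) + int (q j) * (comps V (part j (F \<union> F')) - 1)"
        by (simp add: algebra_simps)
    qed
    \<comment> \<open>The edges without a copy outside \<open>F\<close> are exactly those that
      contribute nothing on the right. They lie in every \<open>part j F\<close>, so one application
      of \<open>conn\<close> to \<open>G\<close> covers all parts.\<close>
    define G where "G = {e \<in> E. \<forall>j<r. (e, j) \<in> F}"
    have GE: "G \<subseteq> E" by (auto simp: G_def)
    have "d F \<le> (\<Sum>j<r. int (q j) * (comps V G - 1))"
      unfolding d_def
    proof (intro sum_mono mult_left_mono)
      fix j assume "j \<in> {..<r}"
      then have "G \<subseteq> part j F" by (auto simp: G_def part_def)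
      then have "comps V (part j F) \<le> comps V G"
        by (rule comps_antimono[OF V(1) finp[OF F]])
      then show "comps V (part j F) - 1 \<le> comps V G - 1" by simp
    qed simp
    also have "\<dots> = int (\<Sum>j<r. q j) * (comps V G - 1)" by (simp add: sum_distrib_right)
    also have "\<dots> \<le> int N * (comps V G - 1)"
    proof (rule mult_right_mono)
      show "int (\<Sum>j<r. q j) \<le> int N" using r(2) by (simp only: of_nat_le_iff)
    qed (use comps_ge_1[OF V, of G] in simp)
    also have "\<dots> \<le> int (card (E - G))" by (rule conn[OF GE])
    also have "int (card (E - G)) = (\<Sum>e\<in>E. int (of_bool (e \<notin> G)))"
    proof -
      have "E - G = E \<inter> {e. e \<notin> G}" by blast
      then show ?thesis using E(1) by simp
    qed
    also have "\<dots> \<le> (\<Sum>e\<in>E. int (min 1 (card {w \<in> W - F. fst w = e})))"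
    proof (intro sum_mono)
      fix e assume e: "e \<in> E"
      have "0 < card {w \<in> W - F. fst w = e}" if eG: "e \<notin> G"
      proof -
        obtain j where "j < r" "(e, j) \<notin> F" using eG e unfolding G_def by blast
        then have "(e, j) \<in> {w \<in> W - F. fst w = e}" using e by (auto simp: W_def)
        moreover have "finite {w \<in> W - F. fst w = e}" using E by (simp add: W_def)
        ultimately show ?thesis by (auto simp: card_gt_0_iff)
      qed
      then show "int (of_bool (e \<notin> G)) \<le> int (min 1 (card {w \<in> W - F. fst w = e}))" by auto
    qed
    finally show "d F \<le> (\<Sum>l\<in>fst ` W. int (min 1 (card {w \<in> W - F. fst w = l})))" unfolding labW .
  qed blast
  show thesis
  proof (rule that[of "\<lambda>j. part j X"])
    show "part j X \<subseteq> E" for j by (rule part[OF X(1)])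
    show "part i X \<inter> part j X = {}" if "i \<noteq> j" for i j
    proof (rule ccontr)
      assume "\<not> ?thesis"
      then obtain e where "(e, i) \<in> X" "(e, j) \<in> X" by (auto simp: part_def)
      then have "{(e, i), (e, j)} \<subseteq> {w \<in> X. fst w = e}" by auto
      moreover have "finite {w \<in> X. fst w = e}" using X(1) E finite_subset[of X W] by (simp add: W_def)
      ultimately have "card {(e, i), (e, j)} \<le> card {w \<in> X. fst w = e}" by (intro card_mono)
      then show False using X(2)[of e] that by simp
    qed
    show "int (q j) * (comps V F - 1) \<le> int (card (part j X - F))" if j: "j < r" and F: "F \<subseteq> E" for j F
    proof -
      \<comment> \<open>All pairs with another index are put into \<open>F'\<close>, so only part
        \<open>j\<close> is counted on the right, while the other terms of the demand are
        nonnegative.\<close>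
      define F' where "F' = F \<times> {j} \<union> E \<times> ({..<r} - {j})"
      have F'W: "F' \<subseteq> W" using F j by (auto simp: F'_def W_def)
      have pj: "part j F' = F" by (auto simp: F'_def part_def)
      have nonneg: "0 \<le> int (q i) * (comps V G - 1)" for i G
        using comps_ge_1[OF V, of G] by simp
      have "int (q j) * (comps V F - 1) \<le> d F'"
        unfolding d_def pj[symmetric]
        by (rule member_le_sum) (use j nonneg in auto)
      also have "\<dots> \<le> int (card (X - F'))" by (rule X(3)[OF F'W])
      also have "X - F' = (part j X - F) \<times> {j}" using X(1) j F by (auto simp: F'_def part_def W_def)
      finally show ?thesis by (simp add: card_cartesian_product)
    qed
  qed
qed

section \<open>Subgraphs of bipartite graphs\<close>

definition bip :: "'a set \<Rightarrow> 'a set \<Rightarrow> 'a set set \<Rightarrow> bool" where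
  "bip A B E \<longleftrightarrow> finite A \<and> finite B \<and> A \<inter> B = {} \<and> (\<forall>e\<in>E. \<exists>a\<in>A. \<exists>b\<in>B. e = {a, b})"

definition end_in :: "'a set \<Rightarrow> 'a set \<Rightarrow> 'a" where
  "end_in A e = the_elem (e \<inter> A)"

definition deg :: "'a set set \<Rightarrow> 'a \<Rightarrow> nat" where
  "deg F x = card {e \<in> F. x \<in> e}"

lemma bip_sym: "bip A B E \<Longrightarrow> bip B A E"
  unfolding bip_def by (auto simp: Int_commute dest!: bspec intro: insert_commute)

lemma bip_mono: "bip A B E \<Longrightarrow> F \<subseteq> E \<Longrightarrow> bip A B F"
  unfolding bip_def by blast

lemma bip_edge:
  assumes "bip A B E" "e \<in> E"
  shows "end_in A e \<in> A" "end_in B e \<in> B" "e = {end_in A e, end_in B e}"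
    "x \<in> A \<Longrightarrow> x \<in> e \<longleftrightarrow> end_in A e = x" "x \<in> B \<Longrightarrow> x \<in> e \<longleftrightarrow> end_in B e = x"
proof -
  obtain a b where ab: "a \<in> A" "b \<in> B" "e = {a, b}" "A \<inter> B = {}" using assms by (auto simp: bip_def)
  then have "e \<inter> A = {a}" "e \<inter> B = {b}" by auto
  then have *: "end_in A e = a" "end_in B e = b" by (simp_all add: end_in_def)
  show "end_in A e \<in> A" "end_in B e \<in> B" "e = {end_in A e, end_in B e}" using * ab by auto
  show "x \<in> A \<Longrightarrow> x \<in> e \<longleftrightarrow> end_in A e = x" "x \<in> B \<Longrightarrow> x \<in> e \<longleftrightarrow> end_in B e = x"
    using * ab by auto
qed

lemma bip_edges_in: "bip A B E \<Longrightarrow> edges_in (A \<union> B) E"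
  unfolding bip_def edges_in_def by blast

lemma bip_finite: assumes "bip A B E" shows "finite E"
proof -
  have "E \<subseteq> Pow (A \<union> B)" using assms by (fastforce simp: bip_def)
  moreover have "finite (Pow (A \<union> B))" using assms by (simp add: bip_def)
  ultimately show ?thesis by (rule finite_subset)
qed

lemma deg_end:
  assumes "bip A B E" "F \<subseteq> E" "x \<in> A"
  shows "deg F x = card {e \<in> F. end_in A e = x}"
proof -
  have "{e \<in> F. x \<in> e} = {e \<in> F. end_in A e = x}"
    using bip_edge(4)[OF assms(1) _ assms(3)] assms(2) by blast
  then show ?thesis by (simp add: deg_def)
qed

lemma sum_deg:
  assumes b: "bip A B E" and F: "F \<subseteq> E" and T: "T \<subseteq> A"
  shows "(\<Sum>x\<in>T. deg F x) = card {e \<in> F. end_in A e \<in> T}"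
proof -
  have fin: "finite F" "finite T" using bip_finite[OF b] F T b finite_subset by (auto simp: bip_def)
  have 1: "(\<Sum>x\<in>T. \<Sum>e\<in>{e \<in> {e \<in> F. end_in A e \<in> T}. end_in A e = x}. 1) = (\<Sum>e\<in>{e \<in> F. end_in A e \<in> T}. 1::nat)"
    by (rule sum.group) (use fin in auto)
  have 2: "deg F x = (\<Sum>e\<in>{e \<in> {e \<in> F. end_in A e \<in> T}. end_in A e = x}. 1)" if "x \<in> T" for x
  proof -
    have "{e \<in> {e \<in> F. end_in A e \<in> T}. end_in A e = x} = {e \<in> F. end_in A e = x}" using that by blast
    moreover have "x \<in> A" using that T by blast
    ultimately show ?thesis using deg_end[OF b F] by simp
  qed
  have "(\<Sum>x\<in>T. deg F x) = (\<Sum>x\<in>T. \<Sum>e\<in>{e \<in> {e \<in> F. end_in A e \<in> T}. end_in A e = x}. 1)"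
    by (intro sum.cong refl 2)
  then show ?thesis unfolding 1 by simp
qed

lemma sum_deg_all:
  assumes b: "bip A B E" and F: "F \<subseteq> E"
  shows "(\<Sum>x\<in>A. deg F x) = card F"
proof -
  have "{e \<in> F. end_in A e \<in> A} = F" using bip_edge(1)[OF b] F by blast
  then show ?thesis using sum_deg[OF b F, of A] by simp
qed

lemma deg_mono: "finite F \<Longrightarrow> G \<subseteq> F \<Longrightarrow> deg G x \<le> deg F x"
  unfolding deg_def by (intro card_mono) auto

lemma deg_Un_disjoint: "finite F \<Longrightarrow> finite G \<Longrightarrow> F \<inter> G = {} \<Longrightarrow> deg (F \<union> G) x = deg F x + deg G x"
proof -
  assume *: "finite F" "finite G" "F \<inter> G = {}"
  have "{e \<in> F \<union> G. x \<in> e} = {e \<in> F. x \<in> e} \<union> {e \<in> G. x \<in> e}" by auto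
  then show ?thesis unfolding deg_def using * by (simp add: card_Un_disjoint disjoint_iff)
qed

lemma deg_diff:
  assumes "finite F" "G \<subseteq> F"
  shows "deg (F - G) x = deg F x - deg G x"
proof -
  have "deg ((F - G) \<union> G) x = deg (F - G) x + deg G x"
    by (rule deg_Un_disjoint) (use assms finite_subset in auto)
  moreover have "(F - G) \<union> G = F" using assms by blast
  ultimately show ?thesis by simp
qed

text \<open>Weight \<open>q / t\<close> on every edge of \<open>H\<close> turns the condition for
  \<open>t\<close> into that for \<open>q\<close>, and \<open>load\<close> says that the weighted
  degree at \<open>u\<close> is at most \<open>c u\<close>. Selection with the end in
  \<open>A\<close> as label rounds these weights; \<open>q \<le> t\<close> keeps them at most
  one.\<close>

lemma low_degree_subgraph:
  assumes b: "bip A B E" and H: "H \<subseteq> E" and t: "0 < t" "q \<le> t"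
    and conn: "\<And>F. F \<subseteq> H \<Longrightarrow> int t * (comps (A \<union> B) F - 1) \<le> int (card (H - F))"
    and load: "\<And>u. u \<in> A \<Longrightarrow> q * deg H u \<le> t * c u"
  obtains Q where "Q \<subseteq> H" "\<And>u. u \<in> A \<Longrightarrow> deg Q u \<le> c u"
    "\<And>F. F \<subseteq> H \<Longrightarrow> int q * (comps (A \<union> B) F - 1) \<le> int (card (Q - F))"
proof -
  have finH: "finite H" using bip_finite[OF bip_mono[OF b H]] .
  have finV: "finite (A \<union> B)" using b by (simp add: bip_def)
  have ein: "edges_in (A \<union> B) H" using bip_edges_in[OF bip_mono[OF b H]] .
  obtain Q where Q: "Q \<subseteq> H" "\<And>u. card {e \<in> Q. end_in A e = u} \<le> c u"
    "\<And>F. F \<subseteq> H \<Longrightarrow> int q * (comps (A \<union> B) F - 1) \<le> int (card (Q - F))"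
  proof (rule supermodular_selection[where W = H and lab = "end_in A" and c = c
        and d = "\<lambda>F. int q * (comps (A \<union> B) F - 1)"])
    show "finite H" by (rule finH)
    fix F assume F: "F \<subseteq> H"
    show "int q * (comps (A \<union> B) F - 1) + int q * (comps (A \<union> B) F' - 1)
        \<le> int q * (comps (A \<union> B) (F \<inter> F') - 1) + int q * (comps (A \<union> B) (F \<union> F') - 1)" if "F' \<subseteq> H" for F'
    proof -
      have "comps (A \<union> B) F + comps (A \<union> B) F' \<le> comps (A \<union> B) (F \<inter> F') + comps (A \<union> B) (F \<union> F')"
        by (rule comps_supermodular[OF finV finite_subset[OF F finH] edges_in_mono[OF ein F]])
      then have "int q * (comps (A \<union> B) F + comps (A \<union> B) F')
          \<le> int q * (comps (A \<union> B) (F \<inter> F') + comps (A \<union> B) (F \<union> F'))" by (intro mult_left_mono) auto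
      then show ?thesis by (simp add: algebra_simps)
    qed
    let ?x = "\<lambda>u. card {e \<in> H - F. end_in A e = u}"
    have "int t * (int q * (comps (A \<union> B) F - 1)) = int q * (int t * (comps (A \<union> B) F - 1))" by simp
    also have "\<dots> \<le> int q * int (card (H - F))" by (intro mult_left_mono conn F) simp
    also have "card (H - F) = (\<Sum>u\<in>end_in A ` H. ?x u)"
    proof -
      have "(\<Sum>u\<in>end_in A ` H. \<Sum>e\<in>{e \<in> H - F. end_in A e = u}. 1) = (\<Sum>e\<in>H - F. 1::nat)"
        by (rule sum.group) (use finH in auto)
      then show ?thesis by simp
    qed
    also have "int q * int (\<Sum>u\<in>end_in A ` H. ?x u) = (\<Sum>u\<in>end_in A ` H. int (q * ?x u))"
      by (simp add: sum_distrib_left)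
    also have "\<dots> \<le> (\<Sum>u\<in>end_in A ` H. int (t * min (c u) (?x u)))"
    proof (intro sum_mono, unfold of_nat_le_iff)
      fix u assume "u \<in> end_in A ` H"
      then have u: "u \<in> A" using bip_edge(1)[OF b] H by blast
      have "?x u \<le> deg H u" unfolding deg_end[OF b H u] using finH by (intro card_mono) auto
      then have "q * ?x u \<le> t * c u" using load[OF u] by (meson le_trans mult_le_mono2)
      moreover have "q * ?x u \<le> t * ?x u" using t by simp
      ultimately show "q * ?x u \<le> t * min (c u) (?x u)" by (simp add: min_def)
    qed
    also have "\<dots> = int t * (\<Sum>u\<in>end_in A ` H. int (min (c u) (?x u)))"
      by (simp add: sum_distrib_left)
    finally show "int q * (comps (A \<union> B) F - 1) \<le> (\<Sum>u\<in>end_in A ` H. int (min (c u) (?x u)))"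
      using t by (simp add: mult_le_cancel_left)
  qed blast
  show thesis
  proof (rule that)
    show "deg Q u \<le> c u" if "u \<in> A" for u
      using Q(2)[of u] deg_end[OF b _ that, of Q] Q(1) H by simp
  qed (use Q in auto)
qed

text \<open>Weight \<open>1 / k\<close> on every edge has the desired degrees. Selection bounds the
  degrees in \<open>A\<close> above by the capacities and those in \<open>B\<close> below by the
  demand; both sides have the same total, so equality holds everywhere.\<close>

lemma divisible_degrees_subgraph:
  assumes b: "bip A B K" and k: "0 < k" and dv: "\<And>x. x \<in> A \<union> B \<Longrightarrow> k dvd deg K x"
  obtains M where "M \<subseteq> K" "\<And>x. x \<in> A \<union> B \<Longrightarrow> k * deg M x = deg K x"
proof -
  have finK: "finite K" by (rule bip_finite[OF b])
  have finB: "finite B" and finA: "finite A" using b by (auto simp: bip_def)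
  \<comment> \<open>The vertices of \<open>B\<close> that \<open>F\<close> does not touch. Their
    total demand is supermodular: \<open>T\<close> turns unions into intersections and only gains on
    intersections of edge sets.\<close>
  define T where "T F = {v \<in> B. \<forall>e\<in>F. v \<notin> e}" for F
  define n where "n x = deg K x div k" for x
  have kn: "k * n x = deg K x" if "x \<in> A \<union> B" for x using dv[OF that] by (simp add: n_def)
  obtain M where M: "M \<subseteq> K" "\<And>u. card {e \<in> M. end_in A e = u} \<le> n u"
    "\<And>F. F \<subseteq> K \<Longrightarrow> (\<Sum>v\<in>T F. int (n v)) \<le> int (card (M - F))"
  proof (rule supermodular_selection[where W = K and lab = "end_in A" and c = n
        and d = "\<lambda>F. \<Sum>v\<in>T F. int (n v)"])
    show "finite K" by (rule finK)
    fix F assume F: "F \<subseteq> K"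
    show "(\<Sum>v\<in>T F. int (n v)) + (\<Sum>v\<in>T F'. int (n v))
        \<le> (\<Sum>v\<in>T (F \<inter> F'). int (n v)) + (\<Sum>v\<in>T (F \<union> F'). int (n v))" for F'
    proof -
      have fin: "finite (T F)" for F using finB by (simp add: T_def)
      have "(\<Sum>v\<in>T F. int (n v)) + (\<Sum>v\<in>T F'. int (n v))
          = (\<Sum>v\<in>T F \<union> T F'. int (n v)) + (\<Sum>v\<in>T F \<inter> T F'. int (n v))"
        by (rule sum.union_inter[symmetric]) (rule fin)+
      also have "T F \<inter> T F' = T (F \<union> F')" by (auto simp: T_def)
      also have "(\<Sum>v\<in>T F \<union> T F'. int (n v)) \<le> (\<Sum>v\<in>T (F \<inter> F'). int (n v))"
        by (intro sum_mono2 fin) (auto simp: T_def)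
      finally show ?thesis by simp
    qed
    let ?x = "\<lambda>u. card {e \<in> K - F. end_in A e = u}"
    let ?y = "\<lambda>u. card {e \<in> {e \<in> K. end_in B e \<in> T F}. end_in A e = u}"
    have TB: "T F \<subseteq> B" by (auto simp: T_def)
    have "int k * (\<Sum>v\<in>T F. int (n v)) = (\<Sum>v\<in>T F. int (deg K v))"
      unfolding sum_distrib_left using TB kn by (intro sum.cong) (auto simp flip: of_nat_mult)
    also have "\<dots> = int (card {e \<in> K. end_in B e \<in> T F})"
      using sum_deg[OF bip_sym[OF b] subset_refl TB] by (simp flip: of_nat_sum)
    also have "card {e \<in> K. end_in B e \<in> T F} = (\<Sum>u\<in>end_in A ` K. ?y u)"
    proof -
      have "(\<Sum>u\<in>end_in A ` K. \<Sum>e\<in>{e \<in> {e \<in> K. end_in B e \<in> T F}. end_in A e = u}. 1)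
          = (\<Sum>e\<in>{e \<in> K. end_in B e \<in> T F}. 1::nat)"
        by (rule sum.group) (use finK in auto)
      then show ?thesis by simp
    qed
    also have "int (\<Sum>u\<in>end_in A ` K. ?y u) = (\<Sum>u\<in>end_in A ` K. int (?y u))" by simp
    also have "\<dots> \<le> (\<Sum>u\<in>end_in A ` K. int (k * min (n u) (?x u)))"
    proof (intro sum_mono, unfold of_nat_le_iff)
      fix u assume "u \<in> end_in A ` K"
      then have u: "u \<in> A" using bip_edge(1)[OF b] by blast
      have "?y u \<le> deg K u" unfolding deg_end[OF b subset_refl u] using finK by (intro card_mono) auto
      then have 1: "?y u \<le> k * n u" using kn[of u] u by simp
      have "{e \<in> {e \<in> K. end_in B e \<in> T F}. end_in A e = u} \<subseteq> {e \<in> K - F. end_in A e = u}"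
        using bip_edge(2,5)[OF b] by (auto simp: T_def)
      then have "?y u \<le> ?x u" by (rule card_mono[rotated]) (use finK in simp)
      moreover have "?x u \<le> k * ?x u" using k by simp
      ultimately have "?y u \<le> k * ?x u" by (rule le_trans)
      with 1 show "?y u \<le> k * min (n u) (?x u)" by (simp add: min_def)
    qed
    also have "\<dots> = int k * (\<Sum>u\<in>end_in A ` K. int (min (n u) (?x u)))"
      by (simp add: sum_distrib_left)
    finally show "(\<Sum>v\<in>T F. int (n v)) \<le> (\<Sum>u\<in>end_in A ` K. int (min (n u) (?x u)))"
      using k by (simp add: mult_le_cancel_left)
  qed blast
  have leA: "deg M u \<le> n u" if "u \<in> A" for u using M(2)[of u] deg_end[OF b M(1) that] by simp
  have geB: "n v \<le> deg M v" if v: "v \<in> B" for v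
  proof -
    \<comment> \<open>With all edges that avoid \<open>v\<close> taken into \<open>F\<close>, the
      edges of \<open>M\<close> left over are those at \<open>v\<close>.\<close>
    let ?F = "{e \<in> K. v \<notin> e}"
    have "v \<in> T ?F" using v by (auto simp: T_def)
    then have "int (n v) \<le> (\<Sum>v\<in>T ?F. int (n v))" using finB by (intro member_le_sum) (auto simp: T_def)
    also have "\<dots> \<le> int (card (M - ?F))" by (rule M(3)) auto
    also have "M - ?F = {e \<in> M. v \<in> e}" using M(1) by auto
    finally show ?thesis by (simp add: deg_def)
  qed
  have e1: "(\<Sum>x\<in>A. deg M x) = (\<Sum>x\<in>B. deg M x)"
    using sum_deg_all[OF b M(1)] sum_deg_all[OF bip_sym[OF b] M(1)] by simp
  have "k * (\<Sum>x\<in>A. n x) = k * (\<Sum>x\<in>B. n x)"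
    using sum_deg_all[OF b subset_refl] sum_deg_all[OF bip_sym[OF b] subset_refl] kn
    by (simp add: sum_distrib_left)
  then have e2: "(\<Sum>x\<in>A. n x) = (\<Sum>x\<in>B. n x)" using k by simp
  have l: "(\<Sum>x\<in>A. deg M x) \<le> (\<Sum>x\<in>A. n x)" "(\<Sum>x\<in>B. n x) \<le> (\<Sum>x\<in>B. deg M x)"
    using leA geB by (auto intro: sum_mono)
  have "(\<Sum>x\<in>A. n x) \<le> (\<Sum>x\<in>A. deg M x)" unfolding e1 e2 by (rule l(2))
  then have eq1: "(\<Sum>x\<in>A. deg M x) = (\<Sum>x\<in>A. n x)" using l(1) by (rule antisym[rotated])
  then have eq2: "(\<Sum>x\<in>B. n x) = (\<Sum>x\<in>B. deg M x)" unfolding e1 e2 by (rule sym)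
  have degM: "deg M x = n x" if x: "x \<in> A \<union> B" for x
  proof (cases "x \<in> A")
    case True
    show ?thesis by (rule sum_mono_inv[where I = A and f = "deg M" and g = n]) (use eq1 leA True finA in auto)
  next
    case False
    then have "x \<in> B" using x by blast
    then have "n x = deg M x"
      by (intro sum_mono_inv[where I = B and f = n and g = "deg M"]) (use eq2 geB finB in auto)
    then show ?thesis by simp
  qed
  show thesis
  proof (rule that[OF M(1)])
    show "k * deg M x = deg K x" if "x \<in> A \<union> B" for x unfolding degM[OF that] by (rule kn[OF that])
  qed
qed

section \<open>Orientations of bipartite graphs as edge selections\<close>

lemma sum_of_bool_card: "finite E \<Longrightarrow> (\<Sum>e\<in>E. of_bool (P e)) = int (card {e \<in> E. P e})"
proof -
  assume "finite E"
  moreover have "{e \<in> E. P e} = E \<inter> {e. P e}" by blast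
  ultimately show ?thesis by simp
qed

text \<open>\<open>X\<close> consists of the edges directed from \<open>A\<close> to
  \<open>B\<close>, so out-degrees in \<open>A\<close> and in-degrees in \<open>B\<close> are
  \<open>X\<close>-degrees. A vertex outside \<open>H\<close> is balanced exactly, which means that
  half of its edges belong to \<open>X\<close>.\<close>

lemma bip_orientation:
  fixes m :: nat and r :: "'a \<Rightarrow> int"
  assumes b: "bip A B E" and m: "1 \<le> m" and BH: "B \<subseteq> H" and H: "H \<subseteq> A \<union> B" "H \<noteq> {}"
    and ev: "\<And>x. x \<in> A - H \<Longrightarrow> even (deg E x)"
    and cut: "\<And>S. S \<subseteq> A \<union> B \<Longrightarrow> S \<inter> H \<noteq> {} \<Longrightarrow> \<not> H \<subseteq> S \<Longrightarrow> 8 * m - 3 \<le> card (crossing E S)"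
    and sum: "int m dvd (\<Sum>x\<in>A \<inter> H. r x) + (\<Sum>x\<in>A - H. int (deg E x div 2)) - (\<Sum>x\<in>B. r x)"
  obtains X where "X \<subseteq> E" "\<And>x. x \<in> H \<Longrightarrow> int m dvd int (deg X x) - r x"
    "\<And>x. x \<in> A - H \<Longrightarrow> 2 * deg X x = deg E x"
proof -
  define h where "h e = Some (end_in A e)" for e
  define t where "t e = Some (end_in B e)" for e
  \<comment> \<open>Balances expressed by \<open>X\<close>-degrees: twice the
    \<open>X\<close>-degree minus the degree in \<open>A\<close>, with the opposite sign in
    \<open>B\<close>.\<close>
  define f where "f x = (if x \<in> A - H then 0 else if x \<in> A then 2 * r x - int (deg E x) else int (deg E x) - 2 * r x)" for x
  define \<tau> where "\<tau> y = f (the y) mod (2 * int m)" for y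
  have finE: "finite E" by (rule bip_finite[OF b])
  have finAB: "finite A" "finite B" "A \<inter> B = {}" using b by (auto simp: bip_def)
  have cutd_eq: "cutd E h t (Some ` S) = int (card (crossing E S))" for S
  proof -
    have "cutd E h t (Some ` S) = (\<Sum>e\<in>E. of_bool (e \<inter> S \<noteq> {} \<and> \<not> e \<subseteq> S))"
      unfolding cutd_def
    proof (intro sum.cong refl arg_cong[where f = of_bool])
      fix e assume "e \<in> E"
      then have "e = {end_in A e, end_in B e}" by (rule bip_edge(3)[OF b])
      then have "e \<inter> S \<noteq> {} \<longleftrightarrow> end_in A e \<in> S \<or> end_in B e \<in> S" "e \<subseteq> S \<longleftrightarrow> end_in A e \<in> S \<and> end_in B e \<in> S"
        by (metis Int_insert_left_if0 Int_insert_left_if1 inf_bot_left insert_not_empty, metis empty_subsetI insert_subset)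
      then show "((h e \<in> Some ` S) \<noteq> (t e \<in> Some ` S)) = (e \<inter> S \<noteq> {} \<and> \<not> e \<subseteq> S)"
        by (auto simp: h_def t_def)
    qed
    then show ?thesis unfolding crossing_def sum_of_bool_card[OF finE] .
  qed
  have cross1: "crossing E {x} = {e \<in> E. x \<in> e}" for x
  proof -
    have "\<not> e \<subseteq> {x}" if "e \<in> E" for e
    proof
      assume "e \<subseteq> {x}"
      moreover have "end_in A e \<in> e" "end_in B e \<in> e"
        using bip_edge(4,5)[OF b that] bip_edge(1,2)[OF b that] by simp_all
      ultimately have "end_in A e = end_in B e" by blast
      then show False using bip_edge(1,2)[OF b that] finAB(3) by auto
    qed
    then show ?thesis by (auto simp: crossing_def)
  qed
  have cut_single: "cutd E h t {Some x} = int (deg E x)" for x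
    using cutd_eq[of "{x}"] by (simp add: cross1 deg_def)
  have cutAB: "cutd E h t (Some ` (A \<union> B)) = 0"
    unfolding cutd_def by (intro sum.neutral) (use bip_edge(1,2)[OF b] in \<open>auto simp: h_def t_def\<close>)
  have net_None: "net E h t q None = 0" for q
    unfolding net_def by (intro sum.neutral) (simp add: h_def t_def)
  have \<tau>f: "2 * int m dvd \<tau> (Some x) - f x" for x by (simp add: \<tau>_def mod_eq_dvd_iff[symmetric])
  have \<tau>_range: "0 \<le> \<tau> y" "\<tau> y < 2 * int m" for y using m by (simp_all add: \<tau>_def)
  \<comment> \<open>\<open>None\<close> is a fresh isolated vertex and serves as \<open>z\<close>;
    taken as \<open>s\<close> as well it means that no vertex is exceptional. Since
    \<open>\<tau>\<close> is at most \<open>2 * m - 1\<close>, every requirement is at most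
    \<open>8 * m - 3\<close>.\<close>
  have "mod_problem (int m) (Some ` (A \<union> B)) (Some ` H) None None E h t (\<lambda>_. 1) \<tau>"
  proof unfold_locales
    show "h e \<in> insert None (Some ` (A \<union> B)) \<and> t e \<in> insert None (Some ` (A \<union> B))" if "e \<in> E" for e
      using bip_edge(1,2)[OF b that] by (simp add: h_def t_def)
    show "even (\<tau> y - cutd E h t {y})" if y: "y \<in> Some ` (A \<union> B)" for y
    proof -
      obtain x where x: "y = Some x" "x \<in> A \<union> B" using y by blast
      have "even (f x - int (deg E x))" using ev[of x] by (simp add: f_def)
      moreover have "even (\<tau> (Some x) - f x)" using \<tau>f[of x] by (rule dvd_mult_left)
      ultimately show ?thesis unfolding x(1) cut_single by simp
    qed
    show "\<tau> y = 0" if "y \<in> Some ` (A \<union> B) - Some ` H" for y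
      using that BH by (auto simp: \<tau>_def f_def)
    show "need (int m) None \<tau> y \<le> cutd E h t S"
      if S: "S \<subseteq> Some ` (A \<union> B)" "S \<inter> Some ` H = {y}" "Some ` H \<noteq> {y}" for S y
    proof -
      obtain S' where S': "S = Some ` S'" "S' \<subseteq> A \<union> B" using S(1) by (auto simp: subset_image_iff)
      have "y \<in> Some ` S' \<inter> Some ` H" using S(2) S'(1) by blast
      then obtain y' where y': "y = Some y'" "y' \<in> S'" "y' \<in> H" by auto
      have "\<not> H \<subseteq> S'"
      proof
        assume "H \<subseteq> S'"
        then have "S \<inter> Some ` H = Some ` H" using S' by blast
        then show False using S by simp
      qed
      then have "8 * m - 3 \<le> card (crossing E S')" using cut[OF S'(2)] y' by blast
      then have "8 * int m - 3 \<le> cutd E h t S" unfolding S'(1) cutd_eq using m by linarith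
      then show ?thesis using \<tau>_range(2)[of y] y' by (simp add: need_def)
    qed
    show "8 * int m - 3 \<le> cutd E h t S"
      if S: "S \<subseteq> Some ` (A \<union> B)" "2 \<le> card (S \<inter> Some ` H)" "\<not> Some ` H \<subseteq> S" for S
    proof -
      obtain S' where S': "S = Some ` S'" "S' \<subseteq> A \<union> B" using S(1) by (auto simp: subset_image_iff)
      have "S \<inter> Some ` H \<noteq> {}" using S(2) by (metis card.empty not_numeral_le_zero)
      then have "S' \<inter> H \<noteq> {}" using S' by blast
      moreover have "\<not> H \<subseteq> S'" using S(3) S' by blast
      ultimately have "8 * m - 3 \<le> card (crossing E S')" using cut[OF S'(2)] by blast
      then show ?thesis unfolding S'(1) cutd_eq using m by linarith
    qed
    show "cutd E h t (Some ` (A \<union> B)) \<le> cutd E h t S" for S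
      unfolding cutAB by (rule cutd_nonneg)
    show "cutd E h t (Some ` (A \<union> B)) \<le> 8 * int m - 2" unfolding cutAB using m by simp
    have "(\<Sum>y\<in>Some ` (A \<union> B). \<tau> y) = (\<Sum>x\<in>A \<union> B. \<tau> (Some x))"
      by (simp add: sum.reindex)
    also have "\<dots> = (\<Sum>x\<in>A \<union> B. f x) + (\<Sum>x\<in>A \<union> B. \<tau> (Some x) - f x)"
      by (simp add: sum.distrib[symmetric])
    finally have 1: "(\<Sum>y\<in>Some ` (A \<union> B). \<tau> y) = (\<Sum>x\<in>A \<union> B. f x) + (\<Sum>x\<in>A \<union> B. \<tau> (Some x) - f x)" .
    have "(\<Sum>x\<in>A \<union> B. f x) = (\<Sum>x\<in>A \<inter> H. f x) + (\<Sum>x\<in>A - H. f x) + (\<Sum>x\<in>B. f x)"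
      using finAB by (simp add: sum.union_disjoint sum.Int_Diff[of A f H])
    also have "(\<Sum>x\<in>A \<inter> H. f x) = 2 * (\<Sum>x\<in>A \<inter> H. r x) - (\<Sum>x\<in>A \<inter> H. int (deg E x))"
      by (simp add: f_def sum_subtractf sum_distrib_left)
    also have "(\<Sum>x\<in>A - H. f x) = 0" by (simp add: f_def)
    also have "(\<Sum>x\<in>B. f x) = (\<Sum>x\<in>B. int (deg E x) - 2 * r x)"
      using finAB(3) by (intro sum.cong) (auto simp: f_def)
    also have "\<dots> = int (card E) - 2 * (\<Sum>x\<in>B. r x)"
      using sum_deg_all[OF bip_sym[OF b] subset_refl]
      by (simp add: sum_subtractf sum_distrib_left flip: of_nat_sum)
    also have "int (card E) = (\<Sum>x\<in>A. int (deg E x))"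
      using sum_deg_all[OF b subset_refl] by (simp flip: of_nat_sum)
    also have "\<dots> = (\<Sum>x\<in>A \<inter> H. int (deg E x)) + (\<Sum>x\<in>A - H. int (deg E x))"
      using finAB by (simp add: sum.Int_Diff[of A _ H])
    also have "(\<Sum>x\<in>A - H. int (deg E x)) = 2 * (\<Sum>x\<in>A - H. int (deg E x div 2))"
      unfolding sum_distrib_left
    proof (intro sum.cong refl)
      fix x assume "x \<in> A - H"
      then have "2 * (deg E x div 2) = deg E x" using ev by simp
      then show "int (deg E x) = 2 * int (deg E x div 2)" by linarith
    qed
    finally have 2: "(\<Sum>x\<in>A \<union> B. f x) =
        2 * ((\<Sum>x\<in>A \<inter> H. r x) + (\<Sum>x\<in>A - H. int (deg E x div 2)) - (\<Sum>x\<in>B. r x))" by simp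
    have "2 * int m dvd (\<Sum>x\<in>A \<union> B. f x)" unfolding 2 by (intro mult_dvd_mono sum) simp
    moreover have "2 * int m dvd (\<Sum>x\<in>A \<union> B. \<tau> (Some x) - f x)" by (intro dvd_sum \<tau>f)
    ultimately have "2 * int m dvd (\<Sum>x\<in>A \<union> B. f x) + (\<Sum>x\<in>A \<union> B. \<tau> (Some x) - f x)"
      by (rule dvd_add)
    then show "2 * int m dvd (\<Sum>y\<in>Some ` (A \<union> B). \<tau> y) + net E h t (\<lambda>_. 1) None"
      unfolding 1 net_None by simp
  qed (use m finAB finE H \<tau>_range in auto)
  then have "\<exists>q. solves (int m) (Some ` (A \<union> B)) (Some ` H) None E h t (\<lambda>_. 1) \<tau> q"
    by (rule mod_problem_solvable)
  then obtain q where q: "solves (int m) (Some ` (A \<union> B)) (Some ` H) None E h t (\<lambda>_. 1) \<tau> q" ..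
  define X where "X = {e \<in> E. q e = 1}"
  have XE: "X \<subseteq> E" by (auto simp: X_def)
  have qX: "q e = 2 * of_bool (e \<in> X) - 1" if "e \<in> E" for e
    using q that by (auto simp: solves_def X_def)
  have signed: "(\<Sum>e\<in>E. q e * of_bool (x \<in> e)) = 2 * int (deg X x) - int (deg E x)" for x
  proof -
    have "(\<Sum>e\<in>E. q e * of_bool (x \<in> e)) = (\<Sum>e\<in>E. 2 * of_bool (e \<in> X \<and> x \<in> e) - of_bool (x \<in> e))"
      by (intro sum.cong) (auto simp: qX)
    also have "\<dots> = 2 * int (card {e \<in> E. e \<in> X \<and> x \<in> e}) - int (card {e \<in> E. x \<in> e})"
      by (simp only: sum_subtractf sum_distrib_left[symmetric] sum_of_bool_card[OF finE])
    also have "{e \<in> E. e \<in> X \<and> x \<in> e} = {e \<in> X. x \<in> e}" using XE by blast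
    finally show ?thesis by (simp add: deg_def)
  qed
  have netA: "net E h t q (Some x) = 2 * int (deg X x) - int (deg E x)" if x: "x \<in> A" for x
    unfolding signed[symmetric] net_def
  proof (intro sum.cong refl)
    fix e assume e: "e \<in> E"
    have "end_in B e \<noteq> x" using bip_edge(2)[OF b e] x finAB by blast
    then show "q e * (of_bool (h e = Some x) - of_bool (t e = Some x)) = q e * of_bool (x \<in> e)"
      using bip_edge(4)[OF b e x] by (simp add: h_def t_def)
  qed
  have netB: "net E h t q (Some x) = - (2 * int (deg X x) - int (deg E x))" if x: "x \<in> B" for x
    unfolding signed[symmetric] net_def sum_negf[symmetric]
  proof (intro sum.cong refl)
    fix e assume e: "e \<in> E"
    have "end_in A e \<noteq> x" using bip_edge(1)[OF b e] x finAB by blast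
    then show "q e * (of_bool (h e = Some x) - of_bool (t e = Some x)) = - (q e * of_bool (x \<in> e))"
      using bip_edge(5)[OF b e x] by (simp add: h_def t_def)
  qed
  show thesis
  proof (rule that[OF XE])
    show "int m dvd int (deg X x) - r x" if x: "x \<in> H" for x
    proof -
      have "2 * int m dvd net E h t q (Some x) - \<tau> (Some x)" using q x by (simp add: solves_def)
      then have dv: "2 * int m dvd net E h t q (Some x) - \<tau> (Some x) + (\<tau> (Some x) - f x)"
        using \<tau>f by (rule dvd_add)
      show ?thesis
      proof (cases "x \<in> A")
        case True
        then have "net E h t q (Some x) - \<tau> (Some x) + (\<tau> (Some x) - f x) = 2 * (int (deg X x) - r x)"
          using x by (simp add: netA f_def)
        then show ?thesis using dv by (metis dvd_mult_cancel_left zero_neq_numeral)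
      next
        case False
        then have "x \<in> B" using x H by blast
        then have "net E h t q (Some x) - \<tau> (Some x) + (\<tau> (Some x) - f x) = 2 * (- (int (deg X x) - r x))"
          using False by (simp add: netB f_def)
        then show ?thesis using dv by (metis dvd_minus_iff dvd_mult_cancel_left zero_neq_numeral)
      qed
    qed
    show "2 * deg X x = deg E x" if x: "x \<in> A - H" for x
    proof -
      have "net E h t q (Some x) = 0" using q x by (auto simp: solves_def)
      then show ?thesis using netA[of x] x by simp
    qed
  qed
qed

text \<open>Edges with different ends in \<open>A\<close> are different, so the choices at the
  vertices of \<open>A\<close> do not interfere.\<close>

lemma pick_degrees:
  assumes b: "bip A B F" and f: "\<And>u. u \<in> A \<Longrightarrow> f u \<le> deg F u"
  obtains S where "S \<subseteq> F" "\<And>u. u \<in> A \<Longrightarrow> deg S u = f u"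
proof -
  have "\<forall>u\<in>A. \<exists>T. T \<subseteq> {e \<in> F. u \<in> e} \<and> card T = f u"
    using f unfolding deg_def by (meson obtain_subset_with_card_n)
  then obtain T where T: "\<And>u. u \<in> A \<Longrightarrow> T u \<subseteq> {e \<in> F. u \<in> e}" "\<And>u. u \<in> A \<Longrightarrow> card (T u) = f u"
    by metis
  show thesis
  proof (rule that)
    show "(\<Union>u\<in>A. T u) \<subseteq> F" using T(1) by blast
    show "deg (\<Union>u\<in>A. T u) u = f u" if u: "u \<in> A" for u
    proof -
      have "{e \<in> (\<Union>u\<in>A. T u). u \<in> e} = T u"
      proof
        show "T u \<subseteq> {e \<in> (\<Union>u\<in>A. T u). u \<in> e}" using T(1)[OF u] u by blast
        show "{e \<in> (\<Union>u\<in>A. T u). u \<in> e} \<subseteq> T u"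
        proof
          fix e assume "e \<in> {e \<in> (\<Union>u\<in>A. T u). u \<in> e}"
          then obtain w where w: "w \<in> A" "e \<in> T w" "u \<in> e" by blast
          then have "e \<in> F" "w \<in> e" using T(1) by blast+
          then have "u = w" using bip_edge(4)[OF b] u w by metis
          then show "e \<in> T u" using w by simp
        qed
      qed
      then show ?thesis using T(2)[OF u] by (simp add: deg_def)
    qed
  qed
qed

section \<open>Distributing edges evenly over central edges\<close>

lemma equal_fibres:
  assumes "finite T" "finite S" "card S = j * card T"
  shows "\<exists>g. g ` S \<subseteq> T \<and> (\<forall>y\<in>T. card {x \<in> S. g x = y} = j)"
  using assms
proof (induction T arbitrary: S rule: finite_induct)
  case (insert y T)
  then have "j \<le> card S" by simp
  then obtain S1 where S1: "S1 \<subseteq> S" "card S1 = j" by (meson obtain_subset_with_card_n)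
  then have "card (S - S1) = j * card T"
    using insert by (simp add: card_Diff_subset finite_subset)
  then obtain g where g: "g ` (S - S1) \<subseteq> T" "\<forall>y\<in>T. card {x \<in> S - S1. g x = y} = j"
    using insert.IH[of "S - S1"] insert.prems by auto
  let ?g = "\<lambda>x. if x \<in> S1 then y else g x"
  have "{x \<in> S. ?g x = y} = S1" using S1 g insert.hyps by (auto simp: image_subset_iff)
  moreover have "{x \<in> S. ?g x = w} = {x \<in> S - S1. g x = w}" if "w \<in> T" for w
    using that insert.hyps S1 by auto
  moreover have "?g ` S \<subseteq> insert y T" using g by auto
  ultimately show ?case using S1 g by (intro exI[of _ ?g]) auto
qed simp

text \<open>At each vertex of \<open>A\<close> the edges of \<open>F\<close> are cut into groups of
  \<open>j\<close>, one for each edge of \<open>M\<close> there. The map \<open>g\<close> tells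
  which central edge a leaf edge is attached to.\<close>

lemma distribute_edges:
  assumes b: "bip A B E" and F: "F \<subseteq> E" and M: "M \<subseteq> E"
    and d: "\<And>u. u \<in> A \<Longrightarrow> deg F u = j * deg M u"
  obtains g where "g ` F \<subseteq> M" "\<And>e. e \<in> F \<Longrightarrow> end_in A (g e) = end_in A e"
    "\<And>e. e \<in> M \<Longrightarrow> card {x \<in> F. g x = e} = j"
proof -
  have fin: "finite E" "finite F" "finite M" using bip_finite[OF b] F M finite_subset by auto
  have "\<forall>u\<in>A. \<exists>g. g ` {e \<in> F. end_in A e = u} \<subseteq> {e \<in> M. end_in A e = u} \<and>
      (\<forall>y\<in>{e \<in> M. end_in A e = u}. card {x \<in> {e \<in> F. end_in A e = u}. g x = y} = j)"
    using d deg_end[OF b F] deg_end[OF b M] fin by (intro ballI equal_fibres) auto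
  from bchoice[OF this] obtain g where
    "\<forall>u\<in>A. g u ` {e \<in> F. end_in A e = u} \<subseteq> {e \<in> M. end_in A e = u} \<and>
      (\<forall>y\<in>{e \<in> M. end_in A e = u}. card {x \<in> {e \<in> F. end_in A e = u}. g u x = y} = j)" ..
  then have g: "\<And>u. u \<in> A \<Longrightarrow> g u ` {e \<in> F. end_in A e = u} \<subseteq> {e \<in> M. end_in A e = u}"
    "\<And>u y. u \<in> A \<Longrightarrow> y \<in> {e \<in> M. end_in A e = u} \<Longrightarrow> card {x \<in> {e \<in> F. end_in A e = u}. g u x = y} = j"
    by simp_all
  let ?g = "\<lambda>e. g (end_in A e) e"
  have gm: "?g e \<in> M \<and> end_in A (?g e) = end_in A e" if e: "e \<in> F" for e
  proof -
    have "end_in A e \<in> A" using bip_edge(1)[OF b] e F by blast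
    then show ?thesis using g(1)[of "end_in A e"] e by blast
  qed
  show thesis
  proof (rule that[of ?g])
    show "?g ` F \<subseteq> M" "\<And>e. e \<in> F \<Longrightarrow> end_in A (?g e) = end_in A e" using gm by auto
    show "card {x \<in> F. ?g x = e} = j" if e: "e \<in> M" for e
    proof -
      have "{x \<in> F. ?g x = e} = {x \<in> {x \<in> F. end_in A x = end_in A e}. g (end_in A e) x = e}"
        using gm by auto
      then show ?thesis using g(2)[of "end_in A e" e] bip_edge(1)[OF b, of e] e M by auto
    qed
  qed
qed

section \<open>Bistar decompositions\<close>

text \<open>The end of \<open>e\<close> in \<open>B\<close> is the centre of degree
  \<open>k\<close>, the end in \<open>A\<close> that of degree \<open>l\<close>. The leaves of the
  two centres lie in different colour classes and therefore never coincide.\<close>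

lemma is_bistarI:
  assumes b: "bip A B E" and e: "e \<in> E" and L: "L \<subseteq> E" "e \<notin> L" "card L = k - 1" "\<And>x. x \<in> L \<Longrightarrow> end_in B x = end_in B e"
    and L': "L' \<subseteq> E" "e \<notin> L'" "card L' = l - 1" "\<And>x. x \<in> L' \<Longrightarrow> end_in A x = end_in A e"
  shows "is_bistar k l ({e} \<union> L \<union> L')"
proof -
  define u v where "u = end_in B e" and "v = end_in A e"
  have edge: "x = {end_in B x, end_in A x}" "end_in A x \<in> A" "end_in B x \<in> B" if "x \<in> E" for x
    using bip_edge(1-3)[OF b that] by auto
  have disj: "A \<inter> B = {}" using b by (simp add: bip_def)
  have finL: "finite L" "finite L'" using bip_finite[OF b] L(1) L'(1) finite_subset by auto
  have Leq: "x = {u, end_in A x}" if "x \<in> L" for x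
    using edge(1)[of x] L(1,4) that unfolding u_def by auto
  have L'eq: "x = {v, end_in B x}" if "x \<in> L'" for x
    using edge(1)[of x] L'(1,4) that unfolding v_def by (auto simp: insert_commute)
  have eeq: "e = {u, v}" using edge(1)[OF e] unfolding u_def v_def .
  have "inj_on (end_in A) L" by (rule inj_onI) (metis Leq)
  then have cA: "card (end_in A ` L) = k - 1" using L(3) by (simp add: card_image)
  have "inj_on (end_in B) L'" by (rule inj_onI) (metis L'eq)
  then have cB: "card (end_in B ` L') = l - 1" using L'(3) by (simp add: card_image)
  have inA: "end_in A ` L \<subseteq> A" "v \<in> A" using edge(2) L(1) e unfolding v_def by auto
  have inB: "end_in B ` L' \<subseteq> B" "u \<in> B" using edge(3) L'(1) e unfolding u_def by auto
  have vL: "v \<notin> end_in A ` L" using Leq eeq L(2) by (metis imageE)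
  have uL: "u \<notin> end_in B ` L'" using L'eq eeq L'(2) by (metis imageE insert_commute)
  have eL: "{{u, x} |x. x \<in> end_in A ` L} = L"
  proof
    show "{{u, x} |x. x \<in> end_in A ` L} \<subseteq> L" using Leq by auto
    show "L \<subseteq> {{u, x} |x. x \<in> end_in A ` L}" using Leq by blast
  qed
  have eL': "{{v, x} |x. x \<in> end_in B ` L'} = L'"
  proof
    show "{{v, x} |x. x \<in> end_in B ` L'} \<subseteq> L'" using L'eq by auto
    show "L' \<subseteq> {{v, x} |x. x \<in> end_in B ` L'}" using L'eq by blast
  qed
  show ?thesis
    unfolding is_bistar_def
  proof (rule exI[of _ u], rule exI[of _ v], rule exI[of _ "end_in A ` L"], rule exI[of _ "end_in B ` L'"], intro conjI)
    show "u \<noteq> v" "end_in A ` L \<inter> end_in B ` L' = {}" "u \<notin> end_in A ` L \<union> end_in B ` L'"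
      "v \<notin> end_in A ` L \<union> end_in B ` L'" using inA inB disj vL uL by blast+
    show "{e} \<union> L \<union> L' = {{u, v}} \<union> {{u, x} |x. x \<in> end_in A ` L} \<union> {{v, y} |y. y \<in> end_in B ` L'}"
      unfolding eL eL' eeq by (rule refl)
  qed (use finL cA cB in simp_all)
qed

text \<open>\<open>M\<close> holds the central edges, one for each bistar. The edges of
  \<open>K - M\<close> are attached to them at their ends in \<open>B\<close>, those of
  \<open>G - K\<close> at their ends in \<open>A\<close>.\<close>

lemma bistar_decomposition_if_degrees:
  assumes b: "bip A B G" and K: "K \<subseteq> G" and M: "M \<subseteq> K"
    and dA: "\<And>u. u \<in> A \<Longrightarrow> deg (G - K) u = (l - 1) * deg M u"
    and dB: "\<And>v. v \<in> B \<Longrightarrow> deg (K - M) v = (k - 1) * deg M v"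
  shows "has_bistar_decomposition k l G"
proof -
  obtain g where g: "g ` (G - K) \<subseteq> M" "\<And>e. e \<in> G - K \<Longrightarrow> end_in A (g e) = end_in A e"
    "\<And>e. e \<in> M \<Longrightarrow> card {x \<in> G - K. g x = e} = l - 1"
    using distribute_edges[OF b, of "G - K" M "l - 1"] K M dA by blast
  obtain g' where g': "g' ` (K - M) \<subseteq> M" "\<And>e. e \<in> K - M \<Longrightarrow> end_in B (g' e) = end_in B e"
    "\<And>e. e \<in> M \<Longrightarrow> card {x \<in> K - M. g' x = e} = k - 1"
    using distribute_edges[OF bip_sym[OF b], of "K - M" M "k - 1"] K M dB by blast
  define D where "D e = {e} \<union> {x \<in> K - M. g' x = e} \<union> {x \<in> G - K. g x = e}" for e
  have "is_bistar k l (D e)" if e: "e \<in> M" for e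
    unfolding D_def
  proof (rule is_bistarI[OF b])
    show "end_in B x = end_in B e" if "x \<in> {x \<in> K - M. g' x = e}" for x using g'(2)[of x] that by auto
    show "end_in A x = end_in A e" if "x \<in> {x \<in> G - K. g x = e}" for x using g(2)[of x] that by auto
    show "e \<in> G" "{x \<in> K - M. g' x = e} \<subseteq> G" "{x \<in> G - K. g x = e} \<subseteq> G"
      "e \<notin> {x \<in> K - M. g' x = e}" "e \<notin> {x \<in> G - K. g x = e}" using e K M by blast+
  qed (rule g'(3)[OF e], rule g(3)[OF e])
  moreover have "\<Union>(D ` M) = G"
  proof
    show "\<Union>(D ` M) \<subseteq> G" using K M by (auto simp: D_def)
    show "G \<subseteq> \<Union>(D ` M)"
    proof
      fix x assume "x \<in> G"
      then consider "x \<in> M" | "x \<in> K - M" | "x \<in> G - K" by blast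
      then show "x \<in> \<Union>(D ` M)"
      proof cases
        case 1
        then show ?thesis by (auto simp: D_def)
      next
        case 2
        then have "g' x \<in> M" "x \<in> D (g' x)" using g'(1) by (auto simp: D_def)
        then show ?thesis by blast
      next
        case 3
        then have "g x \<in> M" "x \<in> D (g x)" using g(1) by (auto simp: D_def)
        then show ?thesis by blast
      qed
    qed
  qed
  moreover have "D e \<inter> D e' = {}" if "e \<in> M" "e' \<in> M" "e \<noteq> e'" for e e'
    using that M by (auto simp: D_def)
  then have "\<forall>F\<in>D ` M. \<forall>F'\<in>D ` M. F \<noteq> F' \<longrightarrow> F \<inter> F' = {}" by (metis imageE)
  ultimately have "bistar_decomposition k l G (D ` M)" unfolding bistar_decomposition_def by blast
  then show ?thesis unfolding has_bistar_decomposition_def by blast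
qed

lemma crossing_mono: "finite Q' \<Longrightarrow> Q \<subseteq> Q' \<Longrightarrow> card (crossing Q S) \<le> card (crossing Q' S)"
  unfolding crossing_def by (rule card_mono) (simp, blast)

text \<open>\<open>H\<close> is thinned to \<open>Q\<close>, made even in \<open>A\<close> as
  \<open>Q'\<close>, and oriented to give \<open>Y\<close>. The set \<open>R\<close> of further
  edges raises the degrees in \<open>A\<close> to \<open>k * n u\<close>, and the residues of
  \<open>Y\<close> in \<open>B\<close> are chosen to compensate for \<open>R\<close>.\<close>

lemma one_sided_decomposition:
  fixes k l t :: nat
  defines "m \<equiv> k + l - 1"
  assumes b: "bip A B G" and ne: "B \<noteq> {}" and k: "1 < k" "k \<le> l"
    and dvd_m: "\<And>u. u \<in> A \<Longrightarrow> m dvd deg G u"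
    and H: "H \<subseteq> G"
    and conn: "\<And>F. F \<subseteq> H \<Longrightarrow> int t * (comps (A \<union> B) F - 1) \<le> int (card (H - F))"
    and num: "m * (8 * k - 2) \<le> 2 * (k - 1) * t"
  shows "has_bistar_decomposition k l G"
proof -
  \<comment> \<open>The cut size that the orientation modulo \<open>k\<close> asks for.\<close>
  define q where "q = 8 * k - 3"
  define n where "n u = deg G u div m" for u
  \<comment> \<open>The cap is odd, so that adding an edge where the degree is odd still leaves at
    most \<open>2 * (k - 1) * n u\<close>.\<close>
  define c where "c u = 2 * (k - 1) * n u - 1" for u
  have finG: "finite G" by (rule bip_finite[OF b])
  have finAB: "finite (A \<union> B)" "A \<inter> B = {}" using b by (auto simp: bip_def)
  have mk: "2 * (k - 1) < m" "0 < m" using k by (auto simp: m_def)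
  have mn: "m * n u = deg G u" if "u \<in> A" for u using dvd_m[OF that] by (simp add: n_def)
  have q1: "8 * k - 2 = q + 1" using k by (simp add: q_def)
  have "m * (q + 1) \<le> m * t"
    using num mk(1) unfolding q1 by (meson le_trans less_imp_le_nat mult_le_mono1)
  then have qt: "q + 1 \<le> t" using mk(2) unfolding mult_le_cancel1 by blast
  have tn: "t \<le> m * n u" if u: "u \<in> A" for u
  proof -
    have "t \<le> card (crossing H {u})"
      by (rule crossing_ge_if_partition_connected[OF finAB(1) _ _ _ conn]) (use u ne finAB(2) in auto)
    also have "\<dots> \<le> deg G u"
      unfolding deg_def using finG H by (intro card_mono) (auto simp: crossing_def)
    finally show ?thesis using mn[OF u] by simp
  qed
  have npos: "0 < n u" if "u \<in> A" for u using tn[OF that] qt by (cases "n u = 0") auto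
  have cn: "c u + 1 = 2 * (k - 1) * n u" if "u \<in> A" for u
    using npos[OF that] k by (simp add: c_def)
  \<comment> \<open>The missing one in \<open>c u\<close> costs \<open>t\<close>. It is paid by
    \<open>t \<le> m * n u\<close> and by \<open>num\<close>, which has
    \<open>8 * k - 2 = q + 1\<close> in place of \<open>q\<close>.\<close>
  have load: "q * deg H u \<le> t * c u" if u: "u \<in> A" for u
  proof -
    have "q * deg H u \<le> q * (m * n u)" using deg_mono[OF finG H, of u] mn[OF u] by simp
    moreover have "m * (q + 1) * n u \<le> 2 * (k - 1) * t * n u" using num unfolding q1 by (rule mult_le_mono1)
    moreover have "2 * (k - 1) * t * n u = t * c u + t"
    proof -
      have "t * c u + t = t * (c u + 1)" by simp
      then show ?thesis unfolding cn[OF u] by (simp add: ac_simps)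
    qed
    moreover have "m * (q + 1) * n u = q * (m * n u) + m * n u" by (simp add: algebra_simps)
    ultimately show ?thesis using tn[OF u] by linarith
  qed
  have "0 < t" "q \<le> t" using qt by simp_all
  then obtain Q where Q: "Q \<subseteq> H" "\<And>u. u \<in> A \<Longrightarrow> deg Q u \<le> c u"
    "\<And>F. F \<subseteq> H \<Longrightarrow> int q * (comps (A \<union> B) F - 1) \<le> int (card (Q - F))"
    using low_degree_subgraph[OF b H _ _ conn load] by blast
  have QG: "Q \<subseteq> G" using Q(1) H by blast
  have degQ: "deg Q u + 1 \<le> 2 * (k - 1) * n u" if "u \<in> A" for u using Q(2)[OF that] cn[OF that] by simp
  have kmn: "2 * (k - 1) * n u + n u \<le> m * n u" if "u \<in> A" for u
  proof -
    have "(2 * (k - 1) + 1) * n u \<le> m * n u" using mk by (intro mult_le_mono1) simp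
    then show ?thesis by (simp add: algebra_simps)
  qed
  \<comment> \<open>One more edge at each vertex of \<open>A\<close> where \<open>Q\<close> has odd
    degree, since exact balance needs even degrees.\<close>
  obtain X where X: "X \<subseteq> G - Q" "\<And>u. u \<in> A \<Longrightarrow> deg X u = deg Q u mod 2"
  proof (rule pick_degrees[OF bip_mono[OF b], of "G - Q" "\<lambda>u. deg Q u mod 2"])
    show "deg Q u mod 2 \<le> deg (G - Q) u" if "u \<in> A" for u
    proof -
      have "deg (G - Q) u = m * n u - deg Q u" using deg_diff[OF finG QG] mn[OF that] by simp
      moreover have "deg Q u mod 2 \<le> 1" by simp
      ultimately show ?thesis using degQ[OF that] kmn[OF that] npos[OF that] by linarith
    qed
  qed auto
  define Q' where "Q' = Q \<union> X"
  have Q'G: "Q' \<subseteq> G" using QG X by (auto simp: Q'_def)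
  have bQ': "bip A B Q'" by (rule bip_mono[OF b Q'G])
  have degQ': "deg Q' u = deg Q u + deg Q u mod 2" if "u \<in> A" for u
  proof -
    have "deg Q' u = deg Q u + deg X u" unfolding Q'_def
    proof (rule deg_Un_disjoint)
      show "finite Q" by (rule finite_subset[OF QG finG])
      show "finite X" using X(1) finG by (meson finite_Diff finite_subset)
      show "Q \<inter> X = {}" using X(1) by blast
    qed
    then show ?thesis using X(2)[OF that] by simp
  qed
  define p where "p u = deg Q' u div 2" for u
  have evQ': "even (deg Q' u)" if "u \<in> A" for u unfolding degQ'[OF that] by presburger
  have p2: "2 * p u = deg Q' u" if "u \<in> A" for u using evQ'[OF that] by (simp add: p_def)
  have pk: "p u \<le> (k - 1) * n u" if u: "u \<in> A" for u
  proof -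
    have "deg Q u mod 2 \<le> 1" by simp
    then have "2 * p u \<le> 2 * ((k - 1) * n u)" unfolding p2[OF u] degQ'[OF u] using degQ[OF u] by simp
    then show ?thesis by simp
  qed
  \<comment> \<open>Half of \<open>Q'\<close> will supply \<open>p u\<close> edges of
    \<open>K\<close> at \<open>u\<close>. Enough edges remain outside \<open>Q'\<close> because
    \<open>p u \<le> (k - 1) * n u\<close> and \<open>k \<le> l\<close>.\<close>
  obtain R where R: "R \<subseteq> G - Q'" "\<And>u. u \<in> A \<Longrightarrow> deg R u = k * n u - p u"
  proof (rule pick_degrees[OF bip_mono[OF b], of "G - Q'" "\<lambda>u. k * n u - p u"])
    show "k * n u - p u \<le> deg (G - Q') u" if u: "u \<in> A" for u
    proof -
      have "deg (G - Q') u = m * n u - 2 * p u" using deg_diff[OF finG Q'G] mn[OF u] p2[OF u] by simp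
      moreover have "m * n u = k * n u + (l - 1) * n u" using k by (simp add: m_def flip: add_mult_distrib)
      moreover have "(k - 1) * n u \<le> (l - 1) * n u" using k by (intro mult_le_mono1) simp
      ultimately show ?thesis using pk[OF u] by linarith
    qed
  qed auto
  have RG: "R \<subseteq> G" using R by blast
  have pkn: "p u \<le> k * n u" if "u \<in> A" for u
    using pk[OF that] by (rule le_trans) (simp add: mult_le_mono1)
  have sumR: "(\<Sum>v\<in>B. int (deg R v)) = (\<Sum>u\<in>A. int (k * n u) - int (p u))"
  proof -
    have "(\<Sum>v\<in>B. deg R v) = (\<Sum>u\<in>A. deg R u)"
      using sum_deg_all[OF b RG] sum_deg_all[OF bip_sym[OF b] RG] by simp
    then have "(\<Sum>v\<in>B. int (deg R v)) = (\<Sum>u\<in>A. int (deg R u))" by (metis of_nat_sum)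
    also have "\<dots> = (\<Sum>u\<in>A. int (k * n u) - int (p u))"
      by (intro sum.cong refl) (simp add: R(2) pkn of_nat_diff)
    finally show ?thesis .
  qed
  \<comment> \<open>Only the vertices of \<open>B\<close> carry residues; those of \<open>A\<close>
    are balanced. The residues add up because \<open>R\<close> and \<open>Y\<close> together are to
    have \<open>k * n u\<close> edges at each \<open>u\<close>.\<close>
  obtain Y where Y: "Y \<subseteq> Q'" "\<And>x. x \<in> B \<Longrightarrow> int k dvd int (deg Y x) - (- int (deg R x))"
    "\<And>x. x \<in> A - B \<Longrightarrow> 2 * deg Y x = deg Q' x"
  proof (rule bip_orientation[OF bQ', of k B "\<lambda>x. - int (deg R x)"])
    show "8 * k - 3 \<le> card (crossing Q' S)"
      if S: "S \<subseteq> A \<union> B" "S \<inter> B \<noteq> {}" "\<not> B \<subseteq> S" for S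
    proof -
      have "q \<le> card (crossing Q S)"
      proof (rule crossing_ge_if_partition_connected[OF finAB(1) S(1)])
        show "int q * (comps (A \<union> B) F - 1) \<le> int (card (Q - F))" if "F \<subseteq> Q" for F
          using Q(3)[of F] that Q(1) by blast
      qed (use S in auto)
      also have "\<dots> \<le> card (crossing Q' S)"
        by (rule crossing_mono) (use finite_subset[OF Q'G finG] in \<open>auto simp: Q'_def\<close>)
      finally show ?thesis by (simp add: q_def)
    qed
    have "A \<inter> B = {}" "A - B = A" using finAB(2) by auto
    then have "(\<Sum>x\<in>A \<inter> B. - int (deg R x)) + (\<Sum>x\<in>A - B. int (deg Q' x div 2)) - (\<Sum>x\<in>B. - int (deg R x))
        = (\<Sum>u\<in>A. int (p u)) + (\<Sum>v\<in>B. int (deg R v))"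
      by (simp add: p_def sum_negf)
    also have "\<dots> = int k * (\<Sum>u\<in>A. int (n u))"
      unfolding sumR by (simp add: sum_subtractf sum_distrib_left)
    finally show "int k dvd (\<Sum>x\<in>A \<inter> B. - int (deg R x)) + (\<Sum>x\<in>A - B. int (deg Q' x div 2))
        - (\<Sum>x\<in>B. - int (deg R x))" by simp
  qed (use k evQ' ne in auto)
  define K where "K = R \<union> Y"
  have KG: "K \<subseteq> G" using RG Y(1) Q'G by (auto simp: K_def)
  have degK: "deg K x = deg R x + deg Y x" for x
    unfolding K_def by (rule deg_Un_disjoint) (use R(1) Y(1) finite_subset[OF RG finG] finite_subset[OF Q'G finG] finite_subset in auto)
  have degKA: "deg K u = k * n u" if u: "u \<in> A" for u
  proof -
    have "u \<in> A - B" using u finAB(2) by blast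
    then have "deg Y u = p u" using Y(3)[of u] p2[OF u] by simp
    then show ?thesis unfolding degK using R(2)[OF u] pkn[OF u] by simp
  qed
  have "k dvd deg K x" if x: "x \<in> A \<union> B" for x
  proof (cases "x \<in> A")
    case False
    then have "int k dvd int (deg K x)" using Y(2)[of x] x unfolding degK by (simp add: add.commute)
    then show ?thesis by simp
  qed (simp add: degKA)
  then obtain M where M: "M \<subseteq> K" "\<And>x. x \<in> A \<union> B \<Longrightarrow> k * deg M x = deg K x"
    using divisible_degrees_subgraph[OF bip_mono[OF b KG], of k] k by auto
  have finK: "finite K" by (rule finite_subset[OF KG finG])
  show ?thesis
  proof (rule bistar_decomposition_if_degrees[OF b KG M(1)])
    fix u assume u: "u \<in> A"
    have "k * deg M u = k * n u" using M(2)[of u] degKA[OF u] u by simp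
    then have "deg M u = n u" using k by simp
    moreover have "deg (G - K) u = m * n u - k * n u" using deg_diff[OF finG KG] mn[OF u] degKA[OF u] by simp
    ultimately show "deg (G - K) u = (l - 1) * deg M u" using k by (simp add: m_def flip: diff_mult_distrib)
  next
    fix v assume v: "v \<in> B"
    have "deg (K - M) v = k * deg M v - deg M v" using deg_diff[OF finK M(1)] M(2)[of v] v by simp
    then show "deg (K - M) v = (k - 1) * deg M v" by (simp add: diff_mult_distrib)
  qed
qed

section \<open>From edge-connectivity to two one-sided problems\<close>

lemma edge_connected_crossing:
  assumes "edge_connected c V E" "S \<subseteq> V" "S \<noteq> {}" "S \<noteq> V"
  shows "c \<le> card (crossing E S)"
proof (rule ccontr)
  assume less: "\<not> ?thesis"
  have "crossing E S \<subseteq> E" by (auto simp: crossing_def)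
  then have conn: "connected_graph V (E - crossing E S)"
    using assms(1) less unfolding edge_connected_def by simp
  obtain s v where sv: "s \<in> S" "v \<in> V" "v \<notin> S" using assms by blast
  have "v \<in> reach (E - crossing E S) s"
    using conn sv assms(2) by (auto simp: connected_graph_def reach_def)
  moreover have "reach (E - crossing E S) s \<subseteq> S"
    by (rule reach_closed[OF sv(1)]) (auto simp: crossing_def)
  ultimately show False using sv by blast
qed

lemma bip_if_bipartite:
  assumes "simple_graph V E" "bipartite V E"
  obtains A where "A \<subseteq> V" "bip A (V - A) E"
proof -
  obtain A where A: "A \<subseteq> V" "\<And>e. e \<in> E \<Longrightarrow> card (e \<inter> A) = 1" using assms by (auto simp: bipartite_def)
  have "\<exists>a\<in>A. \<exists>b\<in>V - A. e = {a, b}" if e: "e \<in> E" for e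
  proof -
    have eV: "e \<subseteq> V" "card e = 2" using assms(1) e by (auto simp: simple_graph_def)
    obtain a where a: "e \<inter> A = {a}" using A(2)[OF e] by (auto simp: card_1_singleton_iff)
    have "finite e" using eV(2) card.infinite by fastforce
    moreover have "a \<in> e" using a by blast
    ultimately have "card (e - {a}) = 1" using eV(2) by simp
    then obtain b where b: "e - {a} = {b}" by (auto simp: card_1_singleton_iff)
    have "a \<in> A" "b \<in> V - A" "e = {a, b}" using a b eV(1) by auto
    then show ?thesis by blast
  qed
  then have "bip A (V - A) E"
    using assms(1) A(1) finite_subset unfolding bip_def simple_graph_def by blast
  then show thesis using that A(1) by blast
qed

lemma bistar_decomposition_Un:
  assumes "has_bistar_decomposition k l E1" "has_bistar_decomposition k l E2" "E1 \<inter> E2 = {}"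
  shows "has_bistar_decomposition k l (E1 \<union> E2)"
proof -
  obtain P1 P2 where P: "bistar_decomposition k l E1 P1" "bistar_decomposition k l E2 P2"
    using assms unfolding has_bistar_decomposition_def by blast
  note P = this[unfolded bistar_decomposition_def]
  note U = P[THEN conjunct1]
  note D = P[THEN conjunct2, THEN conjunct1]
  note S = P[THEN conjunct2, THEN conjunct2]
  have cross: "F \<inter> G = {}" if "F \<in> P1" "G \<in> P2" for F G
    using that U assms(3) by blast
  have "bistar_decomposition k l (E1 \<union> E2) (P1 \<union> P2)"
    unfolding bistar_decomposition_def
  proof (intro conjI ballI impI)
    show "\<Union>(P1 \<union> P2) = E1 \<union> E2" using U by (simp only: Union_Un_distrib)
    show "is_bistar k l F" if "F \<in> P1 \<union> P2" for F using S that by blast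
    fix F G assume F: "F \<in> P1 \<union> P2" "G \<in> P1 \<union> P2" "F \<noteq> G"
    then consider "F \<in> P1" "G \<in> P1" | "F \<in> P1" "G \<in> P2" | "F \<in> P2" "G \<in> P1" | "F \<in> P2" "G \<in> P2" by blast
    then show "F \<inter> G = {}"
    proof cases
      case 1
      then show ?thesis using D(1) F(3) by simp
    next
      case 2
      then show ?thesis by (rule cross)
    next
      case 3
      then show ?thesis using cross[of G F] by (simp only: Int_commute)
    next
      case 4
      then show ?thesis using D(2) F(3) by simp
    qed
  qed
  then show ?thesis unfolding has_bistar_decomposition_def by blast
qed

lemma bipartite_bistar_decomposition:
  fixes k l t N :: nat
  defines "m \<equiv> k + l - 1"
  assumes k: "1 < k" "k \<le> l" and G: "simple_graph V E" "bipartite V E"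
    and conn: "edge_connected (2 * N) V E" and dv: "m dvd card E"
    and N: "8 * m - 3 + 2 * t \<le> N" and t: "m * (8 * k - 2) \<le> 2 * (k - 1) * t"
  shows "has_bistar_decomposition k l E"
proof (cases "E = {}")
  case True
  then have "bistar_decomposition k l E {}" by (simp add: bistar_decomposition_def)
  then show ?thesis unfolding has_bistar_decomposition_def by blast
next
  case False
  obtain A where A: "A \<subseteq> V" "bip A (V - A) E" by (rule bip_if_bipartite[OF G])
  define B where "B = V - A"
  have b: "bip A B E" and AB: "A \<union> B = V" "A \<inter> B = {}" using A by (auto simp: B_def)
  obtain e where "e \<in> E" using False by blast
  then have ne: "A \<noteq> {}" "B \<noteq> {}" using bip_edge(1,2)[OF b] by blast+
  have finV: "finite V" and Vne: "V \<noteq> {}" using G ne A(1) by (auto simp: simple_graph_def)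
  have finE: "finite E" by (rule bip_finite[OF b])
  have ein: "edges_in V E" using bip_edges_in[OF b] AB by simp
  have part: "int N * (comps V F - 1) \<le> int (card (E - F))" if "F \<subseteq> E" for F
    by (rule partition_connected_if_crossing_ge[OF finV Vne finE ein that])
      (rule edge_connected_crossing[OF conn])
  \<comment> \<open>Part 0 is oriented modulo \<open>m\<close>; parts 1 and 2 supply the
    connectivity inside \<open>G1\<close> and \<open>G2\<close>.\<close>
  define w where "w j = (if j = 0 then 8 * m - 3 else t)" for j :: nat
  have sumw: "(\<Sum>j<3. w j) \<le> N" using N by (simp add: w_def numeral_3_eq_3)
  obtain X where X: "\<And>j. j < 3 \<Longrightarrow> X j \<subseteq> E" "\<And>i j. i < 3 \<Longrightarrow> j < 3 \<Longrightarrow> i \<noteq> j \<Longrightarrow> X i \<inter> X j = {}"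
    "\<And>j F. j < 3 \<Longrightarrow> F \<subseteq> E \<Longrightarrow> int (w j) * (comps V F - 1) \<le> int (card (X j - F))"
    by (rule partition_connected_packing[OF finV Vne finE ein part _ sumw]) auto
  define X1 X2 where "X1 = X 1" and "X2 = X (2::nat)"
  have X12: "X1 \<subseteq> E" "X2 \<subseteq> E" "X1 \<inter> X2 = {}" using X(1)[of 1] X(1)[of 2] X(2)[of 1 2] by (simp_all add: X1_def X2_def)
  \<comment> \<open>All edges outside \<open>X1\<close> and \<open>X2\<close> are oriented, not only
    part 0, so that none is left over.\<close>
  define G0 where "G0 = E - (X1 \<union> X2)"
  have G0: "G0 \<subseteq> E" "G0 \<inter> X1 = {}" "G0 \<inter> X2 = {}" by (auto simp: G0_def)
  have fins: "finite X1" "finite X2" "finite G0" 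
    by (rule finite_subset[OF X12(1) finE], rule finite_subset[OF X12(2) finE], rule finite_subset[OF G0(1) finE])
  have X0: "X 0 \<subseteq> G0" using X(1)[of 0] X(2)[of 0 1] X(2)[of 0 2] by (auto simp: G0_def X1_def X2_def)
  have E_eq: "E = G0 \<union> (X1 \<union> X2)" using X12 by (auto simp: G0_def)
  have cardE: "card E = card G0 + card X1 + card X2"
  proof -
    have "card E = card G0 + card (X1 \<union> X2)"
      unfolding E_eq by (rule card_Un_disjoint) (use fins in \<open>auto simp: G0_def\<close>)
    then show ?thesis using X12 fins by (simp add: card_Un_disjoint)
  qed
  have sumA: "(\<Sum>x\<in>A. int (deg F x)) = int (card F)" if "F \<subseteq> E" for F
    using sum_deg_all[OF b that] by (metis of_nat_sum)
  have sumB: "(\<Sum>x\<in>B. int (deg F x)) = int (card F)" if "F \<subseteq> E" for F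
    using sum_deg_all[OF bip_sym[OF b] that] by (metis of_nat_sum)
  \<comment> \<open>Chosen so that \<open>X1\<close> together with \<open>Y\<close> has degrees
    divisible by \<open>m\<close> in \<open>A\<close>, and \<open>X2\<close> together with
    \<open>G0 - Y\<close> in \<open>B\<close>. The required sum is then \<open>- card E\<close>,
    which is where the divisibility of the number of edges enters.\<close>
  define r where "r x = (if x \<in> A then - int (deg X1 x) else int (deg G0 x) + int (deg X2 x))" for x
  have m1: "1 \<le> m" using k by (simp add: m_def)
  obtain Y where Y: "Y \<subseteq> G0" "\<And>x. x \<in> A \<union> B \<Longrightarrow> int m dvd int (deg Y x) - r x"
  proof (rule bip_orientation[OF bip_mono[OF b G0(1)] m1, of "A \<union> B" r])
    show "8 * m - 3 \<le> card (crossing G0 S)"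
      if S: "S \<subseteq> A \<union> B" "S \<inter> (A \<union> B) \<noteq> {}" "\<not> A \<union> B \<subseteq> S" for S
    proof -
      have "w 0 \<le> card (crossing (X 0) S)"
      proof (rule crossing_ge_if_partition_connected[OF finV])
        show "int (w 0) * (comps V F - 1) \<le> int (card (X 0 - F))" if "F \<subseteq> X 0" for F
          using X(3)[of 0 F] that X(1)[of 0] by simp
      qed (use S AB in auto)
      also have "\<dots> \<le> card (crossing G0 S)" by (rule crossing_mono[OF fins(3) X0])
      finally show ?thesis by (simp add: w_def)
    qed
    have sets: "A \<inter> (A \<union> B) = A" "A - (A \<union> B) = {}" by auto
    have "(\<Sum>x\<in>A. r x) = - int (card X1)"
      using sumA[OF X12(1)] by (simp add: r_def sum_negf)
    moreover have "(\<Sum>x\<in>B. r x) = (\<Sum>x\<in>B. int (deg G0 x) + int (deg X2 x))"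
      by (intro sum.cong) (use AB in \<open>auto simp: r_def\<close>)
    then have "(\<Sum>x\<in>B. r x) = int (card G0) + int (card X2)"
      by (simp add: sum.distrib sumB[OF G0(1)] sumB[OF X12(2)])
    ultimately have "(\<Sum>x\<in>A \<inter> (A \<union> B). r x) + (\<Sum>x\<in>A - (A \<union> B). int (deg G0 x div 2)) - (\<Sum>x\<in>B. r x)
        = - int (card E)" unfolding cardE sets by simp
    then show "int m dvd (\<Sum>x\<in>A \<inter> (A \<union> B). r x) + (\<Sum>x\<in>A - (A \<union> B). int (deg G0 x div 2)) - (\<Sum>x\<in>B. r x)"
      using dv by simp
  qed (use ne in auto)
  define G1 G2 where "G1 = X1 \<union> Y" and "G2 = X2 \<union> (G0 - Y)"
  have finY: "finite Y" by (rule finite_subset[OF Y(1) fins(3)])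
  have sub: "G1 \<subseteq> E" "G2 \<subseteq> E" "G1 \<inter> G2 = {}" "G1 \<union> G2 = E"
    using X12 G0 Y(1) E_eq by (auto simp: G1_def G2_def)
  have dvd1: "m dvd deg G1 u" if u: "u \<in> A" for u
  proof -
    have "deg G1 u = deg X1 u + deg Y u"
      unfolding G1_def by (rule deg_Un_disjoint) (use fins finY Y(1) G0 in auto)
    then have "int (deg G1 u) = int (deg Y u) - r u" using u by (simp add: r_def)
    then show ?thesis using Y(2)[of u] u by (metis UnI1 int_dvd_int_iff)
  qed
  have dvd2: "m dvd deg G2 v" if v: "v \<in> B" for v
  proof -
    have "deg G2 v = deg X2 v + deg (G0 - Y) v"
      unfolding G2_def by (rule deg_Un_disjoint) (use fins G0 in auto)
    moreover have "deg (G0 - Y) v = deg G0 v - deg Y v" by (rule deg_diff[OF fins(3) Y(1)])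
    moreover have "deg Y v \<le> deg G0 v" by (rule deg_mono[OF fins(3) Y(1)])
    moreover have "v \<notin> A" using v AB by blast
    ultimately have "int (deg G2 v) = - (int (deg Y v) - r v)" by (simp add: r_def of_nat_diff)
    then show ?thesis using Y(2)[of v] v by (metis UnI2 dvd_minus_iff int_dvd_int_iff)
  qed
  have conn1: "int t * (comps (A \<union> B) F - 1) \<le> int (card (X1 - F))" if "F \<subseteq> X1" for F
    using X(3)[of 1 F] that X12 AB by (simp add: w_def X1_def)
  have conn2: "int t * (comps (B \<union> A) F - 1) \<le> int (card (X2 - F))" if "F \<subseteq> X2" for F
    using X(3)[of 2 F] that X12 AB by (simp add: w_def X2_def Un_commute)
  have "has_bistar_decomposition k l G1"
    by (rule one_sided_decomposition[OF bip_mono[OF b sub(1)] ne(2) k dvd1[unfolded m_def] _ conn1 t[unfolded m_def]])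
      (auto simp: G1_def)
  moreover have "has_bistar_decomposition k l G2"
    by (rule one_sided_decomposition[OF bip_mono[OF bip_sym[OF b] sub(2)] ne(1) k dvd2[unfolded m_def] _ conn2 t[unfolded m_def]])
      (auto simp: G2_def)
  ultimately show ?thesis using bistar_decomposition_Un sub(3,4) by metis
qed

text \<open>Here \<open>a = k - 1\<close>, so \<open>a + l\<close> is \<open>m\<close> and
  \<open>8 * a + 6\<close> is \<open>8 * k - 2\<close>. Half the edge-connectivity is
  \<open>6 * l * c + 3 * m - 2\<close>; taking off \<open>8 * m - 3\<close> leaves
  \<open>6 * l * c - 5 * m + 1\<close> for the two thinned parts.\<close>

lemma tree_budget:
  fixes a l c :: nat
  assumes a: "1 \<le> a" "a < l" and c: "2 * (a + l) \<le> c * a"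
  shows "(a + l) * (8 * a + 6) \<le> a * (6 * l * c - 5 * (a + l))" "5 * (a + l) \<le> 6 * l * c"
proof -
  have c5: "5 \<le> c"
  proof (rule ccontr)
    assume "\<not> 5 \<le> c"
    then have "c * a \<le> 4 * a" by (intro mult_le_mono1) simp
    with c have "2 * (a + l) \<le> 4 * a" by (rule le_trans)
    then show False using a by simp
  qed
  have "5 * (a + l) \<le> 6 * l * 5" using a by simp
  also have "\<dots> \<le> 6 * l * c" using c5 by (rule mult_le_mono2)
  finally show "5 * (a + l) \<le> 6 * l * c" .
  have "(a + l) * (13 * a + 6) \<le> 6 * l * c * a"
  \<comment> \<open>For \<open>a \<le> 6\<close> one has
    \<open>13 * a + 6 \<le> 12 * (a + 1) \<le> 12 * l\<close>, and the hypothesis on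
    \<open>c\<close> absorbs the factor \<open>a + l\<close>. For larger \<open>a\<close> the bounds
    \<open>c \<ge> 5\<close> and \<open>a + l \<le> 2 * l\<close> suffice.\<close>
  proof (cases "a \<le> 6")
    case True
    have "(a + l) * (13 * a + 6) \<le> (a + l) * (12 * l)" using a True by (intro mult_le_mono2) simp
    also have "\<dots> = 6 * l * (2 * (a + l))" by simp
    also have "\<dots> \<le> 6 * l * (c * a)" by (intro mult_le_mono2 c)
    finally show ?thesis by (simp add: ac_simps)
  next
    case False
    have "(a + l) * (13 * a + 6) \<le> (2 * l) * (13 * a + 6)" using a by (intro mult_le_mono1) simp
    also have "\<dots> \<le> (2 * l) * (15 * a)" using False by (intro mult_le_mono2) simp
    also have "\<dots> = 6 * l * 5 * a" by simp
    also have "\<dots> \<le> 6 * l * c * a" using c5 by (intro mult_le_mono1 mult_le_mono2)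
    finally show ?thesis .
  qed
  then have "(a + l) * (8 * a + 6) + a * (5 * (a + l)) \<le> a * (6 * l * c)" by (simp add: algebra_simps)
  then show "(a + l) * (8 * a + 6) \<le> a * (6 * l * c - 5 * (a + l))" by (simp add: diff_mult_distrib2)
qed

theorem theorem20:
  fixes k l :: nat
  assumes "1 < k" and "k \<le> l"
  shows "(\<forall>(V :: 'a set) E.
            simple_graph V E \<and> bipartite V E \<and>
            edge_connected
              (12 * l * nat \<lceil>real (2 * (k + l - 1)) / real (k - 1)\<rceil> + 6 * (k + l - 1) - 4) V E \<and>
            (k + l - 1) dvd card E
            \<longrightarrow> has_bistar_decomposition k l E)
       \<and> (\<forall>(V :: 'a set) E.
            simple_graph V E \<and> bipartite V E \<and>
            edge_connected (72 * k + 236) V E \<and> (2 * k) dvd card E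
            \<longrightarrow> has_bistar_decomposition k (k + 1) E)"
proof (intro conjI allI impI; elim conjE)
  fix V :: "'a set" and E
  define c where "c = nat \<lceil>real (2 * (k + l - 1)) / real (k - 1)\<rceil>"
  define m where "m = k + l - 1"
  assume G: "simple_graph V E" "bipartite V E"
    and conn: "edge_connected (12 * l * nat \<lceil>real (2 * (k + l - 1)) / real (k - 1)\<rceil> + 6 * (k + l - 1) - 4) V E"
    and dv: "(k + l - 1) dvd card E"
  have m: "m = (k - 1) + l" using assms by (simp add: m_def)
  have "real (2 * m) / real (k - 1) \<le> real c"
    unfolding c_def m_def by (rule real_nat_ceiling_ge)
  then have "real (2 * m) \<le> real c * real (k - 1)" using assms by (simp add: pos_divide_le_eq)
  then have c: "2 * m \<le> c * (k - 1)" by (metis of_nat_le_iff of_nat_mult)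
  \<comment> \<open>Half of the remaining budget, rounded down; the added one guarantees
    \<open>6 * l * c - 5 * m \<le> 2 * t\<close>.\<close>
  define t where "t = (6 * l * c - 5 * m + 1) div 2"
  have "1 \<le> k - 1" "k - 1 < l" using assms by auto
  note B = tree_budget[OF this c[unfolded m], folded m]
  have "8 * (k - 1) + 6 = 8 * k - 2" using assms by simp
  then have "m * (8 * k - 2) \<le> (k - 1) * (6 * l * c - 5 * m)" using B(1) by simp
  also have "\<dots> \<le> (k - 1) * (2 * t)" unfolding t_def by (intro mult_le_mono2) simp
  finally have t: "m * (8 * k - 2) \<le> 2 * (k - 1) * t" by (simp add: ac_simps)
  have N: "8 * m - 3 + 2 * t \<le> 6 * l * c + 3 * m - 2"
  proof -
    have "2 * t \<le> 6 * l * c - 5 * m + 1" by (simp add: t_def)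
    moreover have "1 \<le> m" using assms by (simp add: m_def)
    ultimately show ?thesis using B(2) by linarith
  qed
  have "2 * (6 * l * c + 3 * m - 2) = 12 * l * c + 6 * m - 4" by (simp add: diff_mult_distrib2 algebra_simps)
  then have "edge_connected (2 * (6 * l * c + 3 * m - 2)) V E" using conn unfolding c_def m_def by simp
  then show "has_bistar_decomposition k l E"
    using bipartite_bistar_decomposition[OF assms G _ dv] N t unfolding m_def by blast
next
  fix V :: "'a set" and E
  assume G: "simple_graph V E" "bipartite V E" and conn: "edge_connected (72 * k + 236) V E"
    and dv: "2 * k dvd card E"
  have conn': "edge_connected (2 * (36 * k + 118)) V E" using conn by (simp add: algebra_simps)
  obtain a where a: "k = a + 2" using that[of "k - 2"] assms(1) by simp
  have m: "k + (k + 1) - 1 = 2 * k" by simp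
  \<comment> \<open>With \<open>m = 2 * k\<close> and half the connectivity equal to
    \<open>36 * k + 118\<close>, the choice \<open>t = 10 * k + 60\<close> uses all but one of the
    budget. Choosing \<open>t\<close> directly avoids the ceiling.\<close>
  have "8 * (2 * k) - 3 + 2 * (10 * k + 60) \<le> 36 * k + 118" using assms(1) by presburger
  moreover have "2 * k * (8 * k - 2) \<le> 2 * (k - 1) * (10 * k + 60)" by (simp add: a algebra_simps)
  ultimately show "has_bistar_decomposition k (k + 1) E"
    by (intro bipartite_bistar_decomposition[OF assms(1) _ G conn', of "k + 1" "10 * k + 60", unfolded m])
      (simp_all only: le_add1 dv)
qed

end
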